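(* Let $(G,c)$ be a resistance network. The network is transient if and only if $f_k:=(\varepsilon_k+\Delta_{\mathcal M})^{-1}\delta_x$ is weak-$*$ convergent for some sequence $\varepsilon_k\to0$.
   Context: A resistance network $(G,c)$ is a connected graph with vertex set $V$ and a conductance function $c_{xy}=c_{yx}\in[0,\infty)$ with $c_{xx}=0$, where $x\sim y$ (adjacency) iff $c_{xy}>0$, and $c(x):=\sum_{y\sim x}c_{xy}<\infty$ for every $x\in V$. The network is transient if the random walk on $V$ with transition probabilities $p(x,y)=c_{xy}/c(x)$ is transient. Fix a reference vertex $o\in V$. The Laplacian is $(\Delta v)(x)=\sum_{y\sim x}c_{xy}(v(x)-v(y))$. The energy form is $\mathcal E(u,v)=\frac12\sum_{x,y\in V}c_{xy}\overline{(u(x)-u(y))}(v(x)-v(y))$, and $\mathrm{dom}\,\mathcal E$ is the set of functions $u$ on $V$ with $\mathcal E(u,u)<\infty$. The energy Hilbert space $\mathcal H_{\mathcal E}$ is the completion of $\mathrm{dom}\,\mathcal E$ modulo constant functions, with inner product $\langle u,v\rangle_{\mathcal E}=\mathcal E(u,v)$; its elements are classes of functions on $V$ modulo constants. Here $x\in V$ is a vertex, $\delta_x$ is the Dirac mass at $x$, regarded as an element of $\mathcal H_{\mathcal E}$, and weak-$*$ convergence is in the Hilbert space $\mathcal H_{\mathcal E}$. For $y\in V$, $v_y\in\mathcal H_{\mathcal E}$ is the unique element with $\langle v_y,u\rangle_{\mathcal E}=u(y)-u(o)$ for all $u\in\mathcal H_{\mathcal E}$. $\mathrm{Fin}$ is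 the closure in $\mathcal H_{\mathcal E}$ of $\mathrm{span}\{\delta_y\}_{y\in V}$, and $P_{\mathrm{Fin}}$ is the orthogonal projection to $\mathrm{Fin}$. A monopole at $y$ is an element $w\in\mathcal H_{\mathcal E}$ with $\Delta w=\delta_y$ pointwise. If monopoles exist, $w_o$ denotes the unique monopole at $o$ of minimal energy, and $w_y^{v}:=v_y+w_o$, $w_y^{f}:=P_{\mathrm{Fin}}v_y+w_o$. The space $\mathcal M$ is the set of finite linear combinations $\mathcal M=\mathrm{span}\{v_y\}_{y\in V}+\mathrm{span}\{w_y^{v},w_y^{f}\}_{y\in V}$, with $\mathcal M=\mathrm{span}\{v_y\}_{y\in V}$ if there are no monopoles in $\mathcal H_{\mathcal E}$. It is dense in $\mathcal H_{\mathcal E}$. $\Delta_{\mathcal M}$ is the operator closure in $\mathcal H_{\mathcal E}$ of the Laplacian $\Delta$ taken with the dense domain $\mathcal M$.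
   Formalization: The vertex set V is assumed infinite: on a finite network with at least two vertices the walk is recurrent although f_k converges (Δ_M is invertible modulo constants), so the claim fails there; the ε_k are taken positive. *)

theory Defs
  imports "HOL-Probability.Probability"
begin

section \<open>Resistance networks and their random walk\<close>

text \<open>The vertex set is the whole type \<open>'v\<close>.  Two vertices are adjacent iff their conductance
  is positive.\<close>

locale resistance_network =
  fixes c :: "'v \<Rightarrow> 'v \<Rightarrow> real"
  assumes conductance_nonneg: "0 \<le> c x y"
    and conductance_sym: "c x y = c y x"
    and no_loops: "c x x = 0"
    and finite_total: "(\<lambda>y. c x y) summable_on {y. 0 < c x y}"
    and connected: "(\<lambda>x y. 0 < c x y)\<^sup>*\<^sup>* x y"

definition total_conductance :: "('v \<Rightarrow> 'v \<Rightarrow> real) \<Rightarrow> 'v \<Rightarrow> real" where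
  "total_conductance c x = (\<Sum>\<^sub>\<infinity>y\<in>{y. 0 < c x y}. c x y)"

text \<open>\<open>embed_pmf\<close> is only meaningful when the transition probabilities sum to one; see
  \<open>pmf_walk_step\<close> below.\<close>

definition walk_step :: "('v \<Rightarrow> 'v \<Rightarrow> real) \<Rightarrow> 'v \<Rightarrow> 'v pmf" where
  "walk_step c x = embed_pmf (\<lambda>y. c x y / total_conductance c x)"

text \<open>The joint law of the positions at times \<open>1, \<dots>, n\<close> of the walk started at \<open>x\<close>.\<close>

primrec walk :: "('v \<Rightarrow> 'v \<Rightarrow> real) \<Rightarrow> nat \<Rightarrow> 'v \<Rightarrow> 'v list pmf" where
  "walk c 0 x = return_pmf []"
| "walk c (Suc n) x = bind_pmf (walk_step c x) (\<lambda>y. map_pmf ((#) y) (walk c n y))"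

text \<open>The events "the walk from \<open>x\<close> is back at \<open>x\<close> at some time in \<open>{1..n}\<close>" increase with
  \<open>n\<close> to the event of ever returning, whose probability is therefore the supremum.\<close>

definition return_probability :: "('v \<Rightarrow> 'v \<Rightarrow> real) \<Rightarrow> 'v \<Rightarrow> real" where
  "return_probability c x = (SUP n. measure_pmf.prob (walk c n x) {ys. x \<in> set ys})"

definition transient :: "('v \<Rightarrow> 'v \<Rightarrow> real) \<Rightarrow> bool" where
  "transient c \<longleftrightarrow> (\<forall>x. return_probability c x < 1)"


section \<open>Functions modulo constants\<close>

definition differ_by_constant :: "('v \<Rightarrow> complex) \<Rightarrow> ('v \<Rightarrow> complex) \<Rightarrow> bool" where
  "differ_by_constant u v \<longleftrightarrow> (\<exists>k. \<forall>x. u x = v x + k)"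

quotient_type 'v potential = "'v \<Rightarrow> complex" / differ_by_constant
  morphisms rep_potential class_of
proof (rule equivpI)
  show "reflp (differ_by_constant :: ('v \<Rightarrow> complex) \<Rightarrow> _)"
    by (auto intro!: reflpI exI[of _ 0] simp: differ_by_constant_def)
  show "symp (differ_by_constant :: ('v \<Rightarrow> complex) \<Rightarrow> _)"
  proof (rule sympI)
    fix u v :: "'v \<Rightarrow> complex"
    assume "differ_by_constant u v"
    then obtain k where "\<forall>x. u x = v x + k" by (auto simp: differ_by_constant_def)
    then have "\<forall>x. v x = u x + (- k)" by simp
    then show "differ_by_constant v u" unfolding differ_by_constant_def by blast
  qed
  show "transp (differ_by_constant :: ('v \<Rightarrow> complex) \<Rightarrow> _)"
  proof (rule transpI)
    fix u v w :: "'v \<Rightarrow> complex"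
    assume "differ_by_constant u v" "differ_by_constant v w"
    then obtain k l where "\<forall>x. u x = v x + k" "\<forall>x. v x = w x + l"
      by (auto simp: differ_by_constant_def)
    then have "\<forall>x. u x = w x + (l + k)" by simp
    then show "differ_by_constant u w" unfolding differ_by_constant_def by blast
  qed
qed

instantiation potential :: (type) ab_group_add
begin

lift_definition zero_potential :: "'a potential" is "\<lambda>_. 0" .

lift_definition plus_potential :: "'a potential \<Rightarrow> 'a potential \<Rightarrow> 'a potential"
  is "\<lambda>u v x. u x + v x"
proof -
  fix u u' v v' :: "'a \<Rightarrow> complex"
  assume "differ_by_constant u u'" "differ_by_constant v v'"
  then obtain k l where "\<forall>x. u x = u' x + k" "\<forall>x. v x = v' x + l"
    by (auto simp: differ_by_constant_def)
  then have "\<forall>x. u x + v x = u' x + v' x + (k + l)" by simp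
  then show "differ_by_constant (\<lambda>x. u x + v x) (\<lambda>x. u' x + v' x)"
    unfolding differ_by_constant_def by blast
qed

lift_definition minus_potential :: "'a potential \<Rightarrow> 'a potential \<Rightarrow> 'a potential"
  is "\<lambda>u v x. u x - v x"
proof -
  fix u u' v v' :: "'a \<Rightarrow> complex"
  assume "differ_by_constant u u'" "differ_by_constant v v'"
  then obtain k l where "\<forall>x. u x = u' x + k" "\<forall>x. v x = v' x + l"
    by (auto simp: differ_by_constant_def)
  then have "\<forall>x. u x - v x = u' x - v' x + (k - l)" by simp
  then show "differ_by_constant (\<lambda>x. u x - v x) (\<lambda>x. u' x - v' x)"
    unfolding differ_by_constant_def by blast
qed

lift_definition uminus_potential :: "'a potential \<Rightarrow> 'a potential" is "\<lambda>u x. - u x"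
proof -
  fix u u' :: "'a \<Rightarrow> complex"
  assume "differ_by_constant u u'"
  then obtain k where "\<forall>x. u x = u' x + k" by (auto simp: differ_by_constant_def)
  then have "\<forall>x. - u x = - u' x + (- k)" by simp
  then show "differ_by_constant (\<lambda>x. - u x) (\<lambda>x. - u' x)"
    unfolding differ_by_constant_def by blast
qed

instance
  by standard (transfer; auto intro!: exI[of _ 0] simp: differ_by_constant_def)+

end

lift_definition scale_potential :: "complex \<Rightarrow> 'v potential \<Rightarrow> 'v potential"
  is "\<lambda>a u x. a * u x"
proof -
  fix a and u u' :: "'v \<Rightarrow> complex"
  assume "differ_by_constant u u'"
  then obtain k where "\<forall>x. u x = u' x + k" by (auto simp: differ_by_constant_def)
  then have "\<forall>x. a * u x = a * u' x + (a * k)" by (simp add: algebra_simps)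
  then show "differ_by_constant (\<lambda>x. a * u x) (\<lambda>x. a * u' x)"
    unfolding differ_by_constant_def by blast
qed

interpretation potential: vector_space "scale_potential :: complex \<Rightarrow> 'v potential \<Rightarrow> 'v potential"
  by standard
    (transfer; auto intro!: exI[of _ 0] simp: differ_by_constant_def algebra_simps)+

lift_definition increment :: "'v potential \<Rightarrow> 'v \<Rightarrow> 'v \<Rightarrow> complex"
  is "\<lambda>u x y. u y - u x"
  by (rule ext)+ (auto simp: differ_by_constant_def)

lift_definition laplacian :: "('v \<Rightarrow> 'v \<Rightarrow> real) \<Rightarrow> 'v potential \<Rightarrow> 'v \<Rightarrow> complex"
  is "\<lambda>c v x. \<Sum>\<^sub>\<infinity>y\<in>{y. 0 < c x y}. complex_of_real (c x y) * (v x - v y)"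
  by (rule ext) (auto simp: differ_by_constant_def intro!: infsum_cong)

definition dirac :: "'v \<Rightarrow> 'v \<Rightarrow> complex" where
  "dirac y = (\<lambda>x. if x = y then 1 else 0)"


section \<open>The energy space\<close>

lift_definition energy :: "('v \<Rightarrow> 'v \<Rightarrow> real) \<Rightarrow> 'v potential \<Rightarrow> 'v potential \<Rightarrow> complex"
  is "\<lambda>c u v. 1 / 2 * (\<Sum>\<^sub>\<infinity>(x, y)\<in>UNIV. complex_of_real (c x y) * cnj (u x - u y) * (v x - v y))"
  by (auto simp: differ_by_constant_def intro!: infsum_cong)

text \<open>The energy of \<open>u\<close> is finite iff the series below converges; since \<open>infsum\<close> is zero for a
  divergent series, finiteness has to be expressed by summability.\<close>

lift_definition finite_energy :: "('v \<Rightarrow> 'v \<Rightarrow> real) \<Rightarrow> 'v potential \<Rightarrow> bool"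
  is "\<lambda>c u. (\<lambda>(x, y). c x y * (cmod (u x - u y))\<^sup>2) summable_on UNIV"
  by (auto simp: differ_by_constant_def intro!: summable_on_cong)

text \<open>Finite-energy functions modulo constants are already complete in the energy norm
  (\<open>energy_space_complete\<close> below), so no separate completion step is taken.\<close>

definition energy_space :: "('v \<Rightarrow> 'v \<Rightarrow> real) \<Rightarrow> 'v potential set" where
  "energy_space c = {u. finite_energy c u}"

definition energy_norm :: "('v \<Rightarrow> 'v \<Rightarrow> real) \<Rightarrow> 'v potential \<Rightarrow> real" where
  "energy_norm c u = sqrt (Re (energy c u u))"

definition energy_tendsto ::
    "('v \<Rightarrow> 'v \<Rightarrow> real) \<Rightarrow> (nat \<Rightarrow> 'v potential) \<Rightarrow> 'v potential \<Rightarrow> bool" where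
  "energy_tendsto c s u \<longleftrightarrow> (\<lambda>n. energy_norm c (s n - u)) \<longlonglongrightarrow> 0"

definition energy_closure :: "('v \<Rightarrow> 'v \<Rightarrow> real) \<Rightarrow> 'v potential set \<Rightarrow> 'v potential set" where
  "energy_closure c S = {u \<in> energy_space c. \<exists>s. range s \<subseteq> S \<and> energy_tendsto c s u}"

definition weak_star_convergent ::
    "('v \<Rightarrow> 'v \<Rightarrow> real) \<Rightarrow> (nat \<Rightarrow> 'v potential) \<Rightarrow> bool" where
  "weak_star_convergent c f \<longleftrightarrow>
    (\<exists>u\<in>energy_space c. \<forall>h\<in>energy_space c. (\<lambda>k. energy c (f k) h) \<longlonglongrightarrow> energy c u h)"

text \<open>The element \<open>v\<^sub>y\<close> for the reference vertex \<open>a\<close>.\<close>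

definition dipole :: "('v \<Rightarrow> 'v \<Rightarrow> real) \<Rightarrow> 'v \<Rightarrow> 'v \<Rightarrow> 'v potential" where
  "dipole c a y =
    (THE v. v \<in> energy_space c \<and> (\<forall>u\<in>energy_space c. energy c v u = increment u a y))"

definition Fin :: "('v \<Rightarrow> 'v \<Rightarrow> real) \<Rightarrow> 'v potential set" where
  "Fin c = energy_closure c (potential.span (range (\<lambda>y. class_of (dirac y))))"

definition proj_Fin :: "('v \<Rightarrow> 'v \<Rightarrow> real) \<Rightarrow> 'v potential \<Rightarrow> 'v potential" where
  "proj_Fin c u = (THE p. p \<in> Fin c \<and> (\<forall>h\<in>Fin c. energy c h (u - p) = 0))"

definition monopole :: "('v \<Rightarrow> 'v \<Rightarrow> real) \<Rightarrow> 'v \<Rightarrow> 'v potential \<Rightarrow> bool" where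
  "monopole c y w \<longleftrightarrow> w \<in> energy_space c \<and> laplacian c w = dirac y"

definition minimal_monopole :: "('v \<Rightarrow> 'v \<Rightarrow> real) \<Rightarrow> 'v \<Rightarrow> 'v potential" where
  "minimal_monopole c a =
    (THE w. monopole c a w \<and> (\<forall>w'. monopole c a w' \<longrightarrow> energy_norm c w \<le> energy_norm c w'))"

definition monopole_v :: "('v \<Rightarrow> 'v \<Rightarrow> real) \<Rightarrow> 'v \<Rightarrow> 'v \<Rightarrow> 'v potential" where
  "monopole_v c a y = dipole c a y + minimal_monopole c a"

definition monopole_f :: "('v \<Rightarrow> 'v \<Rightarrow> real) \<Rightarrow> 'v \<Rightarrow> 'v \<Rightarrow> 'v potential" where
  "monopole_f c a y = proj_Fin c (dipole c a y) + minimal_monopole c a"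


section \<open>The operator \<open>\<Delta>\<^sub>\<M>\<close>\<close>

definition lap_domain :: "('v \<Rightarrow> 'v \<Rightarrow> real) \<Rightarrow> 'v \<Rightarrow> 'v potential set" where
  "lap_domain c a =
    (if \<exists>y w. monopole c y w
     then {u + w | u w. u \<in> potential.span (range (dipole c a)) \<and>
       w \<in> potential.span (range (monopole_v c a) \<union> range (monopole_f c a))}
     else potential.span (range (dipole c a)))"

text \<open>Operators in the energy space are represented by their graphs.\<close>

definition lap_graph :: "('v \<Rightarrow> 'v \<Rightarrow> real) \<Rightarrow> 'v \<Rightarrow> ('v potential \<times> 'v potential) set" where
  "lap_graph c a = {(u, class_of (laplacian c u)) | u. u \<in> lap_domain c a}"

definition graph_closure ::
    "('v \<Rightarrow> 'v \<Rightarrow> real) \<Rightarrow> ('v potential \<times> 'v potential) set \<Rightarrow> ('v potential \<times> 'v potential) set"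
  where
  "graph_closure c T = {(u, g). u \<in> energy_space c \<and> g \<in> energy_space c \<and>
    (\<exists>s t. (\<forall>n. (s n, t n) \<in> T) \<and> energy_tendsto c s u \<and> energy_tendsto c t g)}"

definition lap_closure :: "('v \<Rightarrow> 'v \<Rightarrow> real) \<Rightarrow> 'v \<Rightarrow> ('v potential \<times> 'v potential) set" where
  "lap_closure c a = graph_closure c (lap_graph c a)"

text \<open>The graph of \<open>e + T\<close>; the graph of \<open>(e + T)\<inverse>\<close> is its converse.\<close>

definition shift_operator ::
    "real \<Rightarrow> ('v potential \<times> 'v potential) set \<Rightarrow> ('v potential \<times> 'v potential) set" where
  "shift_operator e T = {(u, scale_potential (complex_of_real e) u + g) | u g. (u, g) \<in> T}"


section \<open>The encodings are as intended\<close>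

context resistance_network
begin

lemma total_conductance_pos:
  assumes "infinite (UNIV :: 'v set)"
  shows "0 < total_conductance c x"
proof -
  obtain y where "y \<noteq> x" using assms by (metis (full_types) UNIV_I finite.simps insertCI rev_finite_subset subsetI)
  then obtain z where z: "0 < c x z"
    using connected[of x y] by (metis converse_rtranclpE)
  have "c x z = (\<Sum>\<^sub>\<infinity>y\<in>{z}. c x y)" by simp
  also have "\<dots> \<le> total_conductance c x"
    unfolding total_conductance_def
    by (rule infsum_mono_neutral) (use finite_total z conductance_nonneg in auto)
  finally show ?thesis using z by simp
qed

lemma pmf_walk_step:
  assumes "infinite (UNIV :: 'v set)"
  shows "pmf (walk_step c x) y = c x y / total_conductance c x"
proof -
  let ?t = "total_conductance c x"
  have pos: "0 < ?t" by (rule total_conductance_pos[OF assms])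
  have "(c x has_sum ?t) {y. 0 < c x y}"
    unfolding total_conductance_def using finite_total by (rule has_sum_infsum)
  then have "(c x has_sum ?t) UNIV"
    by (rule has_sum_cong_neutral[THEN iffD1, rotated -1])
      (use conductance_nonneg in \<open>auto simp: not_less intro: antisym\<close>)
  then have hs: "((\<lambda>y. c x y / ?t) has_sum 1) UNIV"
    using pos has_sum_divide_const[where f = "c x" and S = ?t and A = UNIV and c = ?t] by simp
  have nn: "0 \<le> c x y / ?t" for y
    using pos conductance_nonneg by simp
  have "Infinite_Sum.abs_summable_on (\<lambda>y. c x y / ?t) UNIV"
    using has_sum_imp_summable[OF hs] unfolding real_norm_def abs_of_nonneg[OF nn] .
  then have abs: "Infinite_Set_Sum.abs_summable_on (\<lambda>y. c x y / ?t) UNIV"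
    unfolding abs_summable_equivalent .
  have "(\<integral>\<^sup>+y. ennreal (c x y / ?t) \<partial>count_space UNIV)
      = ennreal (infsetsum (\<lambda>y. c x y / ?t) UNIV)"
    using abs nn unfolding infsetsum_def Infinite_Set_Sum.abs_summable_on_def
    by (intro nn_integral_eq_integral) auto
  also have "infsetsum (\<lambda>y. c x y / ?t) UNIV = 1"
    using abs hs by (simp add: infsetsum_infsum infsumI)
  finally have "(\<integral>\<^sup>+y. ennreal (c x y / ?t) \<partial>count_space UNIV) = 1"
    by simp
  then show ?thesis
    unfolding walk_step_def by (subst pmf_embed_pmf) (use nn in auto)
qed

lemma finite_energy_iff:
  "finite_energy c u \<longleftrightarrow> (\<lambda>(x, y). c x y * (cmod (increment u x y))\<^sup>2) summable_on UNIV"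
  by transfer (simp add: norm_minus_commute)

lemma Re_energy_self:
  "Re (energy c u u) = 1 / 2 * (\<Sum>\<^sub>\<infinity>(x, y)\<in>UNIV. c x y * (cmod (increment u x y))\<^sup>2)"
proof transfer
  fix c :: "'v \<Rightarrow> 'v \<Rightarrow> real" and u :: "'v \<Rightarrow> complex"
  have "complex_of_real (c x y) * cnj (u x - u y) * (u x - u y)
      = complex_of_real (c x y * (cmod (u y - u x))\<^sup>2)" for x y
    by (metis (no_types) complex_norm_square mult.assoc mult.commute norm_minus_commute of_real_mult)
  then have "(\<Sum>\<^sub>\<infinity>(x, y)\<in>UNIV. complex_of_real (c x y) * cnj (u x - u y) * (u x - u y))
      = (\<Sum>\<^sub>\<infinity>z\<in>UNIV. complex_of_real (case z of (x, y) \<Rightarrow> c x y * (cmod (u y - u x))\<^sup>2))"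
    by (intro infsum_cong) (simp add: case_prod_beta)
  also have "\<dots> = complex_of_real (\<Sum>\<^sub>\<infinity>(x, y)\<in>UNIV. c x y * (cmod (u y - u x))\<^sup>2)"
  proof (cases "(\<lambda>(x, y). c x y * (cmod (u y - u x))\<^sup>2) summable_on UNIV")
    case True
    then show ?thesis
      by (intro infsumI) (simp only: has_sum_of_real_iff has_sum_infsum)
  next
    case False
    then have "\<not> (\<lambda>z. complex_of_real (case z of (x, y) \<Rightarrow> c x y * (cmod (u y - u x))\<^sup>2)) summable_on UNIV"
      using summable_on_Re by fastforce
    with False show ?thesis by (simp add: infsum_not_exists)
  qed
  finally show "Re (1 / 2 * (\<Sum>\<^sub>\<infinity>(x, y)\<in>UNIV. complex_of_real (c x y) * cnj (u x - u y) * (u x - u y)))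
      = 1 / 2 * (\<Sum>\<^sub>\<infinity>(x, y)\<in>UNIV. c x y * (cmod (u y - u x))\<^sup>2)"
    by simp
qed

lemma increment_diff: "increment (u - v) x y = increment u x y - increment v x y"
  by transfer simp

lemma increment_class_of: "increment (class_of u) x y = u y - u x"
  by transfer simp

lemma finite_energy_diff:
  assumes "finite_energy c u" "finite_energy c v"
  shows "finite_energy c (u - v)"
proof -
  let ?q = "\<lambda>w (x, y). c x y * (cmod (increment w x y))\<^sup>2"
  have "(\<lambda>z. 2 * ?q u z + 2 * ?q v z) summable_on UNIV"
    using assms unfolding finite_energy_iff by (intro summable_on_add summable_on_cmult_right)
  moreover have "?q (u - v) z \<le> 2 * ?q u z + 2 * ?q v z" for z
  proof -
    obtain x y where z: "z = (x, y)" by (cases z)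
    let ?a = "cmod (increment u x y)" and ?b = "cmod (increment v x y)"
    have "(cmod (increment (u - v) x y))\<^sup>2 \<le> (?a + ?b)\<^sup>2"
      by (intro power_mono) (auto simp: increment_diff norm_triangle_ineq4)
    also have "\<dots> \<le> 2 * ?a\<^sup>2 + 2 * ?b\<^sup>2"
      using sum_squares_bound[of ?a ?b] by (simp add: power2_sum)
    finally have "c x y * (cmod (increment (u - v) x y))\<^sup>2 \<le> c x y * (2 * ?a\<^sup>2 + 2 * ?b\<^sup>2)"
      by (intro mult_left_mono conductance_nonneg)
    then show ?thesis by (simp add: z algebra_simps)
  qed
  ultimately show ?thesis
    unfolding finite_energy_iff
    by (rule summable_on_comparison_test) (auto simp: conductance_nonneg)
qed

lemma edge_le_energy_norm:
  assumes "finite_energy c u"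
  shows "c x y * (cmod (increment u x y))\<^sup>2 \<le> 2 * (energy_norm c u)\<^sup>2"
proof -
  let ?q = "\<lambda>(x, y). c x y * (cmod (increment u x y))\<^sup>2"
  have nn: "0 \<le> infsum ?q UNIV"
    by (rule infsum_nonneg) (auto simp: conductance_nonneg)
  have "sum ?q {(x, y)} \<le> infsum ?q UNIV"
    using assms unfolding finite_energy_iff
    by (intro finite_sum_le_infsum) (auto simp: conductance_nonneg)
  then show ?thesis
    using nn by (simp add: energy_norm_def Re_energy_self)
qed

lemma energy_norm_nonneg: "0 \<le> energy_norm c w"
  unfolding energy_norm_def Re_energy_self
  by (auto intro!: infsum_nonneg simp: conductance_nonneg)

lemma energy_space_complete:
  assumes s: "\<And>n. s n \<in> energy_space c"
    and cauchy: "\<And>e. 0 < e \<Longrightarrow> \<exists>N. \<forall>m\<ge>N. \<forall>n\<ge>N. energy_norm c (s m - s n) < e"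
  shows "\<exists>u\<in>energy_space c. energy_tendsto c s u"
proof -
  have fin: "finite_energy c (s n)" for n
    using s by (simp add: energy_space_def)
  have edge: "Cauchy (\<lambda>n. increment (s n) x y)" if xy: "0 < c x y" for x y
  proof (rule metric_CauchyI)
    fix e :: real assume e: "0 < e"
    obtain N where N: "\<forall>m\<ge>N. \<forall>n\<ge>N. energy_norm c (s m - s n) < e * sqrt (c x y / 2)"
      using cauchy[of "e * sqrt (c x y / 2)"] e xy by auto
    have "dist (increment (s m) x y) (increment (s n) x y) < e" if "m \<ge> N" "n \<ge> N" for m n
    proof -
      let ?d = "cmod (increment (s m - s n) x y)"
      have "c x y * ?d\<^sup>2 \<le> 2 * (energy_norm c (s m - s n))\<^sup>2"
        by (intro edge_le_energy_norm finite_energy_diff fin)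
      also have "\<dots> < 2 * (e * sqrt (c x y / 2))\<^sup>2"
        using N that energy_norm_nonneg[of "s m - s n"] by (simp add: power_strict_mono)
      also have "\<dots> = c x y * e\<^sup>2"
        using xy by (simp add: power_mult_distrib)
      finally have "?d\<^sup>2 < e\<^sup>2" using xy by simp
      then have "?d < e" using e by (meson less_imp_le power_less_imp_less_base)
      then show ?thesis by (simp add: increment_diff dist_norm)
    qed
    then show "\<exists>N. \<forall>m\<ge>N. \<forall>n\<ge>N. dist (increment (s m) x y) (increment (s n) x y) < e"
      by blast
  qed
  have all: "convergent (\<lambda>n. increment (s n) x y)" for x y
    using connected[of x y]
  proof (induction rule: rtranclp_induct)
    case base
    have "increment w x x = 0" for w :: "'v potential" by transfer simp
    then show ?case by (simp add: convergent_const)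
  next
    case (step y z)
    have "increment w x z = increment w x y + increment w y z" for w :: "'v potential"
      by transfer simp
    then show ?case
      using convergent_add[OF step.IH Cauchy_convergent[OF edge[OF step.hyps(2)]]] by simp
  qed
  fix a :: 'v
  obtain l where l: "\<And>y. (\<lambda>n. increment (s n) a y) \<longlonglongrightarrow> l y"
    using all[of a] unfolding convergent_def by metis
  define u where "u = class_of l"
  have inc: "(\<lambda>n. increment (s n) x y) \<longlonglongrightarrow> increment u x y" for x y
  proof -
    have split: "increment w x y = increment w a y - increment w a x" for w :: "'v potential"
      by transfer simp
    have "(\<lambda>n. increment (s n) a y - increment (s n) a x) \<longlonglongrightarrow> l y - l x"
      by (intro tendsto_diff l)
    then show ?thesis
      unfolding split[of "s _"] by (simp add: u_def increment_class_of)
  qed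
  let ?q = "\<lambda>w (x, y). c x y * (cmod (increment w x y))\<^sup>2"
  have q_nonneg: "0 \<le> ?q w z" for w z
    by (auto simp: conductance_nonneg split: prod.split)
  have main: "\<exists>N. \<forall>m\<ge>N. finite_energy c (s m - u) \<and> energy_norm c (s m - u) \<le> e"
    if e: "0 < e" for e :: real
  proof -
    obtain N where N: "\<forall>m\<ge>N. \<forall>n\<ge>N. energy_norm c (s m - s n) < e"
      using cauchy[OF e] by auto
    have "finite_energy c (s m - u) \<and> energy_norm c (s m - u) \<le> e" if m: "m \<ge> N" for m
    proof -
      have partial: "sum (?q (s m - u)) F \<le> 2 * e\<^sup>2" if F: "finite F" for F
      proof (rule tendsto_upperbound)
        show "(\<lambda>n. sum (?q (s m - s n)) F) \<longlonglongrightarrow> sum (?q (s m - u)) F"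
          unfolding case_prod_beta increment_diff by (intro tendsto_intros inc)
        show "\<forall>\<^sub>F n in sequentially. sum (?q (s m - s n)) F \<le> 2 * e\<^sup>2"
          using eventually_ge_at_top[of N]
        proof eventually_elim
          fix n assume n: "n \<ge> N"
          have fd: "finite_energy c (s m - s n)" by (intro finite_energy_diff fin)
          have nn: "0 \<le> infsum (?q (s m - s n)) UNIV" by (intro infsum_nonneg q_nonneg)
          have "sum (?q (s m - s n)) F \<le> infsum (?q (s m - s n)) UNIV"
            using fd F q_nonneg unfolding finite_energy_iff by (intro finite_sum_le_infsum) auto
          also have "\<dots> = 2 * (energy_norm c (s m - s n))\<^sup>2"
            using nn by (simp add: energy_norm_def Re_energy_self)
          also have "\<dots> \<le> 2 * e\<^sup>2"
            using N m n energy_norm_nonneg[of "s m - s n"]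
            by (simp add: power_mono less_imp_le)
          finally show "sum (?q (s m - s n)) F \<le> 2 * e\<^sup>2" .
        qed
      qed simp
      have summ: "?q (s m - u) summable_on UNIV"
        by (rule nonneg_bounded_partial_sums_imp_summable_on[where C = "2 * e\<^sup>2"])
          (use q_nonneg partial in \<open>auto intro!: eventually_finite_subsets_at_top_weakI\<close>)
      have "infsum (?q (s m - u)) UNIV \<le> 2 * e\<^sup>2"
        by (rule infsum_le_finite_sums[OF summ partial])
      then have "energy_norm c (s m - u) \<le> e"
        using e unfolding energy_norm_def Re_energy_self
        by (intro real_le_lsqrt) auto
      with summ show ?thesis by (simp add: finite_energy_iff)
    qed
    then show ?thesis by blast
  qed
  obtain m where "finite_energy c (s m - u)" using main[of 1] by auto
  then have "finite_energy c (s m - (s m - u))" by (rule finite_energy_diff[OF fin])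
  also have "s m - (s m - u) = u" by (simp add: algebra_simps)
  finally have "u \<in> energy_space c" by (simp add: energy_space_def)
  moreover have "energy_tendsto c s u"
    unfolding energy_tendsto_def
  proof (rule LIMSEQ_I)
    fix r :: real assume "0 < r"
    then obtain N where N: "\<forall>m\<ge>N. energy_norm c (s m - u) \<le> r / 2"
      using main[of "r / 2"] by auto
    have "norm (energy_norm c (s m - u) - 0) < r" if "m \<ge> N" for m
      using N that \<open>0 < r\<close> energy_norm_nonneg[of "s m - u"] by fastforce
    then show "\<exists>N. \<forall>m\<ge>N. norm (energy_norm c (s m - u) - 0) < r" by blast
  qed
  ultimately show ?thesis by blast
qed

end

end

theory Submission
  imports Defs
begin

text \<open>Transience at \<open>x\<close> is equivalent to a capacity bound \<open>|f(x)|\<^sup>2 \<le> C \<parallel>f\<parallel>\<^sup>2\<close> for finitely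
  supported \<open>f\<close>.  One direction is Picone's inequality for the superharmonic hitting probability;
  conversely, on a recurrent network the hitting functions of killed walks are finitely supported,
  tend to 1 and have energy tending to 0.

  If the resolvents converge weakly, the limit \<open>u\<close> has \<open>\<Delta>u = \<delta>\<^sub>x + K\<close> for a constant \<open>K\<close>.  Pairing
  with a sequence of finitely supported functions tending to 1 with energy tending to 0 is then
  impossible, because \<open>V\<close> is infinite.

  If the network is transient, the capacity bound and the Riesz theorem give a monopole.  A vector
  \<open>g\<close> orthogonal to the range of \<open>\<epsilon> + \<Delta>\<^sub>\<M>\<close> is orthogonal to all \<open>w\<^sub>y\<^sup>v - w\<^sub>y\<^sup>f\<close>, hence lies in Fin,
  and is represented by a function \<open>D\<close> with \<open>\<Delta>D = -\<epsilon>D\<close>; testing with truncations of \<open>D\<close> shows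
  \<open>g = 0\<close>.  So the resolvents exist, and they converge in norm to \<open>w\<^sub>x\<^sup>f\<close>, which lies in the closure
  of the range of \<open>\<Delta>\<^sub>\<M>\<close>.\<close>

section \<open>The energy inner product\<close>

text \<open>The quotient by constants is the main obstacle: the Laplacian of a class is a genuine
  function, whereas an equation between classes fixes functions only up to a constant, and
  \<epsilon> + \<Delta> mixes the two. On a transient network the monopole removes the ambiguity.
  Pairing with \<open>monopole_v c a y\<close> returns the value at \<open>y\<close> of a finitely
  supported representative, so for \<open>g\<close> in Fin it selects the representative
  \<open>D\<close> that is the pointwise limit of finitely supported approximants, and the
  eigenvalue equation holds without a constant. The approximants themselves are unsuitable as test
  functions, since their products with \<open>D\<close> have no definite sign; cutting
  \<open>D\<close> down to their modulus gives finite support, the right sign and bounded energy at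
  once. Solvability rests on positivity: \<Delta>u has finite support for u in the domain, so by
  Gauss-Green the pairing of u with \<Delta>u is the sum of |\<Delta>u|^2. The resulting lower bound
  for \<epsilon> + \<Delta> makes preimages of a convergent sequence Cauchy, so that a dense range
  is enough.\<close>

lemma increment_add: "increment (u + v) x y = increment u x y + increment v x y"
  by transfer simp

lemma increment_scale: "increment (scale_potential k u) x y = k * increment u x y"
  by transfer (simp add: algebra_simps)

lemma increment_zero [simp]: "increment 0 x y = 0"
  by transfer simp

lemma increment_self [simp]: "increment u x x = 0"
  by transfer simp

lemma increment_cocycle: "increment u x y = increment u a y - increment u a x"
  by transfer simp

lemma potential_eqI:
  assumes "\<And>y. increment u a y = increment v a y"
  shows "u = v"
  using assms
proof transfer
  fix u v :: "'a \<Rightarrow> complex" and a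
  assume *: "\<And>y. u y - u a = v y - v a"
  have "u y = v y + (u a - v a)" for y
    using *[of y] by (simp add: algebra_simps)
  then show "differ_by_constant u v" unfolding differ_by_constant_def by blast
qed

text \<open>\<open>increment u a\<close> is the representative that vanishes at
  \<open>a\<close>.\<close>

lemma class_of_increment: "class_of (increment u a) = u"
  by (rule potential_eqI[of _ a])
    (use increment_cocycle[of u] in \<open>simp add: Defs.increment.abs_eq\<close>)

lemma class_of_add: "class_of (\<lambda>y. f y + g y) = class_of f + class_of g"
  by (rule plus_potential.abs_eq[symmetric])

lemma class_of_diff: "class_of (\<lambda>y. f y - g y) = class_of f - class_of g"
  by (rule minus_potential.abs_eq[symmetric])

lemma class_of_scale: "class_of (\<lambda>y. k * f y) = scale_potential k (class_of f)"
  by (rule scale_potential.abs_eq[symmetric])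

lemma class_of_add_constant: "class_of (\<lambda>y. f y + k) = class_of f"
  unfolding potential.abs_eq_iff differ_by_constant_def by blast

lemma diff_eq_scale: "u - v = u + scale_potential (- 1) v"
  by simp

text \<open>The summand over ordered pairs is kept apart from the series because
  \<open>infsum\<close> is additive only on summable families.\<close>

definition edge_term ::
    "('v \<Rightarrow> 'v \<Rightarrow> real) \<Rightarrow> 'v potential \<Rightarrow> 'v potential \<Rightarrow> 'v \<times> 'v \<Rightarrow> complex" where
  "edge_term c u v = (\<lambda>(x, y). complex_of_real (c x y) * cnj (increment u x y) * increment v x y)"

lemma energy_edge_term: "energy c u v = 1 / 2 * (\<Sum>\<^sub>\<infinity>z\<in>UNIV. edge_term c u v z)"
  unfolding edge_term_def
  by transfer (simp add: algebra_simps cong: infsum_cong)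

lemma edge_term_add: "edge_term c u (v + w) z = edge_term c u v z + edge_term c u w z"
  by (simp add: edge_term_def increment_add algebra_simps split: prod.split)

lemma edge_term_scale: "edge_term c u (scale_potential k v) z = k * edge_term c u v z"
  by (simp add: edge_term_def increment_scale algebra_simps split: prod.split)

lemma edge_term_cnj: "edge_term c v u z = cnj (edge_term c u v z)"
  by (simp add: edge_term_def algebra_simps split: prod.split)

lemma edge_term_self: "edge_term c u u (x, y) = complex_of_real (c x y * (cmod (increment u x y))\<^sup>2)"
  unfolding edge_term_def case_prod_conv
  by (metis (no_types) complex_norm_square mult.assoc mult.commute of_real_mult)

context resistance_network
begin

lemma norm_edge_term:
  "cmod (edge_term c u v (x, y)) = c x y * (cmod (increment u x y) * cmod (increment v x y))"
  using conductance_nonneg by (simp add: edge_term_def norm_mult)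

lemma edge_term_abs_summable:
  assumes "u \<in> energy_space c" "v \<in> energy_space c"
  shows "(\<lambda>z. cmod (edge_term c u v z)) summable_on UNIV"
proof (rule summable_on_comparison_test)
  let ?q = "\<lambda>w (x, y). c x y * (cmod (increment w x y))\<^sup>2"
  show "(\<lambda>z. ?q u z + ?q v z) summable_on UNIV"
    using assms unfolding energy_space_def mem_Collect_eq finite_energy_iff
    by (intro summable_on_add)
  show "cmod (edge_term c u v z) \<le> ?q u z + ?q v z" for z
  proof -
    obtain x y where z: "z = (x, y)" by (cases z)
    let ?a = "cmod (increment u x y)" and ?b = "cmod (increment v x y)"
    have "2 * (?a * ?b) \<le> ?a\<^sup>2 + ?b\<^sup>2"
      using sum_squares_bound[of ?a ?b] by (simp add: mult.assoc)
    moreover have "0 \<le> ?a * ?b" by simp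
    ultimately have "?a * ?b \<le> ?a\<^sup>2 + ?b\<^sup>2" by linarith
    then show ?thesis
      unfolding z norm_edge_term case_prod_conv distrib_left[symmetric]
      by (rule mult_left_mono[OF _ conductance_nonneg])
  qed
qed simp

lemma edge_term_summable:
  assumes "u \<in> energy_space c" "v \<in> energy_space c"
  shows "edge_term c u v summable_on UNIV"
  using edge_term_abs_summable[OF assms] by (rule abs_summable_summable)

lemma energy_space_diff:
  "u \<in> energy_space c \<Longrightarrow> v \<in> energy_space c \<Longrightarrow> u - v \<in> energy_space c"
  by (simp add: energy_space_def finite_energy_diff)

lemma energy_space_scale:
  assumes "u \<in> energy_space c"
  shows "scale_potential k u \<in> energy_space c"
proof -
  have "(\<lambda>z. (cmod k)\<^sup>2 * (case z of (x, y) \<Rightarrow> c x y * (cmod (increment u x y))\<^sup>2)) summable_on UNIV"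
    using assms unfolding energy_space_def mem_Collect_eq finite_energy_iff
    by (rule summable_on_cmult_right)
  then show ?thesis
    unfolding energy_space_def mem_Collect_eq finite_energy_iff
    by (simp add: increment_scale norm_mult power_mult_distrib case_prod_unfold mult.left_commute)
qed

lemma energy_space_zero: "0 \<in> energy_space c"
  by (simp add: energy_space_def finite_energy_iff case_prod_unfold)

lemma energy_space_add:
  assumes "u \<in> energy_space c" "v \<in> energy_space c"
  shows "u + v \<in> energy_space c"
proof -
  have "u - scale_potential (- 1) v \<in> energy_space c"
    by (intro energy_space_diff energy_space_scale assms)
  then show ?thesis by simp
qed

lemma subspace_energy_space: "potential.subspace (energy_space c)"
  unfolding potential.subspace_def
  using energy_space_zero energy_space_add energy_space_scale by blast

lemma energy_add_right:
  assumes "u \<in> energy_space c" "v \<in> energy_space c" "w \<in> energy_space c"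
  shows "energy c u (v + w) = energy c u v + energy c u w"
  unfolding energy_edge_term edge_term_add
  by (simp add: infsum_add[OF edge_term_summable edge_term_summable] assms algebra_simps)

text \<open>Holds for arbitrary classes: a nonzero factor preserves divergence, and
  \<open>infsum\<close> is 0 on divergent series.\<close>

lemma energy_scale_right: "energy c u (scale_potential k v) = k * energy c u v"
  unfolding energy_edge_term edge_term_scale by (simp add: infsum_cmult_right')

lemma energy_cnj: "energy c v u = cnj (energy c u v)"
  unfolding energy_edge_term edge_term_cnj[of c v u] by simp

lemma energy_diff_right:
  assumes "u \<in> energy_space c" "v \<in> energy_space c" "w \<in> energy_space c"
  shows "energy c u (v - w) = energy c u v - energy c u w"
  unfolding diff_eq_scale[of v w]
  by (simp only: energy_add_right energy_scale_right energy_space_scale assms) simp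

lemma energy_add_left:
  assumes "u \<in> energy_space c" "v \<in> energy_space c" "w \<in> energy_space c"
  shows "energy c (v + w) u = energy c v u + energy c w u"
  using energy_add_right[OF assms] by (metis complex_cnj_add energy_cnj)

lemma energy_scale_left: "energy c (scale_potential k v) u = cnj k * energy c v u"
  using energy_scale_right by (metis complex_cnj_mult energy_cnj)

lemma energy_diff_left:
  assumes "u \<in> energy_space c" "v \<in> energy_space c" "w \<in> energy_space c"
  shows "energy c (v - w) u = energy c v u - energy c w u"
  using energy_diff_right[OF assms] by (metis complex_cnj_diff energy_cnj)

lemma energy_self: "energy c u u = complex_of_real ((energy_norm c u)\<^sup>2)"
proof -
  have "Im (energy c u u) = 0"
    using energy_cnj[of u u] by (simp add: complex_eq_iff)
  moreover have "0 \<le> Re (energy c u u)"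
    unfolding Re_energy_self by (auto intro!: infsum_nonneg simp: conductance_nonneg)
  ultimately show ?thesis by (simp add: energy_norm_def complex_eq_iff)
qed

lemma Re_energy_norm: "Re (energy c u u) = (energy_norm c u)\<^sup>2"
  by (simp add: energy_self)

text \<open>Zero energy kills the increment along each edge; connectedness carries this to all pairs
  of vertices.\<close>

lemma energy_norm_eq_0:
  assumes "u \<in> energy_space c" "energy_norm c u = 0"
  shows "u = 0"
proof (rule potential_eqI)
  fix a y :: 'v
  have edge: "increment u x y = 0" if "0 < c x y" for x y
    using edge_le_energy_norm[of u x y] assms that
    by (simp add: energy_space_def mult_le_0_iff)
  show "increment u a y = increment 0 a y"
    using connected[of a y]
  proof (induction rule: rtranclp_induct)
    case (step y z)
    then show ?case using edge[of y z] increment_cocycle[of u y z a] by simp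
  qed simp
qed

lemma energy_norm_add_sq:
  assumes "u \<in> energy_space c" "v \<in> energy_space c"
  shows "(energy_norm c (u + v))\<^sup>2
    = (energy_norm c u)\<^sup>2 + 2 * Re (energy c u v) + (energy_norm c v)\<^sup>2"
proof -
  have "energy c (u + v) (u + v) = energy c u u + energy c u v + (energy c v u + energy c v v)"
    by (simp add: energy_add_left energy_add_right energy_space_add assms)
  then have "Re (energy c (u + v) (u + v)) = Re (energy c u u) + 2 * Re (energy c u v) + Re (energy c v v)"
    using energy_cnj[of v u] by simp
  then show ?thesis by (simp only: Re_energy_norm)
qed

lemma energy_norm_scale: "energy_norm c (scale_potential k u) = cmod k * energy_norm c u"
proof -
  have "energy c (scale_potential k u) (scale_potential k u) = (cnj k * k) * energy c u u"
    by (simp add: energy_scale_left energy_scale_right)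
  also have "cnj k * k = complex_of_real ((cmod k)\<^sup>2)"
    by (metis complex_norm_square mult.commute)
  finally have "(energy_norm c (scale_potential k u))\<^sup>2 = (cmod k)\<^sup>2 * (energy_norm c u)\<^sup>2"
    by (metis Re_complex_of_real Re_energy_norm energy_self of_real_mult)
  then show ?thesis
    by (metis energy_norm_nonneg mult_nonneg_nonneg norm_ge_zero power2_eq_iff_nonneg power_mult_distrib)
qed

lemma energy_norm_zero [simp]: "energy_norm c 0 = 0"
  using energy_norm_scale[of 0 0] by simp

lemma energy_norm_minus: "energy_norm c (u - v) = energy_norm c (v - u)"
  using energy_norm_scale[of "- 1" "v - u"] by simp

lemma energy_Cauchy_Schwarz:
  assumes u: "u \<in> energy_space c" and v: "v \<in> energy_space c"
  shows "cmod (energy c u v) \<le> energy_norm c u * energy_norm c v"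
proof (cases "energy_norm c v = 0")
  case True
  then have "v = 0" using energy_norm_eq_0 v by blast
  then show ?thesis using energy_scale_right[of u 0 0] by simp
next
  case False
  let ?N = "energy_norm c v" and ?e = "energy c u v"
  have N: "0 < ?N" using False energy_norm_nonneg[of v] by simp
  \<comment> \<open>The coefficient that minimises the norm of
    \<open>u + scale_potential k v\<close>.\<close>
  define k where "k = - cnj ?e / complex_of_real (?N\<^sup>2)"
  have "0 \<le> (energy_norm c (u + scale_potential k v))\<^sup>2" by simp
  also have "\<dots> = (energy_norm c u)\<^sup>2 + 2 * Re (k * ?e) + (cmod k * ?N)\<^sup>2"
    by (simp add: energy_norm_add_sq u v energy_space_scale energy_scale_right energy_norm_scale)
  also have "k * ?e = complex_of_real (- (cmod ?e)\<^sup>2 / ?N\<^sup>2)"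
    unfolding k_def
    by (metis (no_types, opaque_lifting) complex_norm_square mult.commute mult_minus_left of_real_divide of_real_minus times_divide_eq_left)
  also have "(cmod k * ?N)\<^sup>2 = (cmod ?e)\<^sup>2 / ?N\<^sup>2"
    unfolding k_def using N by (simp add: norm_divide norm_mult power_divide power_mult_distrib field_simps power2_eq_square del: of_real_power)
  finally have "(cmod ?e)\<^sup>2 / ?N\<^sup>2 \<le> (energy_norm c u)\<^sup>2" by simp
  then have "(cmod ?e)\<^sup>2 \<le> (energy_norm c u * ?N)\<^sup>2"
    using N by (simp add: field_simps power_mult_distrib)
  then show ?thesis
    by (rule power2_le_imp_le) (simp add: energy_norm_nonneg)
qed

lemma energy_norm_triangle:
  assumes u: "u \<in> energy_space c" and v: "v \<in> energy_space c"
  shows "energy_norm c (u + v) \<le> energy_norm c u + energy_norm c v"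
proof (rule power2_le_imp_le)
  have "Re (energy c u v) \<le> energy_norm c u * energy_norm c v"
    using energy_Cauchy_Schwarz[OF u v] complex_Re_le_cmod order_trans by blast
  then show "(energy_norm c (u + v))\<^sup>2 \<le> (energy_norm c u + energy_norm c v)\<^sup>2"
    by (simp add: energy_norm_add_sq u v power2_sum)
qed (simp add: energy_norm_nonneg)

lemma energy_norm_triangle_diff:
  assumes "u \<in> energy_space c" "v \<in> energy_space c" "w \<in> energy_space c"
  shows "energy_norm c (u - w) \<le> energy_norm c (u - v) + energy_norm c (v - w)"
  using energy_norm_triangle[of "u - v" "v - w"] by (simp add: energy_space_diff assms)

lemma parallelogram:
  assumes "u \<in> energy_space c" "v \<in> energy_space c"
  shows "(energy_norm c (u - v))\<^sup>2
    = 2 * (energy_norm c u)\<^sup>2 + 2 * (energy_norm c v)\<^sup>2 - (energy_norm c (u + v))\<^sup>2"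
  using energy_norm_add_sq[of u v] energy_norm_add_sq[of u "scale_potential (- 1) v"]
    energy_scale_right[of u "- 1" v] energy_norm_scale[of "- 1" v]
  unfolding diff_eq_scale[of u v]
  by (simp add: assms energy_space_scale del: potential.scale_minus_left)

section \<open>Continuity of the energy form and limits in the energy norm\<close>

lemma energy_tendsto_energy_right:
  assumes s: "\<And>n. s n \<in> energy_space c" and u: "u \<in> energy_space c" and h: "h \<in> energy_space c"
    and lim: "energy_tendsto c s u"
  shows "(\<lambda>n. energy c h (s n)) \<longlonglongrightarrow> energy c h u"
proof -
  have "(\<lambda>n. energy c h (s n) - energy c h u) \<longlonglongrightarrow> 0"
  proof (rule Lim_null_comparison)
    show "\<forall>\<^sub>F n in sequentially. norm (energy c h (s n) - energy c h u)
        \<le> energy_norm c h * energy_norm c (s n - u)"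
      using energy_Cauchy_Schwarz[OF h energy_space_diff[OF s u]]
      by (simp add: energy_diff_right s u h)
    show "(\<lambda>n. energy_norm c h * energy_norm c (s n - u)) \<longlonglongrightarrow> 0"
      using tendsto_mult_left[of "\<lambda>n. energy_norm c (s n - u)" 0 sequentially "energy_norm c h"] lim
      by (simp add: energy_tendsto_def)
  qed
  then show ?thesis by (simp add: LIM_zero_iff)
qed

lemma energy_tendsto_energy_left:
  assumes "\<And>n. s n \<in> energy_space c" "u \<in> energy_space c" "h \<in> energy_space c"
    and "energy_tendsto c s u"
  shows "(\<lambda>n. energy c (s n) h) \<longlonglongrightarrow> energy c u h"
proof -
  have "energy c v h = cnj (energy c h v)" for v by (rule energy_cnj)
  then show ?thesis using tendsto_cnj[OF energy_tendsto_energy_right[OF assms]] by simp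
qed

lemma energy_tendsto_norm:
  assumes s: "\<And>n. s n \<in> energy_space c" and u: "u \<in> energy_space c"
    and lim: "energy_tendsto c s u"
  shows "(\<lambda>n. energy_norm c (s n)) \<longlonglongrightarrow> energy_norm c u"
proof -
  have "(\<lambda>n. energy_norm c (s n) - energy_norm c u) \<longlonglongrightarrow> 0"
  proof (rule Lim_null_comparison)
    show "\<forall>\<^sub>F n in sequentially. norm (energy_norm c (s n) - energy_norm c u) \<le> energy_norm c (s n - u)"
    proof (intro always_eventually allI)
      fix n
      show "norm (energy_norm c (s n) - energy_norm c u) \<le> energy_norm c (s n - u)"
        using energy_norm_triangle[of "s n - u" u] energy_norm_triangle[of "u - s n" "s n"]
          energy_norm_minus[of u "s n"]
        by (simp add: s u energy_space_diff)
    qed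
    show "(\<lambda>n. energy_norm c (s n - u)) \<longlonglongrightarrow> 0"
      using lim by (simp add: energy_tendsto_def)
  qed
  then show ?thesis by (simp add: LIM_zero_iff)
qed

lemma energy_tendsto_add:
  assumes "\<And>n. s n \<in> energy_space c" "u \<in> energy_space c" "energy_tendsto c s u"
    and "\<And>n. t n \<in> energy_space c" "v \<in> energy_space c" "energy_tendsto c t v"
  shows "energy_tendsto c (\<lambda>n. s n + t n) (u + v)"
  unfolding energy_tendsto_def
proof (rule Lim_null_comparison)
  show "\<forall>\<^sub>F n in sequentially. norm (energy_norm c (s n + t n - (u + v)))
      \<le> energy_norm c (s n - u) + energy_norm c (t n - v)"
  proof (intro always_eventually allI)
    fix n
    have "s n + t n - (u + v) = (s n - u) + (t n - v)" by simp
    note eq = this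
    show "norm (energy_norm c (s n + t n - (u + v)))
        \<le> energy_norm c (s n - u) + energy_norm c (t n - v)"
      using energy_norm_triangle[of "s n - u" "t n - v"] energy_norm_nonneg
      unfolding eq by (simp only: assms energy_space_diff real_norm_def abs_of_nonneg)
  qed
  show "(\<lambda>n. energy_norm c (s n - u) + energy_norm c (t n - v)) \<longlonglongrightarrow> 0"
    using tendsto_add[OF assms(3,6)[unfolded energy_tendsto_def]] by simp
qed

lemma energy_tendsto_scale:
  assumes "energy_tendsto c s u"
  shows "energy_tendsto c (\<lambda>n. scale_potential k (s n)) (scale_potential k u)"
  unfolding energy_tendsto_def potential.scale_right_diff_distrib[symmetric] energy_norm_scale
  using tendsto_mult_left[OF assms[unfolded energy_tendsto_def], of "cmod k"] by simp

lemma energy_tendsto_diff: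
  assumes "\<And>n. s n \<in> energy_space c" "u \<in> energy_space c" "energy_tendsto c s u"
    and "\<And>n. t n \<in> energy_space c" "v \<in> energy_space c" "energy_tendsto c t v"
  shows "energy_tendsto c (\<lambda>n. s n - t n) (u - v)"
  unfolding diff_eq_scale[of _ v] diff_eq_scale[of "s _"]
  by (intro energy_tendsto_add energy_tendsto_scale energy_space_scale assms)

lemma energy_tendsto_Cauchy:
  assumes s: "\<And>n. s n \<in> energy_space c" and u: "u \<in> energy_space c"
    and lim: "energy_tendsto c s u" and e: "0 < e"
  shows "\<exists>N. \<forall>m\<ge>N. \<forall>n\<ge>N. energy_norm c (s m - s n) < e"
proof -
  obtain N where N: "\<And>n. n \<ge> N \<Longrightarrow> energy_norm c (s n - u) < e / 2"
    using order_tendstoD(2)[OF lim[unfolded energy_tendsto_def], of "e / 2"] e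
    by (auto simp: eventually_sequentially)
  have "energy_norm c (s m - s n) < e" if "m \<ge> N" "n \<ge> N" for m n
    using energy_norm_triangle_diff[OF s[of m] u s[of n]] N[OF that(1)] N[OF that(2)]
      energy_norm_minus[of u "s n"] by simp
  then show ?thesis by blast
qed

section \<open>Closures, Riesz representation and orthogonal projection\<close>

lemma energy_closure_subset: "energy_closure c D \<subseteq> energy_space c"
  by (auto simp: energy_closure_def)

lemma energy_closureI:
  "u \<in> energy_space c \<Longrightarrow> (\<And>n. s n \<in> D) \<Longrightarrow> energy_tendsto c s u \<Longrightarrow> u \<in> energy_closure c D"
  by (auto simp: energy_closure_def)

lemma energy_closureD:
  assumes "u \<in> energy_closure c D"
  shows "\<exists>s. (\<forall>n. s n \<in> D) \<and> energy_tendsto c s u"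
proof -
  from assms obtain s where "range s \<subseteq> D" "energy_tendsto c s u"
    by (auto simp: energy_closure_def)
  then show ?thesis by (intro exI[of _ s]) auto
qed

text \<open>The Riesz vector is the limit of a minimising sequence in \<open>D\<close> of
  \<open>\<parallel>h\<parallel>\<^sup>2 - 2 Re (L h)\<close>; it need not belong to \<open>D\<close>.\<close>

lemma Riesz_subspace:
  fixes L :: "'v potential \<Rightarrow> complex"
  assumes DH: "D \<subseteq> energy_space c" and D: "potential.subspace D"
    and L_add: "\<And>u v. u \<in> D \<Longrightarrow> v \<in> D \<Longrightarrow> L (u + v) = L u + L v"
    and L_scale: "\<And>k u. u \<in> D \<Longrightarrow> L (scale_potential k u) = k * L u"
    and L_bound: "\<And>u. u \<in> D \<Longrightarrow> cmod (L u) \<le> B * energy_norm c u"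
  shows "\<exists>p\<in>energy_closure c D. \<forall>h\<in>D. energy c p h = L h"
proof -
  let ?J = "\<lambda>h. (energy_norm c h)\<^sup>2 - 2 * Re (L h)"
  have H: "h \<in> energy_space c" if "h \<in> D" for h using DH that by blast
  have D0: "0 \<in> D" and Dadd: "\<And>u v. u \<in> D \<Longrightarrow> v \<in> D \<Longrightarrow> u + v \<in> D"
    and Dscale: "\<And>k u. u \<in> D \<Longrightarrow> scale_potential k u \<in> D"
    using D by (auto simp: potential.subspace_def)
  \<comment> \<open>Completing the square: the functional is at least
    \<open>(energy_norm c h - B)^2 - B^2\<close>.\<close>
  have lower: "- B\<^sup>2 \<le> ?J h" if "h \<in> D" for h
  proof -
    have "Re (L h) \<le> B * energy_norm c h"
      using L_bound[OF that] complex_Re_le_cmod order_trans by blast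
    moreover have "0 \<le> (energy_norm c h - B)\<^sup>2" by simp
    ultimately show ?thesis by (simp add: power2_diff algebra_simps)
  qed
  define m where "m = Inf (?J ` D)"
  have bdd: "bdd_below (?J ` D)" using lower by (auto intro!: bdd_belowI2)
  have m: "m \<le> ?J h" if "h \<in> D" for h
    unfolding m_def using bdd that by (auto intro: cInf_lower)
  have "\<exists>h\<in>D. ?J h < m + inverse (real (Suc n))" for n
  proof -
    have "Inf (?J ` D) < m + inverse (real (Suc n))" unfolding m_def[symmetric] by simp
    then show ?thesis using cInf_lessD[of "?J ` D"] D0 by fastforce
  qed
  then obtain s where sD: "\<And>n. s n \<in> D" and sJ: "\<And>n. ?J (s n) < m + inverse (real (Suc n))"
    by metis
  have sH: "s n \<in> energy_space c" for n using H sD by blast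
  have dist: "(energy_norm c (s i - s j))\<^sup>2 \<le> 2 * inverse (real (Suc i)) + 2 * inverse (real (Suc j))" for i j
  proof -
    \<comment> \<open>The midpoint of two near-minimisers cannot fall below the infimum, so the
      parallelogram law forces them together.\<close>
    have "4 * m \<le> 4 * ?J (scale_potential (1 / 2) (s i + s j))"
      using m[OF Dscale[OF Dadd[OF sD sD]]] by (simp only: mult_le_cancel_left_pos zero_less_numeral)
    also have "\<dots> = (energy_norm c (s i + s j))\<^sup>2 - 4 * (Re (L (s i)) + Re (L (s j)))"
      by (simp add: energy_norm_scale L_scale L_add sD Dadd power_mult_distrib power2_eq_square) (simp add: field_simps)
    finally show ?thesis
      using sJ[of i] sJ[of j] parallelogram[OF sH[of i] sH[of j]] by simp
  qed
  have "\<exists>N. \<forall>i\<ge>N. \<forall>j\<ge>N. energy_norm c (s i - s j) < e" if e: "0 < e" for e :: real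
  proof -
    obtain N where N: "inverse (real (Suc N)) < e\<^sup>2 / 4"
      using reals_Archimedean[of "e\<^sup>2 / 4"] e by auto
    have "energy_norm c (s i - s j) < e" if "i \<ge> N" "j \<ge> N" for i j
    proof -
      have "inverse (real (Suc i)) \<le> inverse (real (Suc N))" "inverse (real (Suc j)) \<le> inverse (real (Suc N))"
        using that by (auto intro!: le_imp_inverse_le)
      then have "(energy_norm c (s i - s j))\<^sup>2 < e\<^sup>2" using dist[of i j] N by linarith
      then show ?thesis using e by (meson less_imp_le power_less_imp_less_base)
    qed
    then show ?thesis by blast
  qed
  then obtain p where p: "p \<in> energy_space c" and lim: "energy_tendsto c s p"
    using energy_space_complete[of s, OF sH] by blast
  have Re_eq: "Re (energy c p h) = Re (L h)" if h: "h \<in> D" for h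
  proof -
    let ?d = "Re (energy c p h) - Re (L h)"
    \<comment> \<open>First variation: a shift by \<open>t h\<close> cannot push the functional
      below \<open>m\<close>, while \<open>s n\<close> exceeds \<open>m\<close> by less than
      \<open>1/(n+1)\<close>.\<close>
    have quad: "0 \<le> 2 * t * ?d + t\<^sup>2 * (energy_norm c h)\<^sup>2" for t :: real
    proof (rule tendsto_lowerbound)
      let ?th = "scale_potential (complex_of_real t) h"
      show "(\<lambda>n. inverse (real (Suc n)) + 2 * t * (Re (energy c (s n) h) - Re (L h))
          + t\<^sup>2 * (energy_norm c h)\<^sup>2) \<longlonglongrightarrow> 2 * t * ?d + t\<^sup>2 * (energy_norm c h)\<^sup>2"
      proof -
        have "(\<lambda>n. inverse (real (Suc n)) + 2 * t * (Re (energy c (s n) h) - Re (L h))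
          + t\<^sup>2 * (energy_norm c h)\<^sup>2) \<longlonglongrightarrow> 0 + 2 * t * ?d + t\<^sup>2 * (energy_norm c h)\<^sup>2"
          by (intro tendsto_intros LIMSEQ_inverse_real_of_nat
              energy_tendsto_energy_left[OF sH p H[OF h] lim])
        then show ?thesis by simp
      qed
      have "0 \<le> inverse (real (Suc n)) + 2 * t * (Re (energy c (s n) h) - Re (L h))
          + t\<^sup>2 * (energy_norm c h)\<^sup>2" for n
      proof -
        have "m \<le> ?J (s n + ?th)" by (rule m[OF Dadd[OF sD Dscale[OF h]]])
        then show ?thesis
          using sJ[of n]
          by (simp add: energy_norm_add_sq sH H h energy_space_scale energy_scale_right
              energy_norm_scale L_add L_scale sD Dscale power_mult_distrib algebra_simps)
      qed
      then show "\<forall>\<^sub>F n in sequentially. 0 \<le> inverse (real (Suc n))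
          + 2 * t * (Re (energy c (s n) h) - Re (L h)) + t\<^sup>2 * (energy_norm c h)\<^sup>2"
        by simp
    qed simp
    show ?thesis
    proof (rule ccontr)
      assume ne: "Re (energy c p h) \<noteq> Re (L h)"
      \<comment> \<open>The bound is tested at \<open>t = - ?d / ?N\<close>; the added 1 keeps the
        denominator positive when \<open>h\<close> has norm 0.\<close>
      let ?N = "(energy_norm c h)\<^sup>2 + 1"
      have alg: "2 * (- d / N) * d + (- d / N)\<^sup>2 * N = - d\<^sup>2 / N" if "0 < N" for d N :: real
        using that by (simp add: field_simps power2_eq_square)
      have N: "0 < ?N" by (meson add_nonneg_pos zero_le_power2 zero_less_one)
      have "0 \<le> 2 * (- ?d / ?N) * ?d + (- ?d / ?N)\<^sup>2 * (energy_norm c h)\<^sup>2" by (rule quad)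
      also have "\<dots> \<le> 2 * (- ?d / ?N) * ?d + (- ?d / ?N)\<^sup>2 * ?N"
        by (intro add_left_mono mult_left_mono) auto
      also have "\<dots> = - ?d\<^sup>2 / ?N" by (rule alg[OF N])
      finally show False using N ne by (simp add: divide_le_0_iff zero_le_divide_iff)
    qed
  qed
  have "energy c p h = L h" if h: "h \<in> D" for h
  proof (rule complex_eqI)
    show "Re (energy c p h) = Re (L h)" by (rule Re_eq[OF h])
    \<comment> \<open>Multiplying \<open>h\<close> by \<open>\<i>\<close> turns the imaginary part
      into a real part.\<close>
    show "Im (energy c p h) = Im (L h)"
      using Re_eq[OF Dscale[OF h, of \<i>]] by (simp add: energy_scale_right L_scale h)
  qed
  moreover have "p \<in> energy_closure c D" using p sD lim by (rule energy_closureI)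
  ultimately show ?thesis by blast
qed

text \<open>Riesz for the functional \<open>energy c u\<close> restricted to \<open>D\<close>;
  \<open>orthogonal_closure\<close> later extends the orthogonality from \<open>D\<close> to its
  closure.\<close>

lemma orthogonal_projection:
  assumes DH: "D \<subseteq> energy_space c" and D: "potential.subspace D" and u: "u \<in> energy_space c"
  shows "\<exists>p\<in>energy_closure c D. \<forall>h\<in>D. energy c (u - p) h = 0"
proof -
  have "\<exists>p\<in>energy_closure c D. \<forall>h\<in>D. energy c p h = energy c u h"
    by (rule Riesz_subspace[OF DH D, where B = "energy_norm c u"])
      (use DH u energy_Cauchy_Schwarz in \<open>auto simp: energy_add_right energy_scale_right subset_iff\<close>)
  then obtain p where p: "p \<in> energy_closure c D" "\<forall>h\<in>D. energy c p h = energy c u h" by blast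
  have "energy c (u - p) h = 0" if "h \<in> D" for h
    using p that DH u energy_closure_subset[of D] by (subst energy_diff_left) auto
  with p(1) show ?thesis by blast
qed

lemma orthogonal_closure:
  assumes DH: "D \<subseteq> energy_space c" and w: "w \<in> energy_space c"
    and orth: "\<And>h. h \<in> D \<Longrightarrow> energy c w h = 0" and p: "p \<in> energy_closure c D"
  shows "energy c w p = 0"
proof -
  obtain s where s: "\<And>n. s n \<in> D" "energy_tendsto c s p" using energy_closureD[OF p] by blast
  have "(\<lambda>n. energy c w (s n)) \<longlonglongrightarrow> energy c w p"
    using DH s p energy_closure_subset w by (intro energy_tendsto_energy_right) auto
  then show ?thesis using orth[OF s(1)] by (simp add: LIMSEQ_const_iff)
qed

lemma subspace_energy_closure:
  assumes DH: "D \<subseteq> energy_space c" and D: "potential.subspace D"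
  shows "potential.subspace (energy_closure c D)"
  unfolding potential.subspace_def
proof (intro conjI ballI allI)
  have D0: "0 \<in> D" and Dadd: "\<And>u v. u \<in> D \<Longrightarrow> v \<in> D \<Longrightarrow> u + v \<in> D"
    and Dscale: "\<And>k u. u \<in> D \<Longrightarrow> scale_potential k u \<in> D"
    using D by (auto simp: potential.subspace_def)
  have H: "u \<in> energy_space c" if "u \<in> energy_closure c D" for u
    using that energy_closure_subset by blast
  show "0 \<in> energy_closure c D"
    using energy_norm_scale[of 0 0]
    by (intro energy_closureI[where s = "\<lambda>_. 0"]) (auto simp: D0 energy_space_zero energy_tendsto_def)
  fix u assume u: "u \<in> energy_closure c D"
  obtain s where s: "\<And>n. s n \<in> D" "energy_tendsto c s u" using energy_closureD[OF u] by blast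
  show "scale_potential k u \<in> energy_closure c D" for k
    by (rule energy_closureI[OF energy_space_scale[OF H[OF u]] Dscale[OF s(1)] energy_tendsto_scale[OF s(2)]])
  fix v assume v: "v \<in> energy_closure c D"
  obtain t where t: "\<And>n. t n \<in> D" "energy_tendsto c t v" using energy_closureD[OF v] by blast
  show "u + v \<in> energy_closure c D"
  proof (rule energy_closureI[OF energy_space_add[OF H[OF u] H[OF v]] Dadd[OF s(1) t(1)]])
    show "energy_tendsto c (\<lambda>n. s n + t n) (u + v)"
      using DH by (intro energy_tendsto_add s t H u v subsetD[OF DH])
  qed
qed

end

section \<open>Finitely supported functions and the Gauss-Green identity\<close>

definition finitely_supported :: "'v potential set" where
  "finitely_supported = {class_of f | f. finite {x. f x \<noteq> 0}}"

lemma class_of_sum: "class_of (\<lambda>y. \<Sum>i\<in>I. g i y) = (\<Sum>i\<in>I. class_of (g i))"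
proof (induction I rule: infinite_finite_induct)
  case (insert i I)
  then show ?case by (simp add: class_of_add)
qed (simp_all add: zero_potential.abs_eq)

lemma finite_support_dirac [simp]: "finite {x. dirac y x \<noteq> 0}"
  by (simp add: dirac_def)

lemma dirac_finitely_supported: "class_of (dirac y) \<in> finitely_supported"
  unfolding finitely_supported_def
  by (rule CollectI, rule exI[of _ "dirac y"]) simp

lemma subspace_finitely_supported: "potential.subspace finitely_supported"
  unfolding potential.subspace_def
proof (intro conjI ballI allI)
  show "0 \<in> finitely_supported"
    unfolding finitely_supported_def zero_potential.abs_eq by (rule CollectI) (auto intro!: exI[of _ "\<lambda>_. 0"])
  fix u :: "'v potential" assume "u \<in> finitely_supported"
  then obtain f where f: "u = class_of f" "finite {x. f x \<noteq> 0}"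
    unfolding finitely_supported_def by blast
  show "scale_potential k u \<in> finitely_supported" for k
  proof -
    have "finite {x. k * f x \<noteq> 0}" by (rule finite_subset[OF _ f(2)]) auto
    then show ?thesis unfolding finitely_supported_def f(1) class_of_scale[symmetric] by blast
  qed
  fix v :: "'v potential" assume "v \<in> finitely_supported"
  then obtain g where g: "v = class_of g" "finite {x. g x \<noteq> 0}"
    unfolding finitely_supported_def by blast
  have "finite {x. f x + g x \<noteq> 0}"
    by (rule finite_subset[OF _ finite_UnI[OF f(2) g(2)]]) auto
  then show "u + v \<in> finitely_supported"
    unfolding finitely_supported_def f(1) g(1) class_of_add[symmetric] by blast
qed

lemma span_dirac: "potential.span (range (\<lambda>y. class_of (dirac y))) = finitely_supported"
proof
  have "range (\<lambda>y :: 'v. class_of (dirac y)) \<subseteq> finitely_supported"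
    using dirac_finitely_supported by (rule image_subsetI)
  then show "potential.span (range (\<lambda>y :: 'v. class_of (dirac y))) \<subseteq> finitely_supported"
    by (rule potential.span_minimal[OF _ subspace_finitely_supported])
  show "finitely_supported \<subseteq> potential.span (range (\<lambda>y :: 'v. class_of (dirac y)))"
  proof
    fix u :: "'v potential" assume "u \<in> finitely_supported"
    then obtain f where f: "u = class_of f" "finite {x. f x \<noteq> 0}"
      unfolding finitely_supported_def by blast
    have "f = (\<lambda>y. \<Sum>x | f x \<noteq> 0. f x * dirac x y)"
    proof
      fix y
      have "(\<Sum>x | f x \<noteq> 0. f x * dirac x y) = (\<Sum>x | f x \<noteq> 0. if x = y then f y else 0)"
        by (intro sum.cong) (auto simp: dirac_def)
      also have "\<dots> = f y" using f(2) by simp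
      finally show "f y = (\<Sum>x | f x \<noteq> 0. f x * dirac x y)" by (rule sym)
    qed
    then have "u = class_of (\<lambda>y. \<Sum>x | f x \<noteq> 0. f x * dirac x y)"
      unfolding f(1) by (rule arg_cong[where f = class_of])
    also have "\<dots> = (\<Sum>x | f x \<noteq> 0. scale_potential (f x) (class_of (dirac x)))"
      by (simp only: class_of_sum class_of_scale)
    also have "\<dots> \<in> potential.span (range (\<lambda>y. class_of (dirac y)))"
      by (rule potential.span_sum, rule potential.span_scale, rule potential.span_base) (rule rangeI)
    finally show "u \<in> potential.span (range (\<lambda>y. class_of (dirac y)))" .
  qed
qed

text \<open>Recovers the constant lost in the quotient, so that evaluation at a vertex becomes a
  functional on finitely supported classes.\<close>

definition finite_rep :: "'v potential \<Rightarrow> 'v \<Rightarrow> complex" where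
  "finite_rep u = (THE f. finite {x. f x \<noteq> 0} \<and> class_of f = u)"

text \<open>Two finitely supported representatives differ by a constant, seen to be 0 at a vertex
  outside both supports; infinitude supplies that vertex.\<close>

lemma finite_rep_class_of:
  fixes f :: "'v \<Rightarrow> complex"
  assumes inf: "infinite (UNIV :: 'v set)" and f: "finite {x. f x \<noteq> 0}"
  shows "finite_rep (class_of f) = f"
  unfolding finite_rep_def
proof (rule the_equality)
  fix g :: "'v \<Rightarrow> complex" assume g: "finite {x. g x \<noteq> 0} \<and> class_of g = class_of f"
  then obtain k where k: "\<And>x. g x = f x + k"
    unfolding potential.abs_eq_iff differ_by_constant_def by blast
  have "finite ({x. f x \<noteq> 0} \<union> {x. g x \<noteq> 0})" using f g by simp
  then obtain x where "x \<notin> {x. f x \<noteq> 0} \<union> {x. g x \<noteq> 0}" using inf ex_new_if_finite by blast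
  then have "k = 0" using k[of x] by simp
  then show "g = f" using k by auto
qed (simp add: f)

lemma finitely_supportedE:
  assumes "infinite (UNIV :: 'v set)" "(u :: 'v potential) \<in> finitely_supported"
  shows "finite {x. finite_rep u x \<noteq> 0}" "class_of (finite_rep u) = u"
proof -
  obtain f where f: "u = class_of f" "finite {x. f x \<noteq> 0}"
    using assms(2) unfolding finitely_supported_def by blast
  show "finite {x. finite_rep u x \<noteq> 0}" "class_of (finite_rep u) = u"
    by (simp_all add: f finite_rep_class_of[OF assms(1)])
qed

section \<open>Summation by rows and the Gauss-Green identity\<close>

lemma has_sum_finite_rows:
  fixes g :: "'a \<times> 'b \<Rightarrow> 'c :: topological_comm_monoid_add"
  assumes F: "finite F" and row: "\<And>x. x \<in> F \<Longrightarrow> ((\<lambda>y. g (x, y)) has_sum S x) UNIV"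
    and zero: "\<And>x y. x \<notin> F \<Longrightarrow> g (x, y) = 0"
  shows "(g has_sum sum S F) UNIV"
proof -
  have "(g has_sum sum S F) (F \<times> UNIV)"
    using F row
  proof (induction F rule: finite_induct)
    case (insert x F)
    have "(g has_sum S x) (Pair x ` UNIV)"
      by (subst has_sum_reindex) (use insert.prems in \<open>auto simp: o_def inj_on_def\<close>)
    then have "(g has_sum S x + sum S F) (Pair x ` UNIV \<union> F \<times> UNIV)"
      using insert by (intro has_sum_Un_disjoint insert.IH) auto
    also have "Pair x ` UNIV \<union> F \<times> UNIV = insert x F \<times> UNIV" by auto
    finally show ?case using insert by simp
  qed simp
  then show ?thesis
    by (rule has_sum_cong_neutral[THEN iffD1, rotated -1]) (use zero in auto)
qed

lemma laplacian_increment: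
  assumes "\<And>x y. 0 \<le> c x y"
  shows "laplacian c v x = (\<Sum>\<^sub>\<infinity>y\<in>UNIV. complex_of_real (c x y) * increment v y x)"
  using assms
proof transfer
  fix c :: "'a \<Rightarrow> 'a \<Rightarrow> real" and v :: "'a \<Rightarrow> complex" and x
  assume nn: "\<And>x y. 0 \<le> c x y"
  have "c x y = 0" if "\<not> 0 < c x y" for y using nn[of x y] that by linarith
  then show "(\<Sum>\<^sub>\<infinity>y\<in>{y. 0 < c x y}. complex_of_real (c x y) * (v x - v y))
      = (\<Sum>\<^sub>\<infinity>y\<in>UNIV. complex_of_real (c x y) * (v x - v y))"
    by (intro infsum_cong_neutral) auto
qed

context resistance_network
begin

lemma has_sum_conductance: "(c x has_sum total_conductance c x) UNIV"
proof -
  have "(c x has_sum total_conductance c x) {y. 0 < c x y}"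
    unfolding total_conductance_def using finite_total by (rule has_sum_infsum)
  then show ?thesis
    by (rule has_sum_cong_neutral[THEN iffD1, rotated -1])
      (use conductance_nonneg in \<open>auto simp: not_less intro: antisym\<close>)
qed

text \<open>Expanding \<open>cnj (f x - f y)\<close> splits the double series into a part on
  finitely many rows and its transpose; by symmetry of \<open>c\<close> their sums agree, whence the
  factor 2. Assuming only convergent rows admits bounded \<open>v\<close> of infinite energy, as
  \<open>picone\<close> requires.\<close>

lemma gauss_green:
  assumes fin: "finite {x. f x \<noteq> 0}"
    and row: "\<And>x. (\<lambda>y. complex_of_real (c x y) * increment v y x) summable_on UNIV"
  shows "(edge_term c (class_of f) v has_sum 2 * (\<Sum>x | f x \<noteq> 0. cnj (f x) * laplacian c v x)) UNIV"
proof -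
  define g where "g = (\<lambda>(x, y). cnj (f x) * (complex_of_real (c x y) * increment v y x))"
  let ?S = "\<Sum>x | f x \<noteq> 0. cnj (f x) * laplacian c v x"
  have g: "(g has_sum ?S) UNIV"
  proof (rule has_sum_finite_rows[OF fin])
    show "((\<lambda>y. g (x, y)) has_sum cnj (f x) * laplacian c v x) UNIV" for x
      unfolding g_def case_prod_conv laplacian_increment[of c v, OF conductance_nonneg]
      by (intro has_sum_cmult_right has_sum_infsum row)
  qed (auto simp: g_def)
  then have "((\<lambda>(x, y). g (y, x)) has_sum ?S) UNIV"
    using has_sum_swap[where f = g and S = ?S and A = UNIV and B = UNIV] by simp
  from has_sum_add[OF g this]
  have "((\<lambda>z. g z + (case z of (x, y) \<Rightarrow> g (y, x))) has_sum 2 * ?S) UNIV" by simp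
  moreover have "edge_term c (class_of f) v z = g z + (case z of (x, y) \<Rightarrow> g (y, x))" for z
  proof -
    obtain x y where z: "z = (x, y)" by (cases z)
    have "increment v y x = - increment v x y" using increment_cocycle[of v y x x] by simp
    then show ?thesis
      by (simp add: z g_def edge_term_def increment_class_of conductance_sym[of y x] algebra_simps)
  qed
  then have "edge_term c (class_of f) v = (\<lambda>z. g z + (case z of (x, y) \<Rightarrow> g (y, x)))" by (rule ext)
  ultimately show ?thesis by (simp only:)
qed

lemma row_summable_bounded:
  assumes "\<And>x y. cmod (increment v x y) \<le> B"
  shows "(\<lambda>y. complex_of_real (c x y) * increment v y x) summable_on UNIV"
proof (rule abs_summable_summable, rule summable_on_comparison_test)
  show "(\<lambda>y. c x y * B) summable_on UNIV"
    using has_sum_conductance by (intro summable_on_cmult_left has_sum_imp_summable)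
  show "cmod (complex_of_real (c x y) * increment v y x) \<le> c x y * B" for y
    using assms[of y x] conductance_nonneg by (simp add: norm_mult mult_left_mono)
qed simp

text \<open>From \<open>t \<le> 1 + t^2\<close>, each term is at most \<open>c x y\<close> plus its
  energy term, and both are summable over \<open>y\<close>.\<close>

lemma row_summable_energy_space:
  assumes "v \<in> energy_space c"
  shows "(\<lambda>y. complex_of_real (c x y) * increment v y x) summable_on UNIV"
proof (rule abs_summable_summable, rule summable_on_comparison_test)
  have "(\<lambda>z. case z of (x, y) \<Rightarrow> c x y * (cmod (increment v x y))\<^sup>2) summable_on Pair x ` UNIV"
    using assms unfolding energy_space_def mem_Collect_eq finite_energy_iff
    by (rule summable_on_subset) simp
  then have "(\<lambda>y. c x y * (cmod (increment v x y))\<^sup>2) summable_on UNIV"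
    by (subst (asm) summable_on_reindex) (auto simp: o_def inj_on_def)
  then show "(\<lambda>y. c x y + c x y * (cmod (increment v x y))\<^sup>2) summable_on UNIV"
    by (rule summable_on_add[OF has_sum_imp_summable[OF has_sum_conductance]])
  show "cmod (complex_of_real (c x y) * increment v y x) \<le> c x y + c x y * (cmod (increment v x y))\<^sup>2" for y
  proof -
    have "increment v y x = - increment v x y" using increment_cocycle[of v y x x] by simp
    moreover have "t \<le> 1 + t\<^sup>2" for t :: real
      using zero_le_power2[of "t - 1 / 2"] by (simp add: power2_eq_square algebra_simps)
    then have "c x y * cmod (increment v x y) \<le> c x y * (1 + (cmod (increment v x y))\<^sup>2)"
      by (rule mult_left_mono[OF _ conductance_nonneg])
    ultimately show ?thesis using conductance_nonneg by (simp add: norm_mult algebra_simps)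
  qed
qed simp

lemma finite_support_bounded:
  assumes "finite {x. f x \<noteq> 0}"
  shows "cmod (f x) \<le> (\<Sum>x | f x \<noteq> 0. cmod (f x))"
proof (cases "f x = 0")
  case False
  then show ?thesis using assms by (intro member_le_sum) auto
qed (simp add: sum_nonneg)

lemma finite_support_energy_space:
  assumes f: "finite {x. f x \<noteq> 0}"
  shows "class_of f \<in> energy_space c"
proof -
  define B where "B = (\<Sum>x | f x \<noteq> 0. cmod (f x))"
  have B: "cmod (f x) \<le> B" for x unfolding B_def by (rule finite_support_bounded[OF f])
  have "cmod (increment (class_of f) x y) \<le> B + B" for x y
    unfolding increment_class_of by (rule norm_triangle_le_diff[OF add_mono[OF B B]])
  \<comment> \<open>Gauss-Green with \<open>class_of f\<close> in both places: a finitely supported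
    function is bounded, and summable edge terms mean finite energy.\<close>
  from gauss_green[OF f row_summable_bounded[OF this]]
  have "edge_term c (class_of f) (class_of f) summable_on UNIV" by (rule has_sum_imp_summable)
  from summable_on_Re[OF this]
  have "(\<lambda>(x, y). c x y * (cmod (increment (class_of f) x y))\<^sup>2) summable_on UNIV"
    unfolding case_prod_unfold
    by (rule summable_on_cong[THEN iffD1, rotated])
      (metis Re_complex_of_real edge_term_self prod.collapse)
  then show ?thesis by (simp add: energy_space_def finite_energy_iff)
qed

lemma finitely_supported_subset: "finitely_supported \<subseteq> energy_space c"
  using finite_support_energy_space by (auto simp: finitely_supported_def)

lemma energy_finite_support:
  assumes "finite {x. f x \<noteq> 0}" "v \<in> energy_space c"
  shows "energy c (class_of f) v = (\<Sum>x | f x \<noteq> 0. cnj (f x) * laplacian c v x)"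
  using infsumI[OF gauss_green[OF assms(1) row_summable_energy_space[OF assms(2)]]]
  by (simp add: energy_edge_term)

text \<open>Dirac masses represent evaluation of the Laplacian, which is thereby a bounded linear
  functional. Linearity of \<open>laplacian\<close> and its passage to limits are drawn from
  here.\<close>

lemma energy_dirac:
  assumes "v \<in> energy_space c"
  shows "energy c (class_of (dirac y)) v = laplacian c v y"
proof -
  have "{x. dirac y x \<noteq> 0} = {y}" by (auto simp: dirac_def)
  then have "energy c (class_of (dirac y)) v = (\<Sum>x\<in>{y}. cnj (dirac y x) * laplacian c v x)"
    using energy_finite_support[where f = "dirac y", OF finite_support_dirac assms] by (simp only:)
  also have "\<dots> = cnj (dirac y y) * laplacian c v y" by simp
  also have "dirac y y = 1" by (simp add: dirac_def)
  finally show ?thesis by simp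
qed

lemma dirac_energy_space: "class_of (dirac y) \<in> energy_space c"
  by (rule finite_support_energy_space) simp

lemma laplacian_add:
  assumes "u \<in> energy_space c" "v \<in> energy_space c"
  shows "laplacian c (u + v) y = laplacian c u y + laplacian c v y"
  using energy_add_right[OF dirac_energy_space assms, of y]
  by (simp add: energy_dirac energy_space_add assms)

lemma laplacian_diff:
  assumes "u \<in> energy_space c" "v \<in> energy_space c"
  shows "laplacian c (u - v) y = laplacian c u y - laplacian c v y"
  using energy_diff_right[OF dirac_energy_space assms, of y]
  by (simp add: energy_dirac energy_space_diff assms)

lemma laplacian_scale:
  assumes "u \<in> energy_space c"
  shows "laplacian c (scale_potential k u) y = k * laplacian c u y"
  using energy_scale_right[of "class_of (dirac y)" k u]
  by (simp add: energy_dirac energy_space_scale assms)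

end

section \<open>Dipoles, the projection onto Fin, and monopoles\<close>

context resistance_network
begin

lemma energy_eq_0_commute: "energy c u v = 0 \<Longrightarrow> energy c v u = 0"
  by (subst energy_cnj) simp

lemma energy_norm_diff_eq_0:
  assumes "u \<in> energy_space c" "v \<in> energy_space c" "energy_norm c (u - v) = 0"
  shows "u = v"
  using energy_norm_eq_0[OF energy_space_diff[OF assms(1,2)] assms(3)] by simp

text \<open>On a path from \<open>a\<close> to \<open>y\<close>, an edge of conductance
  \<open>t\<close> adds \<open>sqrt (2 / t)\<close> to the constant. This boundedness is what makes
  dipoles exist.\<close>

lemma increment_bounded: "\<exists>B. \<forall>u\<in>energy_space c. cmod (increment u a y) \<le> B * energy_norm c u"
  using connected[of a y]
proof (induction rule: rtranclp_induct)
  case base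
  show ?case by (rule exI[of _ 0]) simp
next
  case (step y z)
  then obtain B where B: "\<And>u. u \<in> energy_space c \<Longrightarrow> cmod (increment u a y) \<le> B * energy_norm c u"
    by blast
  let ?C = "sqrt (2 / c y z)"
  have "cmod (increment u a z) \<le> (B + ?C) * energy_norm c u" if u: "u \<in> energy_space c" for u
  proof -
    have "(cmod (increment u y z))\<^sup>2 \<le> (?C * energy_norm c u)\<^sup>2"
      using edge_le_energy_norm[of u y z] u step.hyps(2)
      by (simp add: energy_space_def power_mult_distrib field_simps)
    then have "cmod (increment u y z) \<le> ?C * energy_norm c u"
      by (rule power2_le_imp_le) (use step.hyps(2) energy_norm_nonneg in simp)
    moreover have "increment u a z = increment u a y + increment u y z"
      using increment_cocycle[of u y z a] by simp
    then have "cmod (increment u a z) \<le> cmod (increment u a y) + cmod (increment u y z)"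
      by (simp add: norm_triangle_ineq)
    ultimately show ?thesis using B[OF u] by (simp add: distrib_right)
  qed
  then show ?case by blast
qed

section \<open>Dipoles\<close>

lemma dipole_unique:
  assumes "v \<in> energy_space c" "\<And>u. u \<in> energy_space c \<Longrightarrow> energy c v u = increment u a y"
    and "v' \<in> energy_space c" "\<And>u. u \<in> energy_space c \<Longrightarrow> energy c v' u = increment u a y"
  shows "v = v'"
proof -
  have "energy c (v - v') (v - v') = 0"
    by (subst energy_diff_left) (simp_all add: assms energy_space_diff)
  then have "energy_norm c (v - v') = 0" by (simp add: energy_norm_def)
  then show ?thesis using energy_norm_diff_eq_0 assms(1,3) by blast
qed

lemma dipole_ex1:
  "\<exists>!v. v \<in> energy_space c \<and> (\<forall>u\<in>energy_space c. energy c v u = increment u a y)"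
proof (rule ex_ex1I)
  obtain B where B: "\<forall>u\<in>energy_space c. cmod (increment u a y) \<le> B * energy_norm c u"
    using increment_bounded by blast
  have "\<exists>p\<in>energy_closure c (energy_space c). \<forall>u\<in>energy_space c. energy c p u = increment u a y"
    by (rule Riesz_subspace[OF subset_refl subspace_energy_space, where B = B])
      (use B in \<open>auto simp: increment_add increment_scale\<close>)
  then show "\<exists>v. v \<in> energy_space c \<and> (\<forall>u\<in>energy_space c. energy c v u = increment u a y)"
    using energy_closure_subset by blast
qed (use dipole_unique in blast)

lemma dipole_energy_space: "dipole c a y \<in> energy_space c"
  and energy_dipole: "u \<in> energy_space c \<Longrightarrow> energy c (dipole c a y) u = increment u a y"
  using theI'[OF dipole_ex1[of a y]] unfolding dipole_def[symmetric] by auto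

lemma laplacian_dipole: "laplacian c (dipole c a y) x = dirac y x - dirac a x"
proof -
  have "laplacian c (dipole c a y) x = cnj (energy c (dipole c a y) (class_of (dirac x)))"
    unfolding energy_dirac[OF dipole_energy_space, symmetric] by (rule energy_cnj)
  then show ?thesis
    by (simp add: energy_dipole dirac_energy_space increment_class_of) (simp add: dirac_def)
qed

lemma orthogonal_dipoles_imp_zero:
  assumes u: "u \<in> energy_space c" and "\<And>y. energy c (dipole c a y) u = 0"
  shows "u = 0"
proof (rule potential_eqI[where a = a])
  show "increment u a y = increment 0 a y" for y
    unfolding energy_dipole[OF u, symmetric] by (simp add: assms(2))
qed

section \<open>The subspace Fin and the projection onto it\<close>

lemma Fin_eq: "Fin c = energy_closure c finitely_supported"
  by (simp add: Fin_def span_dirac)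

lemma Fin_subset: "Fin c \<subseteq> energy_space c"
  unfolding Fin_eq by (rule energy_closure_subset)

lemma subspace_Fin: "potential.subspace (Fin c)"
  unfolding Fin_eq by (rule subspace_energy_closure[OF finitely_supported_subset subspace_finitely_supported])

lemma finitely_supported_Fin: "finitely_supported \<subseteq> Fin c"
proof
  fix u :: "'v potential" assume u: "u \<in> finitely_supported"
  show "u \<in> Fin c"
    unfolding Fin_eq
  proof (rule energy_closureI)
    show "u \<in> energy_space c" using finitely_supported_subset u by (rule subsetD)
    show "u \<in> finitely_supported" for n :: nat by (rule u)
    show "energy_tendsto c (\<lambda>_. u) u" by (simp add: energy_tendsto_def)
  qed
qed

lemma dirac_Fin: "class_of (dirac y) \<in> Fin c"
  using finitely_supported_Fin dirac_finitely_supported by (rule subsetD)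

text \<open>One half of Royden's decomposition: by Gauss-Green a harmonic class is orthogonal to
  finitely supported ones, and continuity extends this to their closure.\<close>

lemma orthogonal_Fin:
  assumes w: "w \<in> energy_space c" and lap: "\<And>y. laplacian c w y = 0" and p: "p \<in> Fin c"
  shows "energy c w p = 0"
proof (rule orthogonal_closure[OF finitely_supported_subset w _ p[unfolded Fin_eq]])
  fix h :: "'v potential" assume "h \<in> finitely_supported"
  then obtain f where f: "h = class_of f" "finite {x. f x \<noteq> 0}"
    unfolding finitely_supported_def by blast
  then have "energy c h w = 0" using energy_finite_support[OF f(2) w] lap by simp
  then show "energy c w h = 0" by (rule energy_eq_0_commute)
qed

lemma proj_Fin_ex1:
  assumes u: "u \<in> energy_space c"
  shows "\<exists>!p. p \<in> Fin c \<and> (\<forall>h\<in>Fin c. energy c h (u - p) = 0)"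
proof (rule ex_ex1I)
  obtain p where p: "p \<in> Fin c" and orth: "\<And>h. h \<in> finitely_supported \<Longrightarrow> energy c (u - p) h = 0"
    using orthogonal_projection[OF finitely_supported_subset subspace_finitely_supported u]
    unfolding Fin_eq by blast
  have "u - p \<in> energy_space c" using u p Fin_subset by (auto intro: energy_space_diff)
  then have "energy c (u - p) h = 0" if "h \<in> Fin c" for h
    using orthogonal_closure[OF finitely_supported_subset _ orth] that unfolding Fin_eq by blast
  then have "\<forall>h\<in>Fin c. energy c h (u - p) = 0" using energy_eq_0_commute by blast
  with p show "\<exists>p. p \<in> Fin c \<and> (\<forall>h\<in>Fin c. energy c h (u - p) = 0)" by blast
next
  fix p q
  assume p: "p \<in> Fin c \<and> (\<forall>h\<in>Fin c. energy c h (u - p) = 0)"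
    and q: "q \<in> Fin c \<and> (\<forall>h\<in>Fin c. energy c h (u - q) = 0)"
  have H: "p \<in> energy_space c" "q \<in> energy_space c" using p q Fin_subset by auto
  have d: "p - q \<in> Fin c" using p q subspace_Fin by (simp add: potential.subspace_diff)
  have "energy c (p - q) (u - q - (u - p)) = energy c (p - q) (u - q) - energy c (p - q) (u - p)"
    by (intro energy_diff_right energy_space_diff H u)
  then have "energy c (p - q) (p - q) = 0" using p q d by simp
  then have "energy_norm c (p - q) = 0" by (simp add: energy_norm_def)
  then show "p = q" using energy_norm_diff_eq_0 H by blast
qed

lemma proj_Fin_in: "u \<in> energy_space c \<Longrightarrow> proj_Fin c u \<in> Fin c"
  and energy_proj_Fin_right: "u \<in> energy_space c \<Longrightarrow> h \<in> Fin c \<Longrightarrow> energy c h (u - proj_Fin c u) = 0"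
  using theI'[OF proj_Fin_ex1[of u]] unfolding proj_Fin_def[symmetric] by auto

lemma proj_Fin_energy_space: "u \<in> energy_space c \<Longrightarrow> proj_Fin c u \<in> energy_space c"
  using proj_Fin_in Fin_subset by blast

text \<open>The remainder \<open>u - proj_Fin c u\<close> is orthogonal to every Dirac mass, hence
  harmonic by \<open>energy_dirac\<close>.\<close>

lemma laplacian_proj_Fin:
  assumes "u \<in> energy_space c"
  shows "laplacian c (proj_Fin c u) y = laplacian c u y"
  using energy_proj_Fin_right[OF assms dirac_Fin, of y]
  by (simp add: energy_dirac energy_space_diff proj_Fin_energy_space laplacian_diff assms)

text \<open>A dipole moves the pole from \<open>y\<close> to \<open>a\<close>, and projecting onto
  Fin keeps the Laplacian. Any other monopole at \<open>a\<close> differs from this projection by a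
  harmonic class, which is orthogonal to Fin; Pythagoras makes the projection the unique
  minimiser.\<close>

lemma minimal_monopole:
  assumes "monopole c y w"
  shows "monopole c a (minimal_monopole c a)" "minimal_monopole c a \<in> Fin c"
proof -
  \<comment> \<open>Its Laplacian is \<open>dirac y - (dirac y - dirac a)\<close>, that is,
    \<open>dirac a\<close>.\<close>
  let ?w = "w - dipole c a y"
  have w: "w \<in> energy_space c" "laplacian c w = dirac y" using assms by (auto simp: monopole_def)
  define p where "p = proj_Fin c ?w"
  have H: "?w \<in> energy_space c" by (intro energy_space_diff w dipole_energy_space)
  have pF: "p \<in> Fin c" and pH: "p \<in> energy_space c"
    unfolding p_def by (simp_all add: H proj_Fin_in proj_Fin_energy_space)
  have lap_p: "laplacian c p = dirac a"
    by (rule ext) (simp add: p_def laplacian_proj_Fin[OF H] laplacian_diff w dipole_energy_space laplacian_dipole)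
  have mono: "monopole c a p" by (simp add: monopole_def pH lap_p)
  have pyth: "(energy_norm c u)\<^sup>2 = (energy_norm c (u - p))\<^sup>2 + (energy_norm c p)\<^sup>2" if "monopole c a u" for u
  proof -
    have u: "u \<in> energy_space c" "laplacian c u = dirac a" using that by (auto simp: monopole_def)
    have "energy c (u - p) p = 0"
      by (rule orthogonal_Fin[OF _ _ pF]) (simp_all add: energy_space_diff u pH laplacian_diff lap_p)
    then show ?thesis using energy_norm_add_sq[of "u - p" p] by (simp add: energy_space_diff u pH)
  qed
  have le: "energy_norm c p \<le> energy_norm c u" if "monopole c a u" for u
    by (rule power2_le_imp_le) (simp_all add: pyth[OF that] energy_norm_nonneg)
  have "minimal_monopole c a = p"
    unfolding minimal_monopole_def
  proof (rule the_equality)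
    show "monopole c a p \<and> (\<forall>w'. monopole c a w' \<longrightarrow> energy_norm c p \<le> energy_norm c w')"
      using mono le by blast
    fix u assume u: "monopole c a u \<and> (\<forall>w'. monopole c a w' \<longrightarrow> energy_norm c u \<le> energy_norm c w')"
    then have "energy_norm c u \<le> energy_norm c p" using mono by blast
    then have "(energy_norm c (u - p))\<^sup>2 \<le> 0"
      using pyth[of u] u power_mono[OF _ energy_norm_nonneg[of u], of "energy_norm c p" 2] by simp
    then have "energy_norm c (u - p) = 0" by simp
    moreover have "u \<in> energy_space c" using u by (simp add: monopole_def)
    ultimately show "u = p" using energy_norm_diff_eq_0 pH by blast
  qed
  then show "monopole c a (minimal_monopole c a)" "minimal_monopole c a \<in> Fin c"
    using mono pF by simp_all
qed

section \<open>The domain of the Laplacian\<close>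

lemma lap_domain_subspace: "potential.subspace (lap_domain c a)"
proof (cases "\<exists>y w. monopole c y w")
  case True
  then show ?thesis
    unfolding lap_domain_def
    using potential.subspace_sums[OF potential.subspace_span potential.subspace_span] by simp
qed (simp add: lap_domain_def)

text \<open>Finite support places \<Delta>u in the energy space and later allows Gauss-Green with
  \<Delta>u as the finitely supported function. It holds for the generators and survives linear
  combinations.\<close>

lemma lap_domain_finite:
  assumes "u \<in> lap_domain c a"
  shows "u \<in> energy_space c \<and> finite {y. laplacian c u y \<noteq> 0}"
proof -
  define T where "T = {u \<in> energy_space c. finite {y. laplacian c u y \<noteq> 0}}"
  have T: "potential.subspace T"
    unfolding potential.subspace_def
  proof (intro conjI ballI allI)
    show "0 \<in> T"
      using laplacian_scale[OF energy_space_zero, of 0] by (simp add: T_def energy_space_zero)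
    fix u assume u: "u \<in> T"
    show "scale_potential k u \<in> T" for k
    proof -
      have "finite {y. laplacian c u y \<noteq> 0}" using u by (simp add: T_def)
      then have "finite {y. laplacian c (scale_potential k u) y \<noteq> 0}"
        by (rule finite_subset[rotated]) (use u in \<open>auto simp: T_def laplacian_scale\<close>)
      then show ?thesis using u by (simp add: T_def energy_space_scale)
    qed
    fix v assume v: "v \<in> T"
    have "finite ({y. laplacian c u y \<noteq> 0} \<union> {y. laplacian c v y \<noteq> 0})" using u v by (simp add: T_def)
    then have "finite {y. laplacian c (u + v) y \<noteq> 0}"
      by (rule finite_subset[rotated]) (use u v in \<open>auto simp: T_def laplacian_add\<close>)
    then show "u + v \<in> T" using u v by (simp add: T_def energy_space_add)
  qed
  have dip: "dipole c a y \<in> T" for y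
  proof -
    have "{x. laplacian c (dipole c a y) x \<noteq> 0} \<subseteq> {y, a}" by (auto simp: laplacian_dipole dirac_def)
    then show ?thesis by (simp add: T_def dipole_energy_space finite_subset)
  qed
  show ?thesis
  proof (cases "\<exists>y w. monopole c y w")
    case True
    then have "monopole c a (minimal_monopole c a)" using minimal_monopole by blast
    then have m: "minimal_monopole c a \<in> T" by (simp add: T_def monopole_def)
    have "proj_Fin c (dipole c a y) \<in> T" for y
      using dip[of y] by (simp add: T_def laplacian_proj_Fin proj_Fin_energy_space)
    then have "monopole_v c a y \<in> T" "monopole_f c a y \<in> T" for y
      unfolding monopole_v_def monopole_f_def
      using potential.subspace_add[OF T _ m] dip by blast+
    then have "range (monopole_v c a) \<union> range (monopole_f c a) \<subseteq> T" by blast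
    then have "potential.span (range (monopole_v c a) \<union> range (monopole_f c a)) \<subseteq> T"
      by (rule potential.span_minimal[OF _ T])
    moreover have "potential.span (range (dipole c a)) \<subseteq> T"
      by (rule potential.span_minimal[OF _ T]) (use dip in auto)
    moreover obtain v w where "u = v + w" "v \<in> potential.span (range (dipole c a))"
        "w \<in> potential.span (range (monopole_v c a) \<union> range (monopole_f c a))"
      using assms True unfolding lap_domain_def by auto
    ultimately have "u \<in> T" using potential.subspace_add[OF T] by blast
    then show ?thesis by (simp add: T_def)
  next
    case False
    have "potential.span (range (dipole c a)) \<subseteq> T"
      by (rule potential.span_minimal[OF _ T]) (use dip in auto)
    then show ?thesis using False assms by (auto simp: lap_domain_def T_def)
  qed
qed

lemma lap_domain_energy_space: "u \<in> lap_domain c a \<Longrightarrow> u \<in> energy_space c"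
  using lap_domain_finite by blast

lemma monopole_v_lap_domain:
  assumes "monopole c z w"
  shows "monopole_v c a y \<in> lap_domain c a" "monopole_f c a y \<in> lap_domain c a"
proof -
  have "\<exists>y w. monopole c y w" using assms by blast
  moreover have "v \<in> lap_domain c a"
    if "v \<in> range (monopole_v c a) \<union> range (monopole_f c a)" "\<exists>y w. monopole c y w" for v
    using that unfolding lap_domain_def
    by (simp, intro exI[of _ 0] exI[of _ v]) (auto simp: potential.span_base potential.span_zero)
  ultimately show "monopole_v c a y \<in> lap_domain c a" "monopole_f c a y \<in> lap_domain c a" by blast+
qed

lemma class_laplacian_energy_space:
  assumes "u \<in> lap_domain c a"
  shows "class_of (laplacian c u) \<in> energy_space c"
  using lap_domain_finite[OF assms] by (intro finite_support_energy_space) blast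

end

section \<open>Hitting probabilities and the capacity of a vertex\<close>

text \<open>The transition operator of the walk.\<close>

definition transition_mean :: "('v \<Rightarrow> 'v \<Rightarrow> real) \<Rightarrow> ('v \<Rightarrow> real) \<Rightarrow> 'v \<Rightarrow> real" where
  "transition_mean c f y = (\<Sum>\<^sub>\<infinity>z. c y z * f z) / total_conductance c y"

definition hit :: "('v \<Rightarrow> 'v \<Rightarrow> real) \<Rightarrow> 'v \<Rightarrow> nat \<Rightarrow> 'v \<Rightarrow> real" where
  "hit c x n y = measure_pmf.prob (walk c n y) {ys. x \<in> set ys}"

text \<open>Time 0 counts as a visit here but not in \<open>hit\<close>; the one-step recursion
  alternates between the two.\<close>

definition hit_from_start :: "('v \<Rightarrow> 'v \<Rightarrow> real) \<Rightarrow> 'v \<Rightarrow> nat \<Rightarrow> 'v \<Rightarrow> real" where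
  "hit_from_start c x n y = (if y = x then 1 else hit c x n y)"

lemma hit_0 [simp]: "hit c x 0 y = 0"
  by (simp add: hit_def)

lemma hit_nonneg: "0 \<le> hit c x n y"
  by (simp add: hit_def)

lemma hit_le_1: "hit c x n y \<le> 1"
  by (simp add: hit_def)

lemma picone_pair:
  fixes p q s t :: real
  assumes s: "0 < s" and t: "0 < t"
  shows "(p\<^sup>2 / s - q\<^sup>2 / t) * (s - t) \<le> (p - q)\<^sup>2"
proof -
  have "(p - q)\<^sup>2 - (p\<^sup>2 / s - q\<^sup>2 / t) * (s - t) = (p * t - q * s)\<^sup>2 / (s * t)"
    using s t by (simp add: field_simps power2_eq_square)
  moreover have "0 \<le> (p * t - q * s)\<^sup>2 / (s * t)" using s t by simp
  ultimately show ?thesis by linarith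
qed

context resistance_network
begin

text \<open>Summable positive conductances leave only countably many neighbours per vertex, and
  connectedness reaches every vertex in finitely many steps. Countability provides the exhaustion by
  finite sets.\<close>

lemma countable_vertices: "countable (UNIV :: 'v set)"
proof -
  fix a :: 'v
  let ?E = "{(x, y). 0 < c x y}"
  have nbr: "countable {y. 0 < c x y}" for x
    by (rule countable_subset[OF _ summable_countable_real[OF finite_total[of x]]]) auto
  have "countable (?E `` Y)" if "countable Y" for Y
  proof -
    have "?E `` Y = (\<Union>x\<in>Y. {y. 0 < c x y})" by auto
    then show ?thesis using that nbr by simp
  qed
  moreover have "countable {a}" by (rule countable_finite) simp
  ultimately have "countable (?E\<^sup>* `` {a})" by (rule countable_rtrancl)
  moreover have "?E\<^sup>* `` {a} = UNIV"
    using connected[of a] by (auto simp: rtranclp_rtrancl_eq)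
  ultimately show ?thesis by simp
qed

lemma laplacian_of_real:
  assumes "((\<lambda>z. c y z * g z) has_sum S) UNIV"
  shows "laplacian c (class_of (\<lambda>z. complex_of_real (g z))) y
    = complex_of_real (total_conductance c y * g y - S)"
proof -
  have "((\<lambda>z. c y z * g y + - 1 * (c y z * g z)) has_sum total_conductance c y * g y + - 1 * S) UNIV"
    by (intro has_sum_add has_sum_cmult_left has_sum_cmult_right has_sum_conductance assms)
  then have "((\<lambda>z. complex_of_real (c y z * g y + - 1 * (c y z * g z)))
      has_sum complex_of_real (total_conductance c y * g y + - 1 * S)) UNIV"
    by (rule has_sum_of_real)
  then have "((\<lambda>z. complex_of_real (c y z) * increment (class_of (\<lambda>z. complex_of_real (g z))) z y)
      has_sum complex_of_real (total_conductance c y * g y - S)) UNIV"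
    by (simp add: increment_class_of algebra_simps)
  then show ?thesis
    unfolding laplacian_increment[of c, OF conductance_nonneg] by (rule infsumI)
qed

lemma edge_term_of_real:
  "edge_term c (class_of (\<lambda>y. complex_of_real (p y))) (class_of (\<lambda>y. complex_of_real (g y))) (x, y)
    = complex_of_real (c x y * ((p x - p y) * (g x - g y)))"
  by (simp add: edge_term_def increment_class_of algebra_simps)

text \<open>Discrete Picone inequality: pair \<open>|f|^2 / g\<close> with \<open>g\<close> by
  Gauss-Green and compare with the energy of \<open>f\<close> edge by edge through
  \<open>picone_pair\<close>.\<close>

lemma picone:
  assumes f: "finite {y. f y \<noteq> 0}" and pos: "\<And>y. 0 < g y" and bd: "\<And>y. g y \<le> M"
  shows "(\<Sum>y | f y \<noteq> 0. (cmod (f y))\<^sup>2 / g y * Re (laplacian c (class_of (\<lambda>y. complex_of_real (g y))) y))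
    \<le> (energy_norm c (class_of f))\<^sup>2"
proof -
  define \<psi> where "\<psi> = (\<lambda>y. complex_of_real ((cmod (f y))\<^sup>2 / g y))"
  let ?G = "class_of (\<lambda>y. complex_of_real (g y))"
  let ?S = "\<Sum>y | f y \<noteq> 0. (cmod (f y))\<^sup>2 / g y * Re (laplacian c ?G y)"
  have supp: "{y. \<psi> y \<noteq> 0} = {y. f y \<noteq> 0}"
    using pos by (auto simp: \<psi>_def less_imp_neq[symmetric])
  have "cmod (increment ?G x y) \<le> M" for x y
  proof -
    have "cmod (increment ?G x y) = \<bar>g y - g x\<bar>"
      unfolding increment_class_of of_real_diff[symmetric] norm_of_real ..
    then show ?thesis using pos[of x] pos[of y] bd[of x] bd[of y] by linarith
  qed
  then have "(edge_term c (class_of \<psi>) ?G has_sum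
      2 * (\<Sum>y | f y \<noteq> 0. cnj (\<psi> y) * laplacian c ?G y)) UNIV"
    using gauss_green[of \<psi> ?G] f row_summable_bounded[of ?G M] unfolding supp by blast
  then have 1: "((\<lambda>z. Re (edge_term c (class_of \<psi>) ?G z)) has_sum 2 * ?S) UNIV"
    by (auto dest!: has_sum_Re simp: \<psi>_def simp del: of_real_divide of_real_power)
  have H: "class_of f \<in> energy_space c" by (rule finite_support_energy_space[OF f])
  have "(\<lambda>(x, y). c x y * (cmod (increment (class_of f) x y))\<^sup>2) summable_on UNIV"
    using H by (simp add: energy_space_def finite_energy_iff)
  then have 2: "((\<lambda>(x, y). c x y * (cmod (increment (class_of f) x y))\<^sup>2)
      has_sum 2 * (energy_norm c (class_of f))\<^sup>2) UNIV"
    unfolding Re_energy_norm[symmetric] Re_energy_self by (simp add: has_sum_infsum)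
  have "2 * ?S \<le> 2 * (energy_norm c (class_of f))\<^sup>2"
  proof (rule has_sum_mono[OF 1 2])
    fix z :: "'v \<times> 'v"
    obtain x y where z: "z = (x, y)" by (cases z)
    have "edge_term c (class_of \<psi>) ?G (x, y) = complex_of_real (c x y *
        (((cmod (f x))\<^sup>2 / g x - (cmod (f y))\<^sup>2 / g y) * (g x - g y)))"
      unfolding \<psi>_def by (rule edge_term_of_real)
    then have "Re (edge_term c (class_of \<psi>) ?G (x, y))
        = c x y * (((cmod (f x))\<^sup>2 / g x - (cmod (f y))\<^sup>2 / g y) * (g x - g y))"
      by (simp only: Re_complex_of_real)
    also have "\<dots> \<le> c x y * (cmod (f x) - cmod (f y))\<^sup>2"
      by (intro mult_left_mono picone_pair pos conductance_nonneg)
    also have "\<dots> \<le> c x y * (cmod (f y - f x))\<^sup>2"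
      by (intro mult_left_mono conductance_nonneg power2_le_iff_abs_le[THEN iffD2])
        (use norm_triangle_ineq3[of "f x" "f y"] in \<open>simp_all add: norm_minus_commute\<close>)
    finally show "Re (edge_term c (class_of \<psi>) ?G z)
        \<le> (case z of (x, y) \<Rightarrow> c x y * (cmod (increment (class_of f) x y))\<^sup>2)"
      by (simp add: z increment_class_of)
  qed
  then show ?thesis by simp
qed

end

text \<open>Infinitude gives every vertex positive total conductance, so that the walk is well
  defined, and makes finitely supported representatives unique.\<close>

locale infinite_network = resistance_network c for c :: "'v \<Rightarrow> 'v \<Rightarrow> real" +
  assumes infinite_vertices: "infinite (UNIV :: 'v set)"
begin

lemma total_pos: "0 < total_conductance c y"
  by (rule total_conductance_pos[OF infinite_vertices])

section \<open>The transition operator and hitting probabilities\<close>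

lemma has_sum_transition_mean:
  assumes "\<And>z. 0 \<le> f z" "\<And>z. f z \<le> 1"
  shows "((\<lambda>z. c y z * f z) has_sum total_conductance c y * transition_mean c f y) UNIV"
proof -
  have "(\<lambda>z. c y z * f z) summable_on UNIV"
  proof (rule summable_on_comparison_test)
    show "c y summable_on UNIV" using has_sum_conductance by (rule has_sum_imp_summable)
    show "c y z * f z \<le> c y z" "0 \<le> c y z * f z" for z
      using assms[of z] conductance_nonneg by (simp_all add: mult_left_le)
  qed
  moreover have "total_conductance c y * transition_mean c f y = (\<Sum>\<^sub>\<infinity>z. c y z * f z)"
    using total_pos[of y] by (simp add: transition_mean_def)
  ultimately show ?thesis by (simp only: has_sum_infsum)
qed

lemma transition_mean_mono:
  assumes "\<And>z. 0 \<le> f z" "\<And>z. f z \<le> g z" "\<And>z. g z \<le> 1"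
  shows "transition_mean c f y \<le> transition_mean c g y"
proof -
  have f1: "f z \<le> 1" and g0: "0 \<le> g z" for z
    using assms(1)[of z] assms(2)[of z] assms(3)[of z] by auto
  have "total_conductance c y * transition_mean c f y \<le> total_conductance c y * transition_mean c g y"
    by (rule has_sum_mono[OF has_sum_transition_mean has_sum_transition_mean])
      (use assms f1 g0 conductance_nonneg in \<open>auto intro: mult_left_mono\<close>)
  then show ?thesis using total_pos[of y] by simp
qed

lemma transition_mean_nonneg:
  assumes "\<And>z. 0 \<le> f z" "\<And>z. f z \<le> 1"
  shows "0 \<le> transition_mean c f y"
proof -
  have "0 \<le> (\<Sum>\<^sub>\<infinity>z. c y z * f z)" by (rule infsum_nonneg) (simp add: assms conductance_nonneg)
  then show ?thesis using total_pos[of y] by (simp add: transition_mean_def)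
qed

lemma transition_mean_le_1:
  assumes "\<And>z. 0 \<le> f z" "\<And>z. f z \<le> 1"
  shows "transition_mean c f y \<le> 1"
proof -
  have "total_conductance c y * transition_mean c f y \<le> total_conductance c y"
    by (rule has_sum_mono[OF has_sum_transition_mean has_sum_conductance])
      (use assms conductance_nonneg in \<open>auto simp: mult_left_le\<close>)
  then show ?thesis using total_pos[of y] by simp
qed

text \<open>Fatou's lemma for the transition operator, proved on finite partial sums.\<close>

lemma transition_mean_limit_le:
  assumes f: "\<And>n z. 0 \<le> f n z" "\<And>n z. f n z \<le> 1" and lim: "\<And>z. (\<lambda>n. f n z) \<longlonglongrightarrow> g z"
    and B: "\<And>n. transition_mean c (f n) y \<le> B"
  shows "transition_mean c g y \<le> B"
proof -
  have g: "0 \<le> g z" "g z \<le> 1" for z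
    using f by (auto intro: LIMSEQ_le_const[OF lim] LIMSEQ_le_const2[OF lim])
  have hs: "((\<lambda>z. c y z * g z) has_sum total_conductance c y * transition_mean c g y) UNIV"
    by (rule has_sum_transition_mean[OF g])
  have "total_conductance c y * transition_mean c g y \<le> total_conductance c y * B"
  proof (rule has_sum_le_finite_sums[OF hs])
    fix F :: "'v set" assume F: "finite F"
    show "(\<Sum>z\<in>F. c y z * g z) \<le> total_conductance c y * B"
    proof (rule LIMSEQ_le_const2)
      show "(\<lambda>n. \<Sum>z\<in>F. c y z * f n z) \<longlonglongrightarrow> (\<Sum>z\<in>F. c y z * g z)"
        by (intro tendsto_intros lim)
      have "(\<Sum>z\<in>F. c y z * f n z) \<le> total_conductance c y * B" for n
      proof -
        have "(\<Sum>z\<in>F. c y z * f n z) \<le> total_conductance c y * transition_mean c (f n) y"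
          by (rule has_sum_mono_neutral[OF has_sum_finite[OF F] has_sum_transition_mean[of "f n" y]])
            (simp_all add: f conductance_nonneg)
        also have "\<dots> \<le> total_conductance c y * B"
          using B total_pos[of y] by (intro mult_left_mono) auto
        finally show ?thesis .
      qed
      then show "\<exists>N. \<forall>n\<ge>N. (\<Sum>z\<in>F. c y z * f n z) \<le> total_conductance c y * B" by blast
    qed
  qed
  then show ?thesis using total_pos[of y] by simp
qed

lemma hit_from_start_bounds: "0 \<le> hit_from_start c x n y" "hit_from_start c x n y \<le> 1"
  by (simp_all add: hit_from_start_def hit_nonneg hit_le_1)

lemma hit_Suc: "hit c x (Suc n) y = transition_mean c (hit_from_start c x n) y"
proof -
  let ?A = "{ys. x \<in> set ys}" and ?h = "hit_from_start c x n"
  have step: "emeasure (map_pmf ((#) z) (walk c n z)) ?A = ennreal (?h z)" for z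
  proof -
    have "emeasure (map_pmf ((#) z) (walk c n z)) ?A = emeasure (measure_pmf (walk c n z)) ((#) z -` ?A)"
      by simp
    \<comment> \<open>A first step onto \<open>x\<close> settles the event whatever follows; this is
      where \<open>hit\<close> turns into \<open>hit_from_start\<close>.\<close>
    also have "(#) z -` ?A = (if z = x then UNIV else ?A)" by auto
    finally show ?thesis
      by (simp add: hit_from_start_def hit_def measure_pmf.emeasure_eq_measure)
  qed
  have int: "integrable (walk_step c y) ?h"
    by (rule measure_pmf.integrable_const_bound[where B = 1])
      (auto simp: hit_from_start_bounds)
  have "ennreal (hit c x (Suc n) y) = emeasure (walk c (Suc n) y) ?A"
    by (simp add: hit_def measure_pmf.emeasure_eq_measure)
  also have "\<dots> = (\<integral>\<^sup>+z. ennreal (?h z) \<partial>walk_step c y)"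
    unfolding walk.simps emeasure_bind_pmf step ..
  also have "\<dots> = ennreal (measure_pmf.expectation (walk_step c y) ?h)"
    by (rule nn_integral_eq_integral[OF int]) (simp add: hit_from_start_bounds)
  finally have "hit c x (Suc n) y = measure_pmf.expectation (walk_step c y) ?h"
    by (subst (asm) ennreal_inj) (auto simp: hit_nonneg hit_from_start_bounds intro!: integral_nonneg_AE)
  also have "\<dots> = infsetsum (\<lambda>z. pmf (walk_step c y) z * ?h z) UNIV"
    by (rule pmf_expectation_eq_infsetsum)
  also have "\<dots> = infsetsum (\<lambda>z. c y z / total_conductance c y * ?h z) UNIV"
    by (simp only: pmf_walk_step[OF infinite_vertices])
  also have "\<dots> = (\<Sum>\<^sub>\<infinity>z. c y z / total_conductance c y * ?h z)"
  proof (rule infsetsum_infsum)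
    have "(\<lambda>z. c y z * ?h z * inverse (total_conductance c y)) summable_on UNIV"
      by (intro summable_on_cmult_left has_sum_imp_summable[OF has_sum_transition_mean] hit_from_start_bounds)
    then have "(\<lambda>z. norm (c y z / total_conductance c y * ?h z)) summable_on UNIV"
      using total_pos[of y]
      by (simp add: conductance_nonneg hit_from_start_bounds abs_mult divide_inverse algebra_simps)
    then show "Infinite_Set_Sum.abs_summable_on (\<lambda>z. c y z / total_conductance c y * ?h z) UNIV"
      unfolding abs_summable_equivalent .
  qed
  also have "\<dots> = transition_mean c ?h y"
  proof -
    have "(\<Sum>\<^sub>\<infinity>z. c y z / total_conductance c y * ?h z)
        = (\<Sum>\<^sub>\<infinity>z. c y z * ?h z * inverse (total_conductance c y))"
      by (rule infsum_cong) (simp add: divide_inverse)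
    also have "\<dots> = (\<Sum>\<^sub>\<infinity>z. c y z * ?h z) * inverse (total_conductance c y)"
      by (rule infsum_cmult_left')
    finally show ?thesis by (simp add: transition_mean_def divide_inverse)
  qed
  finally show ?thesis .
qed

lemma hit_mono: "hit c x n y \<le> hit c x (Suc n) y"
proof (induction n arbitrary: y)
  case (Suc n)
  have "hit_from_start c x n z \<le> hit_from_start c x (Suc n) z" for z
    using Suc by (simp add: hit_from_start_def)
  then show ?case
    unfolding hit_Suc by (intro transition_mean_mono) (simp_all add: hit_from_start_bounds)
qed (simp add: hit_nonneg)

lemma hit_bdd: "bdd_above (range (\<lambda>n. hit c x n y))"
  by (rule bdd_aboveI2[where M = 1]) (rule hit_le_1)

lemma hit_limit: "(\<lambda>n. hit c x n y) \<longlonglongrightarrow> (SUP n. hit c x n y)"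
  by (rule LIMSEQ_incseq_SUP[OF hit_bdd]) (simp add: incseq_SucI hit_mono)

lemma hit_le_SUP: "hit c x n y \<le> (SUP n. hit c x n y)"
  by (rule cSUP_upper[OF UNIV_I hit_bdd])

lemma return_probability_hit: "return_probability c x = (SUP n. hit c x n x)"
  by (simp add: return_probability_def hit_def)

text \<open>The function \<open>1 +\<close> (probability of ever visiting \<open>x\<close>) is superharmonic, with Laplacian
  \<open>c(x)\<close> times the escape probability at \<open>x\<close>; Picone's inequality turns it into a capacity bound.\<close>

lemma capacity_bound:
  assumes esc: "return_probability c x < 1"
  shows "\<exists>C. \<forall>f. finite {y. f y \<noteq> 0} \<longrightarrow> (cmod (f x))\<^sup>2 \<le> C * (energy_norm c (class_of f))\<^sup>2"
proof -
  define H where "H y = (SUP n. hit c x n y)" for y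
  define F where "F y = (if y = x then 1 else H y)" for y
  \<comment> \<open>Adding 1 leaves the Laplacian unchanged and makes \<open>g\<close> strictly
    positive, as Picone's inequality requires; the value \<open>g x = 2\<close> is the origin of the
    2 in the final constant.\<close>
  define g where "g y = F y + 1" for y
  have lim: "(\<lambda>n. hit_from_start c x n y) \<longlonglongrightarrow> F y" for y
    using hit_limit[of x y] by (simp add: hit_from_start_def F_def H_def)
  have F: "0 \<le> F y" "F y \<le> 1" for y
    by (auto intro: LIMSEQ_le_const[OF lim] LIMSEQ_le_const2[OF lim] simp: hit_from_start_bounds)
  \<comment> \<open>Off \<open>x\<close> this says that \<open>F\<close> is superharmonic; at
    \<open>x\<close> it bounds the mean by the return probability.\<close>
  have PF: "transition_mean c F y \<le> H y" for y
    by (rule transition_mean_limit_le[OF hit_from_start_bounds lim])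
      (simp add: H_def hit_le_SUP flip: hit_Suc)
  have lap: "laplacian c (class_of (\<lambda>y. complex_of_real (g y))) y
      = complex_of_real (total_conductance c y * (F y - transition_mean c F y))" for y
  proof -
    have "((\<lambda>z. c y z * F z + c y z) has_sum
        total_conductance c y * transition_mean c F y + total_conductance c y) UNIV"
      by (intro has_sum_add has_sum_transition_mean F has_sum_conductance)
    then have "((\<lambda>z. c y z * g z) has_sum
        total_conductance c y * transition_mean c F y + total_conductance c y) UNIV"
      by (simp add: g_def algebra_simps)
    from laplacian_of_real[OF this] show ?thesis by (simp add: g_def algebra_simps)
  qed
  let ?d = "total_conductance c x * (1 - H x)"
  have d: "0 < ?d" using esc total_pos[of x] by (simp add: return_probability_hit H_def)
  have "(cmod (f x))\<^sup>2 \<le> 2 / ?d * (energy_norm c (class_of f))\<^sup>2" if f: "finite {y. f y \<noteq> 0}" for f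
  proof -
    let ?t = "\<lambda>y. (cmod (f y))\<^sup>2 / g y * Re (laplacian c (class_of (\<lambda>y. complex_of_real (g y))) y)"
    have gpos: "0 < g y" and gle: "g y \<le> 2" for y using F[of y] by (simp_all add: g_def)
    have "transition_mean c F y \<le> F y" for y
      using PF[of y] esc by (cases "y = x") (simp_all add: F_def H_def return_probability_hit)
    then have t: "0 \<le> ?t y" for y
      using gpos[of y] total_pos[of y] by (simp add: lap)
    have "(cmod (f x))\<^sup>2 / 2 * ?d \<le> ?t x"
    proof -
      have "?d \<le> total_conductance c x * (1 - transition_mean c F x)"
        using PF[of x] total_pos[of x] by (intro mult_left_mono) auto
      then have "(cmod (f x))\<^sup>2 / 2 * ?d \<le> (cmod (f x))\<^sup>2 / 2 * (total_conductance c x * (1 - transition_mean c F x))"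
        by (rule mult_left_mono) simp
      then show ?thesis unfolding lap Re_complex_of_real by (simp add: g_def F_def)
    qed
    also have "?t x \<le> (\<Sum>y | f y \<noteq> 0. ?t y)"
    proof (cases "f x = 0")
      case True
      then show ?thesis by (simp del: times_divide_eq_left add: sum_nonneg[OF t])
    next
      case False
      then show ?thesis by (intro member_le_sum t f) simp
    qed
    also have "\<dots> \<le> (energy_norm c (class_of f))\<^sup>2" by (rule picone[OF f gpos gle])
    finally show ?thesis using d by (simp add: field_simps)
  qed
  then show ?thesis by blast
qed

text \<open>If \<open>x\<close> is recurrent, the hitting functions of the walk killed off an exhausting sequence of
  finite sets have energy at most \<open>c(x)\<close> times their escape defect, which tends to zero.\<close>

lemma recurrent_null_sequence:
  assumes rec: "return_probability c x = 1"
  shows "\<exists>\<phi> :: nat \<Rightarrow> 'v \<Rightarrow> real. (\<forall>n. finite {y. \<phi> n y \<noteq> 0} \<and> \<phi> n x = 1 \<and> (\<forall>y. 0 \<le> \<phi> n y))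
    \<and> (\<lambda>n. energy_norm c (class_of (\<lambda>y. complex_of_real (\<phi> n y)))) \<longlonglongrightarrow> 0"
proof -
  define K where "K n = from_nat_into (UNIV :: 'v set) ` {..<n}" for n
  \<comment> \<open>One recursion advances the time and enlarges the exhausting set together: every
    stage has finite support, while the limit is no longer restricted to any of the sets.\<close>
  define \<phi> where "\<phi> = rec_nat (\<lambda>y. if y = x then 1 else 0)
    (\<lambda>n f y. if y = x then 1 else if y \<in> K n then transition_mean c f y else 0)"
  have \<phi>0: "\<phi> 0 = (\<lambda>y. if y = x then 1 else 0)"
    and \<phi>S: "\<phi> (Suc n) = (\<lambda>y. if y = x then 1 else if y \<in> K n then transition_mean c (\<phi> n) y else 0)" for n
    unfolding \<phi>_def by simp_all
  have finK: "finite (K n)" for n by (simp add: K_def)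
  have monoK: "K m \<subseteq> K n" if "m \<le> n" for m n using that by (auto simp: K_def)
  have exK: "\<exists>n. y \<in> K n" for y
    using from_nat_into_surj[OF countable_vertices, of y] by (auto simp: K_def)
  have b: "0 \<le> \<phi> n y \<and> \<phi> n y \<le> 1" for n y
    by (induction n arbitrary: y) (auto simp: \<phi>0 \<phi>S transition_mean_nonneg transition_mean_le_1)
  then have b0: "0 \<le> \<phi> n y" and b1: "\<phi> n y \<le> 1" for n y by auto
  have \<phi>x: "\<phi> n x = 1" for n by (cases n) (simp_all add: \<phi>0 \<phi>S)
  have fin: "finite {y. \<phi> n y \<noteq> 0}" for n
  proof (cases n)
    case (Suc m)
    have "{y. \<phi> n y \<noteq> 0} \<subseteq> insert x (K m)" by (auto simp: Suc \<phi>S)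
    then show ?thesis using finK by (meson finite_insert finite_subset)
  qed (simp add: \<phi>0)
  have mono: "\<phi> n y \<le> \<phi> (Suc n) y" for n y
  proof (induction n arbitrary: y)
    case 0
    show ?case using b0[of "Suc 0" y] \<phi>x[of "Suc 0"] by (simp add: \<phi>0)
  next
    case (Suc n)
    have "transition_mean c (\<phi> n) y \<le> transition_mean c (\<phi> (Suc n)) y"
      by (rule transition_mean_mono[OF b0 Suc b1])
    then show ?case
      using monoK[of n "Suc n"] transition_mean_nonneg[of "\<phi> (Suc n)" y, OF b0 b1]
      unfolding \<phi>S[of n] \<phi>S[of "Suc n"] by auto
  qed
  \<comment> \<open>Subharmonicity off \<open>x\<close>: a stage is at most the mean of the previous
    one, hence by monotonicity at most its own mean.\<close>
  have le_mean: "\<phi> n y \<le> transition_mean c (\<phi> n) y" if "y \<noteq> x" for n y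
  proof (cases n)
    case 0
    then show ?thesis using that transition_mean_nonneg[of "\<phi> 0" y, OF b0 b1] by (simp add: \<phi>0)
  next
    case (Suc m)
    show ?thesis
      using that transition_mean_mono[of "\<phi> m" "\<phi> (Suc m)" y, OF b0 mono b1] transition_mean_nonneg[of "\<phi> (Suc m)" y, OF b0 b1]
      unfolding Suc by (simp add: \<phi>S[of m])
  qed
  have incs: "incseq (\<lambda>n. \<phi> n y)" for y by (intro incseq_SucI mono)
  have bdd: "bdd_above (range (\<lambda>n. \<phi> n y))" for y by (rule bdd_aboveI2[where M = 1]) (rule b1)
  define G where "G y = (SUP n. \<phi> n y)" for y
  have limG: "(\<lambda>n. \<phi> n y) \<longlonglongrightarrow> G y" for y
    unfolding G_def by (rule LIMSEQ_incseq_SUP[OF bdd incs])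
  have leG: "\<phi> n y \<le> G y" for n y unfolding G_def by (rule cSUP_upper[OF UNIV_I bdd])
  have G0: "0 \<le> G y" and G1: "G y \<le> 1" for y
    using b by (auto intro: LIMSEQ_le_const[OF limG] LIMSEQ_le_const2[OF limG])
  have Gx: "G x = 1" by (simp add: G_def \<phi>x)
  have PG: "transition_mean c G y \<le> G y" if y: "y \<noteq> x" for y
  proof (rule transition_mean_limit_le[OF b0 b1 limG])
    fix n
    obtain k where k: "y \<in> K k" using exK by blast
    \<comment> \<open>A stage late enough for \<open>y\<close> to have entered the exhausting
      set.\<close>
    let ?m = "max k n"
    have "\<phi> n z \<le> \<phi> ?m z" for z using incs[of z] by (simp add: incseq_def)
    then have "transition_mean c (\<phi> n) y \<le> transition_mean c (\<phi> ?m) y"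
      by (rule transition_mean_mono[OF b0 _ b1])
    also have "\<dots> = \<phi> (Suc ?m) y" using k y monoK[of k ?m] by (auto simp: \<phi>S[of ?m])
    also have "\<dots> \<le> G y" by (rule leG)
    finally show "transition_mean c (\<phi> n) y \<le> G y" .
  qed
  \<comment> \<open>Being 1 at \<open>x\<close> and superharmonic elsewhere, the limit dominates
    every hitting function; recurrence then forces its mean at \<open>x\<close> to be at least
    1.\<close>
  have hit_le: "hit_from_start c x n y \<le> G y" for n y
  proof (induction n arbitrary: y)
    case 0
    show ?case using Gx G0 by (simp add: hit_from_start_def)
  next
    case (Suc n)
    show ?case
    proof (cases "y = x")
      case False
      then have "hit_from_start c x (Suc n) y = transition_mean c (hit_from_start c x n) y"
        by (simp add: hit_from_start_def hit_Suc)
      also have "\<dots> \<le> transition_mean c G y"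
        by (rule transition_mean_mono[OF hit_from_start_bounds(1) Suc G1])
      also have "\<dots> \<le> G y" by (rule PG[OF False])
      finally show ?thesis .
    qed (simp add: hit_from_start_def Gx)
  qed
  have "hit c x n x \<le> transition_mean c G x" for n
    using transition_mean_mono[OF hit_from_start_bounds(1) hit_le G1] transition_mean_nonneg[OF G0 G1]
    by (cases n) (simp_all add: hit_Suc)
  then have PG1: "1 \<le> transition_mean c G x"
    unfolding rec[symmetric] return_probability_hit by (intro cSUP_least) auto
  let ?p = "\<lambda>n. transition_mean c (\<phi> n) x"
  have p1: "?p n \<le> 1" for n by (rule transition_mean_le_1[OF b0 b1])
  have "incseq ?p" by (intro incseq_SucI transition_mean_mono[OF b0 mono b1])
  moreover have pbdd: "bdd_above (range ?p)" by (rule bdd_aboveI2[where M = 1]) (rule p1)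
  ultimately have plim: "?p \<longlonglongrightarrow> (SUP n. ?p n)" by (intro LIMSEQ_incseq_SUP)
  have "transition_mean c G x \<le> (SUP n. ?p n)"
    by (rule transition_mean_limit_le[OF b0 b1 limG]) (rule cSUP_upper[OF UNIV_I pbdd])
  then have "1 \<le> (SUP n. ?p n)" using PG1 by linarith
  moreover have "(SUP n. ?p n) \<le> 1" by (intro cSUP_least p1) simp
  ultimately have p_lim: "?p \<longlonglongrightarrow> 1" using plim by simp
  let ?N = "\<lambda>n. energy_norm c (class_of (\<lambda>y. complex_of_real (\<phi> n y)))"
  have en: "(?N n)\<^sup>2 \<le> total_conductance c x * (1 - ?p n)" for n
  proof -
    let ?f = "\<lambda>y. complex_of_real (\<phi> n y)"
    let ?e = "\<lambda>y. \<phi> n y * (total_conductance c y * \<phi> n y - total_conductance c y * transition_mean c (\<phi> n) y)"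
    have supp: "{y. ?f y \<noteq> 0} = {y. \<phi> n y \<noteq> 0}" by simp
    have lap: "laplacian c (class_of ?f) y = complex_of_real
        (total_conductance c y * \<phi> n y - total_conductance c y * transition_mean c (\<phi> n) y)" for y
      by (rule laplacian_of_real[OF has_sum_transition_mean[OF b0 b1]])
    have f: "finite {y. ?f y \<noteq> 0}" unfolding supp by (rule fin)
    \<comment> \<open>Gauss-Green writes the energy as the sum of \<open>\<phi> n\<close> times its
      Laplacian; by \<open>le_mean\<close> only the term at \<open>x\<close> can be
      positive.\<close>
    have "energy c (class_of ?f) (class_of ?f) = (\<Sum>y | \<phi> n y \<noteq> 0. complex_of_real (?e y))"
      using energy_finite_support[OF f finite_support_energy_space[OF f]]
      unfolding supp lap complex_cnj_complex_of_real of_real_mult[symmetric] .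
    then have "(?N n)\<^sup>2 = (\<Sum>y | \<phi> n y \<noteq> 0. ?e y)"
      unfolding Re_energy_norm[symmetric] by simp
    also have "\<dots> \<le> (\<Sum>y | \<phi> n y \<noteq> 0. if y = x then total_conductance c x * (1 - ?p n) else 0)"
    proof (rule sum_mono)
      fix y
      have "?e y \<le> 0" if "y \<noteq> x"
        using le_mean[OF that, of n] total_pos[of y] b0[of n y]
        by (intro mult_nonneg_nonpos) (auto simp: mult_left_mono)
      then show "?e y \<le> (if y = x then total_conductance c x * (1 - ?p n) else 0)"
        by (simp add: \<phi>x algebra_simps)
    qed
    also have "\<dots> = total_conductance c x * (1 - ?p n)"
      using fin[of n] by (simp add: \<phi>x)
    finally show ?thesis .
  qed
  have "(\<lambda>n. total_conductance c x * (1 - ?p n)) \<longlonglongrightarrow> total_conductance c x * (1 - 1)"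
    by (intro tendsto_intros p_lim)
  then have bound_lim: "(\<lambda>n. total_conductance c x * (1 - ?p n)) \<longlonglongrightarrow> 0" by simp
  have "(\<lambda>n. (?N n)\<^sup>2) \<longlonglongrightarrow> 0"
  proof (rule Lim_null_comparison[OF _ bound_lim])
    show "\<forall>\<^sub>F n in sequentially. norm ((?N n)\<^sup>2) \<le> total_conductance c x * (1 - ?p n)"
      unfolding real_norm_def abs_power2 by (rule always_eventually, rule allI, rule en)
  qed
  from tendsto_real_sqrt[OF this] have "?N \<longlonglongrightarrow> 0"
    unfolding real_sqrt_abs real_sqrt_zero abs_of_nonneg[OF energy_norm_nonneg] .
  moreover have "\<forall>n. finite {y. \<phi> n y \<noteq> 0} \<and> \<phi> n x = 1 \<and> (\<forall>y. 0 \<le> \<phi> n y)"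
    using fin \<phi>x b0 by simp
  ultimately show ?thesis by blast
qed

end

section \<open>Convergence of the resolvent forces transience\<close>

context infinite_network
begin

text \<open>Pairings with Dirac masses and dipoles are continuous, so the closed operator still acts
  as the pointwise Laplacian. Its value is a class, hence the comparison of increments.\<close>

lemma lap_closure_laplacian:
  assumes "(u, g) \<in> lap_closure c a"
  shows "u \<in> energy_space c" "increment g a y = laplacian c u y - laplacian c u a"
proof -
  obtain s t where u: "u \<in> energy_space c" and g: "g \<in> energy_space c"
    and st: "\<And>n. (s n, t n) \<in> lap_graph c a"
    and lim: "energy_tendsto c s u" "energy_tendsto c t g"
    using assms unfolding lap_closure_def graph_closure_def by blast
  show "u \<in> energy_space c" by (rule u)
  have dom: "s n \<in> lap_domain c a" and t: "t n = class_of (laplacian c (s n))" for n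
    using st[of n] by (auto simp: lap_graph_def)
  have sH: "s n \<in> energy_space c" for n by (rule lap_domain_energy_space[OF dom])
  have tH: "t n \<in> energy_space c" for n unfolding t by (rule class_laplacian_energy_space[OF dom])
  have lap: "(\<lambda>n. laplacian c (s n) y) \<longlonglongrightarrow> laplacian c u y" for y
    using energy_tendsto_energy_right[OF sH u dirac_energy_space lim(1), of y]
    by (simp only: energy_dirac[OF sH] energy_dirac[OF u])
  have "(\<lambda>n. increment (t n) a y) \<longlonglongrightarrow> increment g a y"
    using energy_tendsto_energy_right[OF tH g dipole_energy_space lim(2), of a y]
    by (simp only: energy_dipole[OF tH] energy_dipole[OF g])
  moreover have "(\<lambda>n. increment (t n) a y) \<longlonglongrightarrow> laplacian c u y - laplacian c u a"
    unfolding t increment_class_of by (intro tendsto_diff lap)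
  ultimately show "increment g a y = laplacian c u y - laplacian c u a" by (rule LIMSEQ_unique)
qed

text \<open>Passing to the limit in the resolvent equation only yields \<open>\<Delta>u = \<delta>\<^sub>x\<close> up to an additive
  constant, because functions are identified modulo constants.\<close>

lemma weak_limit_laplacian:
  assumes eps: "\<epsilon> \<longlonglongrightarrow> (0 :: real)"
    and f: "\<And>k. (class_of (dirac x), f k) \<in> (shift_operator (\<epsilon> k) (lap_closure c a))\<inverse>"
    and weak: "weak_star_convergent c f"
  shows "\<exists>u\<in>energy_space c. \<exists>K. \<forall>y. laplacian c u y = dirac x y + K"
proof -
  obtain u where u: "u \<in> energy_space c"
    and lim: "\<And>h. h \<in> energy_space c \<Longrightarrow> (\<lambda>k. energy c (f k) h) \<longlonglongrightarrow> energy c u h"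
    using weak unfolding weak_star_convergent_def by blast
  have lim': "(\<lambda>k. energy c h (f k)) \<longlonglongrightarrow> energy c h u" if "h \<in> energy_space c" for h
  proof -
    have "energy c h v = cnj (energy c v h)" for v by (rule energy_cnj)
    then show ?thesis using tendsto_cnj[OF lim[OF that]] by (simp only:)
  qed
  obtain g where g: "\<And>k. (f k, g k) \<in> lap_closure c a"
    and eq: "\<And>k. class_of (dirac x) = scale_potential (complex_of_real (\<epsilon> k)) (f k) + g k"
    using f unfolding shift_operator_def converse_iff by (simp add: prod_eq_iff) metis
  have fH: "f k \<in> energy_space c" for k by (rule lap_closure_laplacian[OF g])
  have lap: "(\<lambda>k. laplacian c (f k) y) \<longlonglongrightarrow> laplacian c u y" for y
    using lim'[OF dirac_energy_space, of y] by (simp only: energy_dirac[OF fH] energy_dirac[OF u])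
  \<comment> \<open>Classes only record increments, so the defect at the reference vertex
    \<open>a\<close> remains as the constant.\<close>
  have "laplacian c u y = dirac x y + (laplacian c u a - dirac x a)" for y
  proof -
    \<comment> \<open>Convergence of the increments makes the term with the factor
      \<open>\<epsilon> k\<close> vanish in the limit.\<close>
    have inc: "(\<lambda>k. increment (f k) a y) \<longlonglongrightarrow> increment u a y"
      using lim'[OF dipole_energy_space, of a y] by (simp only: energy_dipole[OF fH] energy_dipole[OF u])
    have "dirac x y - dirac x a
        = complex_of_real (\<epsilon> k) * increment (f k) a y + (laplacian c (f k) y - laplacian c (f k) a)" for k
    proof -
      have "increment (class_of (dirac x)) a y
          = increment (scale_potential (complex_of_real (\<epsilon> k)) (f k) + g k) a y"
        by (simp only: eq[of k])
      then show ?thesis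
        by (simp only: increment_class_of increment_add increment_scale lap_closure_laplacian(2)[OF g])
    qed
    moreover have "(\<lambda>k. complex_of_real (\<epsilon> k) * increment (f k) a y
          + (laplacian c (f k) y - laplacian c (f k) a))
        \<longlonglongrightarrow> complex_of_real 0 * increment u a y + (laplacian c u y - laplacian c u a)"
      by (intro tendsto_intros eps inc lap)
    ultimately have "(\<lambda>k :: nat. dirac x y - dirac x a) \<longlonglongrightarrow>
        complex_of_real 0 * increment u a y + (laplacian c u y - laplacian c u a)"
      by (simp only:)
    then have "dirac x y - dirac x a = laplacian c u y - laplacian c u a"
      by (simp add: LIMSEQ_const_iff)
    then show ?thesis by (simp add: algebra_simps)
  qed
  then show ?thesis using u by blast
qed

text \<open>The pairing of \<open>u\<close> with the null sequence is
  \<open>\<phi> n x + K * M n\<close>; it tends to 0 although \<open>\<phi> n x\<close> tends to 1.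
  This excludes \<open>K = 0\<close>; otherwise the masses \<open>M n\<close> converge, although the
  nonnegative \<open>\<phi> n\<close> tend to 1 at infinitely many vertices.\<close>

lemma transient_if_dirac_plus_constant:
  assumes u: "u \<in> energy_space c" and lap: "\<And>y. laplacian c u y = dirac x y + K"
  shows "transient c"
  unfolding transient_def
proof (rule allI, rule ccontr)
  fix z assume "\<not> return_probability c z < 1"
  moreover have "return_probability c z \<le> 1"
    unfolding return_probability_hit by (intro cSUP_least hit_le_1) simp
  ultimately have "return_probability c z = 1" by simp
  from recurrent_null_sequence[OF this] obtain \<phi> :: "nat \<Rightarrow> 'v \<Rightarrow> real"
    where fin: "\<And>n. finite {y. \<phi> n y \<noteq> 0}" and z: "\<And>n. \<phi> n z = 1" and pos: "\<And>n y. 0 \<le> \<phi> n y"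
      and null: "(\<lambda>n. energy_norm c (class_of (\<lambda>y. complex_of_real (\<phi> n y)))) \<longlonglongrightarrow> 0"
    by blast
  define p where "p n = class_of (\<lambda>y. complex_of_real (\<phi> n y))" for n
  have fin': "finite {y. complex_of_real (\<phi> n y) \<noteq> 0}" for n using fin[of n] by simp
  have pH: "p n \<in> energy_space c" for n
    unfolding p_def by (rule finite_support_energy_space[OF fin'])
  \<comment> \<open>The value 1 at \<open>z\<close> and vanishing energy force the limit 1 at every
    vertex, by \<open>increment_bounded\<close>.\<close>
  have \<phi>_lim: "(\<lambda>n. \<phi> n y) \<longlonglongrightarrow> 1" for y
  proof -
    obtain B where B: "\<forall>u\<in>energy_space c. cmod (increment u z y) \<le> B * energy_norm c u"
      using increment_bounded by blast
    have "(\<lambda>n. \<phi> n y - 1) \<longlonglongrightarrow> 0"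
    proof (rule Lim_null_comparison)
      show "\<forall>\<^sub>F n in sequentially. norm (\<phi> n y - 1) \<le> B * energy_norm c (p n)"
      proof (intro always_eventually allI)
        fix n
        have "increment (p n) z y = complex_of_real (\<phi> n y - 1)"
          by (simp add: p_def increment_class_of z)
        then have "cmod (increment (p n) z y) = \<bar>\<phi> n y - 1\<bar>" by (simp only: norm_of_real)
        then show "norm (\<phi> n y - 1) \<le> B * energy_norm c (p n)" using B pH[of n] by fastforce
      qed
      show "(\<lambda>n. B * energy_norm c (p n)) \<longlonglongrightarrow> 0"
        using tendsto_mult_left[OF null, of B] by (simp add: p_def)
    qed
    then show ?thesis by (simp add: LIM_zero_iff)
  qed
  define M where "M n = (\<Sum>y | \<phi> n y \<noteq> 0. \<phi> n y)" for n
  have en: "energy c (p n) u = complex_of_real (\<phi> n x) + K * complex_of_real (M n)" for n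
  proof -
    have "energy c (p n) u = (\<Sum>y | \<phi> n y \<noteq> 0. complex_of_real (\<phi> n y) * (dirac x y + K))"
      unfolding p_def energy_finite_support[OF fin' u] lap by simp
    also have "\<dots> = (\<Sum>y | \<phi> n y \<noteq> 0. complex_of_real (\<phi> n y) * dirac x y) + K * complex_of_real (M n)"
      by (simp add: M_def sum_distrib_left distrib_left sum.distrib mult.commute)
    also have "(\<Sum>y | \<phi> n y \<noteq> 0. complex_of_real (\<phi> n y) * dirac x y)
        = (\<Sum>y | \<phi> n y \<noteq> 0. if y = x then complex_of_real (\<phi> n x) else 0)"
      by (intro sum.cong) (auto simp: dirac_def)
    also have "\<dots> = complex_of_real (\<phi> n x)" using fin[of n] by simp
    finally show ?thesis .
  qed
  have "(\<lambda>n. energy c (p n) u) \<longlonglongrightarrow> 0"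
  proof (rule Lim_null_comparison)
    show "\<forall>\<^sub>F n in sequentially. norm (energy c (p n) u) \<le> energy_norm c (p n) * energy_norm c u"
      by (intro always_eventually allI energy_Cauchy_Schwarz pH u)
    show "(\<lambda>n. energy_norm c (p n) * energy_norm c u) \<longlonglongrightarrow> 0"
      using tendsto_mult_right[OF null, of "energy_norm c u"] by (simp add: p_def)
  qed
  moreover have x_lim: "(\<lambda>n. complex_of_real (\<phi> n x)) \<longlonglongrightarrow> complex_of_real 1"
    by (intro tendsto_of_real \<phi>_lim)
  ultimately have "(\<lambda>n. energy c (p n) u - complex_of_real (\<phi> n x)) \<longlonglongrightarrow> 0 - complex_of_real 1"
    by (rule tendsto_diff)
  then have KM: "(\<lambda>n. K * complex_of_real (M n)) \<longlonglongrightarrow> - 1" by (simp add: en)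
  show False
  proof (cases "K = 0")
    case True
    then show False using KM by (simp add: LIMSEQ_const_iff)
  next
    case False
    then have "(\<lambda>n. inverse K * (K * complex_of_real (M n))) \<longlonglongrightarrow> inverse K * - 1"
      using KM by (intro tendsto_intros)
    then have "(\<lambda>n. complex_of_real (M n)) \<longlonglongrightarrow> inverse K * - 1"
      using False by (simp add: mult.assoc[symmetric])
    from tendsto_Re[OF this] have M_lim: "M \<longlonglongrightarrow> Re (inverse K * - 1)" by simp
    \<comment> \<open>\<open>N\<close> exceeds the limit of the masses, while any \<open>N\<close>
      vertices carry mass tending to \<open>N\<close>.\<close>
    obtain N :: nat where N: "Re (inverse K * - 1) < real N" using reals_Archimedean2 by blast
    obtain S :: "'v set" where S: "finite S" "card S = N"
      using infinite_arbitrarily_large[OF infinite_vertices] by blast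
    have "real N \<le> Re (inverse K * - 1)"
    proof (rule LIMSEQ_le[OF _ M_lim])
      have "(\<lambda>n. \<Sum>y\<in>S. \<phi> n y) \<longlonglongrightarrow> (\<Sum>y\<in>S. 1)" by (intro tendsto_sum \<phi>_lim)
      then show "(\<lambda>n. \<Sum>y\<in>S. \<phi> n y) \<longlonglongrightarrow> real N" by (simp add: S)
      have "(\<Sum>y\<in>S. \<phi> n y) \<le> M n" for n
      proof -
        have "(\<Sum>y\<in>S. \<phi> n y) = (\<Sum>y\<in>{y \<in> S. \<phi> n y \<noteq> 0}. \<phi> n y)"
          using S(1) by (intro sum.mono_neutral_right) auto
        also have "\<dots> \<le> M n" unfolding M_def by (intro sum_mono2 fin pos) auto
        finally show ?thesis .
      qed
      then show "\<exists>k. \<forall>n\<ge>k. (\<Sum>y\<in>S. \<phi> n y) \<le> M n" by blast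
    qed
    then show False using N by simp
  qed
qed

end

section \<open>The resolvent on a transient network\<close>

definition clip :: "real \<Rightarrow> complex \<Rightarrow> complex" where
  "clip t s = (if cmod s \<le> t then s else complex_of_real (t / cmod s) * s)"

text \<open>Identifies the truncation with a nearest-point map onto a convex set, which is
  1-Lipschitz. Outside the disc the distance is \<open>cmod s - t\<close>, least possible by the
  triangle inequality.\<close>

lemma clip_closest_point:
  assumes t: "0 \<le> t"
  shows "clip t s = closest_point (cball 0 t) s"
proof (rule closest_point_unique)
  have norm: "cmod (clip t s) \<le> t"
  proof (cases "cmod s \<le> t")
    case False
    then have "0 < cmod s" using t by linarith
    then show ?thesis using False t by (simp add: clip_def norm_mult norm_divide)
  qed (simp add: clip_def)
  then show "clip t s \<in> cball 0 t" by simp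
  show "\<forall>z\<in>cball 0 t. dist s (clip t s) \<le> dist s z"
  proof
    fix z :: complex assume "z \<in> cball 0 t"
    then have z: "cmod z \<le> t" by simp
    show "dist s (clip t s) \<le> dist s z"
    proof (cases "cmod s \<le> t")
      case True
      then show ?thesis by (simp add: clip_def)
    next
      case False
      then have s: "0 < cmod s" using t by linarith
      have "s - clip t s = complex_of_real (1 - t / cmod s) * s"
        using False by (simp add: clip_def algebra_simps)
      then have "cmod (s - clip t s) = \<bar>1 - t / cmod s\<bar> * cmod s"
        by (simp only: norm_mult norm_of_real)
      also have "\<dots> = cmod s - t" using False s by (simp add: field_simps abs_if)
      also have "\<dots> \<le> cmod s - cmod z" using z by simp
      also have "\<dots> \<le> cmod (s - z)" by (rule norm_triangle_ineq2)
      finally show ?thesis by (simp add: dist_norm)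
    qed
  qed
qed auto

lemma clip_lipschitz_point:
  assumes "0 \<le> t"
  shows "cmod (clip t s - clip t s') \<le> cmod (s - s')"
  using closest_point_lipschitz[of "cball 0 t" s s'] assms
  by (simp add: clip_closest_point dist_norm)

lemma clip_min: "0 \<le> t \<Longrightarrow> clip t s = complex_of_real (min t (cmod s) / cmod s) * s"
  by (simp add: clip_def min_def)

lemma clip_lipschitz_radius:
  assumes "0 \<le> t" "0 \<le> t'"
  shows "cmod (clip t s - clip t' s) \<le> \<bar>t - t'\<bar>"
proof (cases "s = 0")
  case False
  have "clip t s - clip t' s
      = complex_of_real ((min t (cmod s) - min t' (cmod s)) / cmod s) * s"
    using assms by (simp add: clip_min diff_divide_distrib algebra_simps)
  then have "cmod (clip t s - clip t' s) = \<bar>(min t (cmod s) - min t' (cmod s)) / cmod s\<bar> * cmod s"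
    by (simp only: norm_mult norm_of_real)
  also have "\<dots> = \<bar>min t (cmod s) - min t' (cmod s)\<bar>" using False by (simp add: abs_divide)
  also have "\<dots> \<le> \<bar>t - t'\<bar>" by (simp add: min_def abs_if)
  finally show ?thesis .
qed (simp add: clip_def assms)

text \<open>Point and radius vary together because \<open>D\<close> will be cut at a radius that
  depends on the vertex.\<close>

lemma clip_lipschitz:
  assumes "0 \<le> t" "0 \<le> t'"
  shows "cmod (clip t s - clip t' s') \<le> cmod (s - s') + \<bar>t - t'\<bar>"
proof -
  have "cmod (clip t s - clip t' s') \<le> cmod (clip t s - clip t s') + cmod (clip t s' - clip t' s')"
    using norm_triangle_ineq[of "clip t s - clip t s'" "clip t s' - clip t' s'"] by simp
  then show ?thesis
    using clip_lipschitz_point[OF assms(1), of s s'] clip_lipschitz_radius[OF assms, of s'] by linarith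
qed

lemma Re_cnj_clip_nonneg:
  assumes "0 \<le> t"
  shows "0 \<le> Re (cnj (clip t s) * s)"
proof -
  have "cnj (clip t s) * s = complex_of_real (min t (cmod s) / cmod s) * (cnj s * s)"
    using assms by (simp only: clip_min complex_cnj_mult complex_cnj_complex_of_real mult.assoc)
  also have "cnj s * s = complex_of_real ((cmod s)\<^sup>2)"
    by (metis complex_norm_square mult.commute)
  finally have "Re (cnj (clip t s) * s) = min t (cmod s) / cmod s * (cmod s)\<^sup>2"
    by (simp only: of_real_mult[symmetric] Re_complex_of_real)
  then show ?thesis using assms by simp
qed

context resistance_network
begin

section \<open>Density of the dipoles and weak convergence\<close>

lemma span_dipole_dense:
  assumes h: "h \<in> energy_space c"
  shows "h \<in> energy_closure c (potential.span (range (dipole c a)))"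
proof -
  let ?D = "potential.span (range (dipole c a))"
  have DH: "?D \<subseteq> energy_space c"
    by (rule potential.span_minimal[OF _ subspace_energy_space]) (auto simp: dipole_energy_space)
  obtain p where p: "p \<in> energy_closure c ?D" and orth: "\<And>v. v \<in> ?D \<Longrightarrow> energy c (h - p) v = 0"
    using orthogonal_projection[OF DH potential.subspace_span h] by blast
  have pH: "p \<in> energy_space c" using p energy_closure_subset by blast
  have "energy c (dipole c a y) (h - p) = 0" for y
    by (rule energy_eq_0_commute, rule orth, rule potential.span_base) simp
  then have "h - p = 0" by (rule orthogonal_dipoles_imp_zero[OF energy_space_diff[OF h pH]])
  then show ?thesis using p by simp
qed

text \<open>Pointwise convergence of increments is convergence against dipoles; density of their
  span and the uniform bound extend it to every \<open>h\<close>.\<close>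

lemma bounded_pointwise_imp_weak:
  assumes s: "\<And>n. s n \<in> energy_space c" and u: "u \<in> energy_space c"
    and bd: "\<And>n. energy_norm c (s n) \<le> B"
    and pw: "\<And>y. (\<lambda>n. increment (s n) a y) \<longlonglongrightarrow> increment u a y"
    and h: "h \<in> energy_space c"
  shows "(\<lambda>n. energy c h (s n)) \<longlonglongrightarrow> energy c h u"
proof -
  let ?D = "potential.span (range (dipole c a))"
  have DH: "?D \<subseteq> energy_space c"
    by (rule potential.span_minimal[OF _ subspace_energy_space]) (auto simp: dipole_energy_space)
  define T where "T = {v \<in> energy_space c. (\<lambda>n. energy c v (s n)) \<longlonglongrightarrow> energy c v u}"
  have T: "potential.subspace T"
    unfolding potential.subspace_def
  proof (intro conjI ballI allI)
    have z: "energy c 0 v = 0" for v using energy_scale_left[of 0 0 v] by simp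
    show "0 \<in> T" by (simp add: T_def z energy_space_zero)
    fix v assume v: "v \<in> T"
    then show "scale_potential k v \<in> T" for k
      by (auto simp: T_def energy_scale_left energy_space_scale intro: tendsto_mult_left)
    fix w assume w: "w \<in> T"
    have "(\<lambda>n. energy c v (s n) + energy c w (s n)) \<longlonglongrightarrow> energy c v u + energy c w u"
      using v w by (intro tendsto_add) (auto simp: T_def)
    then show "v + w \<in> T" using v w by (simp add: T_def energy_add_left s u energy_space_add)
  qed
  have "dipole c a y \<in> T" for y
    using pw[of y] by (simp add: T_def dipole_energy_space energy_dipole s u)
  then have "range (dipole c a) \<subseteq> T" by blast
  then have DT: "?D \<subseteq> T" by (rule potential.span_minimal[OF _ T])
  have B: "0 \<le> B" using bd[of 0] energy_norm_nonneg[of "s 0"] by linarith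
  obtain v where v: "\<And>m. v m \<in> ?D" and vlim: "energy_tendsto c v h"
    using energy_closureD[OF span_dipole_dense[OF h]] by blast
  have vH: "v m \<in> energy_space c" for m using DH v by blast
  \<comment> \<open>Bounds the norm of \<open>s n - u\<close>; the added 1 makes it
    positive.\<close>
  let ?C = "B + energy_norm c u + 1"
  have C: "0 < ?C" using B energy_norm_nonneg[of u] by linarith
  show ?thesis
  proof (rule metric_LIMSEQ_I)
    fix e :: real assume e: "0 < e"
    have "0 < e / (2 * ?C)" using e C by simp
    then have "\<forall>\<^sub>F m in sequentially. energy_norm c (v m - h) < e / (2 * ?C)"
      by (rule order_tendstoD(2)[OF vlim[unfolded energy_tendsto_def]])
    then obtain m where m: "energy_norm c (v m - h) < e / (2 * ?C)"
      using eventually_happens'[OF sequentially_bot] by blast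
    have "(\<lambda>n. energy c (v m) (s n)) \<longlonglongrightarrow> energy c (v m) u" using DT v by (auto simp: T_def)
    then obtain N where N: "\<And>n. n \<ge> N \<Longrightarrow> dist (energy c (v m) (s n)) (energy c (v m) u) < e / 2"
      using metric_LIMSEQ_D[of _ _ "e / 2"] e by (metis half_gt_zero)
    have "dist (energy c h (s n)) (energy c h u) < e" if n: "n \<ge> N" for n
    proof -
      have d: "s n - u \<in> energy_space c" by (intro energy_space_diff s u)
      have "energy c h (s n) - energy c h u = energy c (v m) (s n - u) - energy c (v m - h) (s n - u)"
        by (simp add: energy_diff_left energy_diff_right vH h s u energy_space_diff)
      then have "cmod (energy c h (s n) - energy c h u)
          \<le> cmod (energy c (v m) (s n - u)) + cmod (energy c (v m - h) (s n - u))"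
        by (simp add: norm_triangle_ineq4)
      moreover have "cmod (energy c (v m) (s n - u)) < e / 2"
        using N[OF n] by (simp add: dist_norm energy_diff_right vH s u)
      moreover have "cmod (energy c (v m - h) (s n - u)) \<le> e / 2"
      proof -
        have "energy_norm c (s n - u) \<le> energy_norm c (s n) + energy_norm c u"
          using energy_norm_triangle_diff[OF s[of n] energy_space_zero u] energy_norm_minus[of 0 u] by simp
        then have C': "energy_norm c (s n - u) \<le> ?C" using bd[of n] by linarith
        have "cmod (energy c (v m - h) (s n - u)) \<le> energy_norm c (v m - h) * energy_norm c (s n - u)"
          by (intro energy_Cauchy_Schwarz energy_space_diff vH h s u)
        also have "\<dots> \<le> e / (2 * ?C) * ?C"
          using m C' e C by (intro mult_mono) (auto simp: energy_norm_nonneg)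
        also have "\<dots> = e / 2" using C by (simp add: field_simps)
        finally show ?thesis .
      qed
      ultimately show ?thesis by (simp add: dist_norm)
    qed
    then show "\<exists>no. \<forall>n\<ge>no. dist (energy c h (s n)) (energy c h u) < e" by blast
  qed
qed

lemma energy_norm_sq_le_if_increments_le:
  assumes v: "v \<in> energy_space c" and w: "w \<in> energy_space c" and u: "u \<in> energy_space c"
    and le: "\<And>x y. cmod (increment u x y) \<le> cmod (increment v x y) + cmod (increment w x y)"
  shows "(energy_norm c u)\<^sup>2 \<le> 2 * (energy_norm c v)\<^sup>2 + 2 * (energy_norm c w)\<^sup>2"
proof -
  let ?q = "\<lambda>w (x, y). c x y * (cmod (increment w x y))\<^sup>2"
  have hs: "(?q w has_sum 2 * (energy_norm c w)\<^sup>2) UNIV" if "w \<in> energy_space c" for w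
    unfolding Re_energy_norm[symmetric] Re_energy_self
    using that by (simp add: energy_space_def finite_energy_iff has_sum_infsum)
  have "2 * (energy_norm c u)\<^sup>2 \<le> 2 * (2 * (energy_norm c v)\<^sup>2) + 2 * (2 * (energy_norm c w)\<^sup>2)"
  proof (rule has_sum_mono[OF hs[OF u]])
    show "((\<lambda>z. 2 * ?q v z + 2 * ?q w z) has_sum
        2 * (2 * (energy_norm c v)\<^sup>2) + 2 * (2 * (energy_norm c w)\<^sup>2)) UNIV"
      by (intro has_sum_add has_sum_cmult_right hs v w)
    fix z :: "'v \<times> 'v"
    obtain x y where z: "z = (x, y)" by (cases z)
    let ?a = "cmod (increment v x y)" and ?b = "cmod (increment w x y)"
    have "(cmod (increment u x y))\<^sup>2 \<le> (?a + ?b)\<^sup>2" by (intro power_mono le) simp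
    also have "\<dots> \<le> 2 * ?a\<^sup>2 + 2 * ?b\<^sup>2"
      using sum_squares_bound[of ?a ?b] by (simp add: power2_sum)
    finally have "c x y * (cmod (increment u x y))\<^sup>2 \<le> c x y * (2 * ?a\<^sup>2 + 2 * ?b\<^sup>2)"
      by (intro mult_left_mono conductance_nonneg)
    then show "?q u z \<le> 2 * ?q v z + 2 * ?q w z" by (simp add: z algebra_simps)
  qed
  then show ?thesis by simp
qed

text \<open>Test the equation against the truncations of \<open>D\<close> by a finitely supported approximating
  sequence: they converge weakly to \<open>class_of D\<close>, so \<open>\<parallel>class_of D\<parallel>\<^sup>2 \<le> 0\<close>.\<close>

lemma no_eigenfunction_in_Fin:
  assumes D: "class_of D \<in> energy_space c" and e: "0 < e"
    and lap: "\<And>y. laplacian c (class_of D) y = - complex_of_real e * D y"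
    and \<phi>: "\<And>n. finite {y. \<phi> n y \<noteq> 0}"
    and \<phi>_lim: "energy_tendsto c (\<lambda>n. class_of (\<phi> n)) (class_of D)"
    and \<phi>_pw: "\<And>y. (\<lambda>n. \<phi> n y) \<longlonglongrightarrow> D y"
  shows "class_of D = 0"
proof -
  let ?g = "class_of D"
  fix a :: 'v
  define \<psi> where "\<psi> n y = clip (cmod (\<phi> n y)) (D y)" for n y
  have supp: "finite {y. \<psi> n y \<noteq> 0}" for n
  proof (rule finite_subset[OF _ \<phi>[of n]])
    show "{y. \<psi> n y \<noteq> 0} \<subseteq> {y. \<phi> n y \<noteq> 0}" by (auto simp: \<psi>_def clip_def)
  qed
  define s where "s n = class_of (\<psi> n)" for n
  have sH: "s n \<in> energy_space c" for n unfolding s_def by (rule finite_support_energy_space[OF supp])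
  have \<phi>H: "class_of (\<phi> n) \<in> energy_space c" for n by (rule finite_support_energy_space[OF \<phi>])
  have \<psi>_lim: "(\<lambda>n. \<psi> n y) \<longlonglongrightarrow> D y" for y
  proof -
    have "(\<lambda>n. \<psi> n y - D y) \<longlonglongrightarrow> 0"
    proof (rule Lim_null_comparison)
      show "\<forall>\<^sub>F n in sequentially. norm (\<psi> n y - D y) \<le> cmod (\<phi> n y - D y)"
      proof (intro always_eventually allI)
        fix n
        have "cmod (clip (cmod (\<phi> n y)) (D y) - clip (cmod (D y)) (D y)) \<le> \<bar>cmod (\<phi> n y) - cmod (D y)\<bar>"
          by (intro clip_lipschitz_radius) auto
        also have "\<dots> \<le> cmod (\<phi> n y - D y)" by (rule norm_triangle_ineq3)
        finally show "norm (\<psi> n y - D y) \<le> cmod (\<phi> n y - D y)"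
          by (simp add: \<psi>_def) (simp add: clip_def)
      qed
      show "(\<lambda>n. cmod (\<phi> n y - D y)) \<longlonglongrightarrow> 0"
        using \<phi>_pw[of y] by (simp add: LIM_zero tendsto_norm_zero)
    qed
    then show ?thesis by (simp add: LIM_zero_iff)
  qed
  have "convergent (\<lambda>n. energy_norm c (class_of (\<phi> n)))"
    using energy_tendsto_norm[OF \<phi>H D \<phi>_lim] by (auto simp: convergent_def)
  then obtain B where B: "\<And>n. \<bar>energy_norm c (class_of (\<phi> n))\<bar> \<le> B"
    using convergent_imp_Bseq BseqE by (metis real_norm_def)
  have bound: "energy_norm c (s n) \<le> sqrt (2 * (energy_norm c ?g)\<^sup>2 + 2 * B\<^sup>2)" for n
  proof (rule real_le_rsqrt)
    \<comment> \<open>The joint Lipschitz bound for \<open>clip\<close> controls the energy of the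
      truncations by those of \<open>D\<close> and \<open>\<phi> n\<close>, uniformly in
      \<open>n\<close>.\<close>
    have "cmod (increment (s n) x y) \<le> cmod (increment ?g x y) + cmod (increment (class_of (\<phi> n)) x y)" for x y
    proof -
      have "cmod (\<psi> n y - \<psi> n x) \<le> cmod (D y - D x) + \<bar>cmod (\<phi> n y) - cmod (\<phi> n x)\<bar>"
        unfolding \<psi>_def by (intro clip_lipschitz) auto
      also have "\<dots> \<le> cmod (D y - D x) + cmod (\<phi> n y - \<phi> n x)"
        by (intro add_left_mono norm_triangle_ineq3)
      finally show ?thesis by (simp add: s_def increment_class_of)
    qed
    from energy_norm_sq_le_if_increments_le[OF D \<phi>H sH this]
    have "(energy_norm c (s n))\<^sup>2 \<le> 2 * (energy_norm c ?g)\<^sup>2 + 2 * (energy_norm c (class_of (\<phi> n)))\<^sup>2" .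
    also have "(energy_norm c (class_of (\<phi> n)))\<^sup>2 \<le> B\<^sup>2"
      by (intro power_mono energy_norm_nonneg) (use B[of n] in linarith)
    finally show "(energy_norm c (s n))\<^sup>2 \<le> 2 * (energy_norm c ?g)\<^sup>2 + 2 * B\<^sup>2" by simp
  qed
  have "(\<lambda>n. increment (s n) a y) \<longlonglongrightarrow> increment ?g a y" for y
    unfolding s_def increment_class_of by (intro tendsto_diff \<psi>_lim)
  from bounded_pointwise_imp_weak[OF sH D bound this D]
  have "(\<lambda>n. Re (energy c ?g (s n))) \<longlonglongrightarrow> Re (energy c ?g ?g)" by (rule tendsto_Re)
  moreover have "Re (energy c ?g (s n)) \<le> 0" for n
  proof -
    \<comment> \<open>By Gauss-Green the Laplacian falls on \<open>D\<close>, where the negative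
      eigenvalue supplies the sign.\<close>
    have "Re (energy c ?g (s n)) = Re (energy c (s n) ?g)"
      by (subst energy_cnj) simp
    also have "\<dots> = - (\<Sum>y | \<psi> n y \<noteq> 0. e * Re (cnj (\<psi> n y) * D y))"
      unfolding s_def energy_finite_support[OF supp D] lap
      by (simp add: sum_negf[symmetric] algebra_simps)
    also have "\<dots> \<le> 0"
      using e by (auto simp: \<psi>_def intro!: sum_nonneg mult_nonneg_nonneg Re_cnj_clip_nonneg
          simp del: times_complex.sel)
    finally show ?thesis .
  qed
  ultimately have "Re (energy c ?g ?g) \<le> 0" by (intro LIMSEQ_le_const2) auto
  then have "(energy_norm c ?g)\<^sup>2 \<le> 0" by (simp only: Re_energy_norm)
  then have "energy_norm c ?g = 0" by simp
  then show ?thesis by (rule energy_norm_eq_0[OF D])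
qed

text \<open>Gauss-Green with \<Delta>u as the finitely supported function turns the pairing into the
  sum of |\<Delta>u|^2.\<close>

lemma energy_laplacian_nonneg:
  assumes "u \<in> lap_domain c a"
  shows "0 \<le> Re (energy c u (class_of (laplacian c u)))"
proof -
  have u: "u \<in> energy_space c" and fin: "finite {y. laplacian c u y \<noteq> 0}"
    using lap_domain_finite[OF assms] by auto
  have "Re (energy c u (class_of (laplacian c u))) = Re (energy c (class_of (laplacian c u)) u)"
    by (subst energy_cnj) simp
  also have "\<dots> = (\<Sum>y | laplacian c u y \<noteq> 0. Re (cnj (laplacian c u y) * laplacian c u y))"
    by (simp add: energy_finite_support[OF fin u])
  also have "0 \<le> \<dots>" by (intro sum_nonneg) simp
  finally show ?thesis .
qed

text \<open>Positivity bounds the pairing of \<open>u\<close> with its image below by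
  \<open>e * (energy_norm c u)^2\<close>; Cauchy-Schwarz then allows one factor to be
  cancelled.\<close>

lemma lap_domain_coercive:
  assumes u: "u \<in> lap_domain c a" and e: "0 < e"
  shows "e * energy_norm c u \<le> energy_norm c (scale_potential (complex_of_real e) u + class_of (laplacian c u))"
proof (cases "energy_norm c u = 0")
  case True
  then show ?thesis by (simp add: energy_norm_nonneg)
next
  case False
  then have N: "0 < energy_norm c u" using energy_norm_nonneg[of u] by simp
  have uH: "u \<in> energy_space c" by (rule lap_domain_energy_space[OF u])
  have gH: "class_of (laplacian c u) \<in> energy_space c" by (rule class_laplacian_energy_space[OF u])
  let ?r = "scale_potential (complex_of_real e) u + class_of (laplacian c u)"
  have rH: "?r \<in> energy_space c" by (intro energy_space_add energy_space_scale uH gH)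
  have "energy c u ?r = complex_of_real e * energy c u u + energy c u (class_of (laplacian c u))"
    by (simp add: energy_add_right energy_scale_right energy_space_scale uH gH)
  then have "Re (energy c u ?r) = e * Re (energy c u u) + Re (energy c u (class_of (laplacian c u)))"
    by simp
  then have "e * (energy_norm c u)\<^sup>2 \<le> Re (energy c u ?r)"
    using energy_laplacian_nonneg[OF u] by (simp add: Re_energy_norm)
  also have "\<dots> \<le> energy_norm c u * energy_norm c ?r"
    using energy_Cauchy_Schwarz[OF uH rH] complex_Re_le_cmod order_trans by blast
  finally have "energy_norm c u * (e * energy_norm c u) \<le> energy_norm c u * energy_norm c ?r"
    by (simp add: power2_eq_square mult.left_commute)
  then show ?thesis using N by simp
qed

text \<open>A dipole sees the harmonic part of \<open>g\<close> only through its own harmonic part,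
  so that part of \<open>g\<close> is orthogonal to all dipoles and vanishes.\<close>

lemma orthogonal_harmonic_dipoles_imp_Fin:
  assumes g: "g \<in> energy_space c"
    and orth: "\<And>y. energy c (dipole c a y - proj_Fin c (dipole c a y)) g = 0"
  shows "g \<in> Fin c"
proof -
  let ?q = "proj_Fin c g"
  have qF: "?q \<in> Fin c" and qH: "?q \<in> energy_space c"
    using proj_Fin_in[OF g] proj_Fin_energy_space[OF g] by auto
  have "energy c (dipole c a y) (g - ?q) = 0" for y
  proof -
    let ?v = "dipole c a y" and ?p = "proj_Fin c (dipole c a y)"
    have vH: "?v \<in> energy_space c" and pF: "?p \<in> Fin c" and pH: "?p \<in> energy_space c"
      by (simp_all add: dipole_energy_space proj_Fin_in proj_Fin_energy_space)
    have "energy c (?v - ?p) ?q = 0"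
      using energy_proj_Fin_right[OF vH qF] by (rule energy_eq_0_commute)
    moreover have "energy c ?p (g - ?q) = 0" by (rule energy_proj_Fin_right[OF g pF])
    ultimately show ?thesis
      using orth[of y] by (simp add: energy_diff_left energy_diff_right vH pH qH g)
  qed
  then have "g - ?q = 0" by (rule orthogonal_dipoles_imp_zero[OF energy_space_diff[OF g qH]])
  then show ?thesis using qF by simp
qed

lemma class_laplacian_add:
  assumes "u \<in> lap_domain c a" "v \<in> lap_domain c a"
  shows "class_of (laplacian c (u + v)) = class_of (laplacian c u) + class_of (laplacian c v)"
proof -
  have "laplacian c (u + v) = (\<lambda>y. laplacian c u y + laplacian c v y)"
    by (rule ext) (rule laplacian_add[OF assms[THEN lap_domain_energy_space]])
  then show ?thesis by (simp only: class_of_add)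
qed

lemma class_laplacian_scale:
  assumes "u \<in> lap_domain c a"
  shows "class_of (laplacian c (scale_potential k u)) = scale_potential k (class_of (laplacian c u))"
proof -
  have "laplacian c (scale_potential k u) = (\<lambda>y. k * laplacian c u y)"
    by (rule ext) (rule laplacian_scale[OF lap_domain_energy_space[OF assms]])
  then show ?thesis by (simp only: class_of_scale)
qed

lemma class_laplacian_diff:
  assumes "u \<in> lap_domain c a" "v \<in> lap_domain c a"
  shows "class_of (laplacian c (u - v)) = class_of (laplacian c u) - class_of (laplacian c v)"
proof -
  have "laplacian c (u - v) = (\<lambda>y. laplacian c u y - laplacian c v y)"
    by (rule ext) (rule laplacian_diff[OF assms[THEN lap_domain_energy_space]])
  then show ?thesis by (simp only: class_of_diff)
qed

text \<open>Coercivity passes to the closure by continuity. The difference form serves to compare a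
  resolvent vector \<open>f\<close> with an explicit approximate solution \<open>u\<close>.\<close>

lemma lap_closure_coercive:
  assumes fg: "(f, g) \<in> lap_closure c a" and u: "u \<in> lap_domain c a" and e: "0 < e"
  shows "e * energy_norm c (u - f) \<le>
    energy_norm c (scale_potential (complex_of_real e) (u - f) + (class_of (laplacian c u) - g))"
proof -
  obtain s t where f: "f \<in> energy_space c" and g: "g \<in> energy_space c"
    and st: "\<And>n. (s n, t n) \<in> lap_graph c a"
    and lim: "energy_tendsto c s f" "energy_tendsto c t g"
    using fg unfolding lap_closure_def graph_closure_def by blast
  have dom: "s n \<in> lap_domain c a" and t: "t n = class_of (laplacian c (s n))" for n
    using st[of n] by (auto simp: lap_graph_def)
  have sH: "s n \<in> energy_space c" for n by (rule lap_domain_energy_space[OF dom])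
  have tH: "t n \<in> energy_space c" for n unfolding t by (rule class_laplacian_energy_space[OF dom])
  have uH: "u \<in> energy_space c" by (rule lap_domain_energy_space[OF u])
  have lH: "class_of (laplacian c u) \<in> energy_space c" by (rule class_laplacian_energy_space[OF u])
  have const: "energy_tendsto c (\<lambda>_. v) v" for v by (simp add: energy_tendsto_def)
  show ?thesis
  proof (rule LIMSEQ_le)
    show "(\<lambda>n. e * energy_norm c (u - s n)) \<longlonglongrightarrow> e * energy_norm c (u - f)"
      by (intro tendsto_mult_left energy_tendsto_norm energy_tendsto_diff const energy_space_diff uH sH f lim)
    show "(\<lambda>n. energy_norm c (scale_potential (complex_of_real e) (u - s n) + (class_of (laplacian c u) - t n)))
        \<longlonglongrightarrow> energy_norm c (scale_potential (complex_of_real e) (u - f) + (class_of (laplacian c u) - g))"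
      by (intro energy_tendsto_norm energy_tendsto_add energy_tendsto_scale energy_tendsto_diff const
          energy_space_add energy_space_scale energy_space_diff uH lH sH tH f g lim)
    have "e * energy_norm c (u - s n)
        \<le> energy_norm c (scale_potential (complex_of_real e) (u - s n) + (class_of (laplacian c u) - t n))" for n
      using lap_domain_coercive[OF potential.subspace_diff[OF lap_domain_subspace u dom] e, of n]
      unfolding class_laplacian_diff[OF u dom] t .
    then show "\<exists>N. \<forall>n\<ge>N. e * energy_norm c (u - s n)
        \<le> energy_norm c (scale_potential (complex_of_real e) (u - s n) + (class_of (laplacian c u) - t n))"
      by blast
  qed
qed

end

section \<open>The monopole and the resolvent on a transient network\<close>

context infinite_network
begin

text \<open>The capacity bound makes evaluation at \<open>a\<close> a bounded functional on finitely
  supported classes; its Riesz vector, tested on Dirac masses, is a monopole.\<close>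

lemma transient_monopole:
  assumes "transient c"
  shows "\<exists>w. monopole c a w"
proof -
  have "return_probability c a < 1" using assms by (simp add: transient_def)
  then obtain C where C: "\<And>f. finite {y. f y \<noteq> 0} \<Longrightarrow> (cmod (f a))\<^sup>2 \<le> C * (energy_norm c (class_of f))\<^sup>2"
    using capacity_bound by blast
  note rep = finitely_supportedE[OF infinite_vertices]
  have "\<exists>p\<in>energy_closure c finitely_supported. \<forall>h\<in>finitely_supported. energy c p h = finite_rep h a"
  proof (rule Riesz_subspace[OF finitely_supported_subset subspace_finitely_supported])
    fix u v :: "'v potential" assume u: "u \<in> finitely_supported" and v: "v \<in> finitely_supported"
    have "finite {y. finite_rep u y + finite_rep v y \<noteq> 0}"
      by (rule finite_subset[OF _ finite_UnI[OF rep(1)[OF u] rep(1)[OF v]]]) auto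
    from finite_rep_class_of[OF infinite_vertices this]
    show "finite_rep (u + v) a = finite_rep u a + finite_rep v a"
      by (simp add: class_of_add rep(2) u v)
  next
    fix k and u :: "'v potential" assume u: "u \<in> finitely_supported"
    have "finite {y. k * finite_rep u y \<noteq> 0}"
      by (rule finite_subset[OF _ rep(1)[OF u]]) auto
    from finite_rep_class_of[OF infinite_vertices this]
    show "finite_rep (scale_potential k u) a = k * finite_rep u a"
      by (simp add: class_of_scale rep(2) u)
  next
    fix u :: "'v potential" assume u: "u \<in> finitely_supported"
    \<comment> \<open>\<open>capacity_bound\<close> does not record the sign of \<open>C\<close>,
      hence the absolute value.\<close>
    show "cmod (finite_rep u a) \<le> sqrt \<bar>C\<bar> * energy_norm c u"
    proof (rule power2_le_imp_le)
      have "(cmod (finite_rep u a))\<^sup>2 \<le> C * (energy_norm c u)\<^sup>2"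
        using C[OF rep(1)[OF u]] by (simp add: rep(2) u)
      also have "\<dots> \<le> \<bar>C\<bar> * (energy_norm c u)\<^sup>2" by (intro mult_right_mono) auto
      finally show "(cmod (finite_rep u a))\<^sup>2 \<le> (sqrt \<bar>C\<bar> * energy_norm c u)\<^sup>2"
        by (simp add: power_mult_distrib)
    qed (simp add: energy_norm_nonneg)
  qed
  then obtain p where p: "p \<in> energy_closure c finitely_supported"
    and rep_p: "\<And>h. h \<in> finitely_supported \<Longrightarrow> energy c p h = finite_rep h a" by blast
  have pH: "p \<in> energy_space c" using p energy_closure_subset by blast
  have "laplacian c p y = dirac a y" for y
  proof -
    have "laplacian c p y = cnj (energy c p (class_of (dirac y)))"
      unfolding energy_dirac[OF pH, symmetric] by (rule energy_cnj)
    also have "energy c p (class_of (dirac y)) = dirac y a"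
      unfolding rep_p[OF dirac_finitely_supported]
      by (simp add: finite_rep_class_of[OF infinite_vertices finite_support_dirac])
    finally show ?thesis by (simp add: dirac_def)
  qed
  then show ?thesis using pH by (auto simp: monopole_def)
qed

text \<open>A monopole sees an actual value, not just an increment, which makes evaluation
  continuous on finitely supported classes.\<close>

lemma energy_monopole_finite_support:
  assumes w: "monopole c a w" and f: "finite {y. f y \<noteq> 0}"
  shows "energy c w (class_of f) = f a"
proof -
  have wH: "w \<in> energy_space c" and lap: "laplacian c w = dirac a" using w by (auto simp: monopole_def)
  have "energy c (class_of f) w = (\<Sum>y | f y \<noteq> 0. if y = a then cnj (f a) else 0)"
    unfolding energy_finite_support[OF f wH] lap by (intro sum.cong) (auto simp: dirac_def)
  also have "\<dots> = cnj (f a)" using f by simp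
  finally have "energy c (class_of f) w = cnj (f a)" .
  then show ?thesis by (subst energy_cnj) simp
qed

context
  fixes a :: 'v and w\<^sub>0
  assumes monopole_exists: "monopole c a w\<^sub>0"
begin

abbreviation (input) w\<^sub>a where "w\<^sub>a \<equiv> minimal_monopole c a"

lemma w\<^sub>a: "monopole c a w\<^sub>a" "w\<^sub>a \<in> Fin c" "w\<^sub>a \<in> energy_space c" "laplacian c w\<^sub>a y = dirac a y"
  using minimal_monopole[OF monopole_exists] by (auto simp: monopole_def)

lemma monopole_v_in: "monopole_v c a y \<in> lap_domain c a" "monopole_v c a y \<in> energy_space c"
  using monopole_v_lap_domain(1)[OF monopole_exists] lap_domain_energy_space by blast+

lemma laplacian_monopole_v: "laplacian c (monopole_v c a y) = dirac y"
  by (rule ext) (simp add: monopole_v_def laplacian_add dipole_energy_space w\<^sub>a laplacian_dipole)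

lemma laplacian_monopole_f: "laplacian c (monopole_f c a y) = dirac y"
  by (rule ext) (simp add: monopole_f_def laplacian_add dipole_energy_space proj_Fin_energy_space
      laplacian_proj_Fin w\<^sub>a laplacian_dipole)

lemma monopole_f_in: "monopole_f c a y \<in> lap_domain c a" "monopole_f c a y \<in> Fin c"
proof -
  show "monopole_f c a y \<in> lap_domain c a" by (rule monopole_v_lap_domain(2)[OF monopole_exists])
  show "monopole_f c a y \<in> Fin c"
    unfolding monopole_f_def
    by (rule potential.subspace_add[OF subspace_Fin proj_Fin_in[OF dipole_energy_space] w\<^sub>a(2)])
qed

lemma shifted_range_dense:
  assumes e: "0 < e" and g: "g \<in> energy_space c"
    and orth: "\<And>u. u \<in> lap_domain c a \<Longrightarrow>
      energy c (scale_potential (complex_of_real e) u + class_of (laplacian c u)) g = 0"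
  shows "g = 0"
proof -
  let ?e = "complex_of_real e"
  have split: "?e * energy c u g + energy c (class_of (laplacian c u)) g = 0" if u: "u \<in> lap_domain c a" for u
  proof -
    have "energy c (scale_potential ?e u + class_of (laplacian c u)) g
        = ?e * energy c u g + energy c (class_of (laplacian c u)) g"
      by (simp add: energy_add_left energy_scale_left g energy_space_scale
          lap_domain_energy_space[OF u] class_laplacian_energy_space[OF u])
    then show ?thesis using orth[OF u] by simp
  qed
  \<comment> \<open>The Laplacian vanishes on these domain elements, so orthogonality reduces to
    \<open>e\<close> times the pairing with \<open>g\<close>.\<close>
  have harm: "energy c (dipole c a y - proj_Fin c (dipole c a y)) g = 0" for y
  proof -
    let ?h = "dipole c a y - proj_Fin c (dipole c a y)"
    have h: "?h = monopole_v c a y - monopole_f c a y" by (simp add: monopole_v_def monopole_f_def)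
    have hD: "?h \<in> lap_domain c a"
      unfolding h by (rule potential.subspace_diff[OF lap_domain_subspace monopole_v_in(1) monopole_f_in(1)])
    have "laplacian c ?h = (\<lambda>_. 0)"
      by (rule ext) (simp add: laplacian_diff laplacian_proj_Fin dipole_energy_space proj_Fin_energy_space)
    then have "class_of (laplacian c ?h) = 0" by (simp add: zero_potential.abs_eq)
    moreover have "energy c 0 g = 0" using energy_scale_left[of 0 0 g] by simp
    ultimately show ?thesis using split[OF hD] e by simp
  qed
  then have gF: "g \<in> Fin c" by (rule orthogonal_harmonic_dipoles_imp_Fin[OF g])
  \<comment> \<open>Pairing with \<open>monopole_v c a y\<close> instead of the dipole fixes the
    additive constant of the representative of \<open>g\<close>.\<close>
  define D where "D y = energy c (monopole_v c a y) g" for y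
  have D: "D y = increment g a y + energy c w\<^sub>a g" for y
    unfolding D_def monopole_v_def
    by (simp add: energy_add_left dipole_energy_space w\<^sub>a g energy_dipole)
  have gD: "class_of D = g"
  proof -
    have "D = (\<lambda>y. increment g a y + energy c w\<^sub>a g)" by (rule ext) (rule D)
    then show ?thesis by (simp only: class_of_add_constant class_of_increment)
  qed
  obtain s where s: "\<And>n. s n \<in> finitely_supported" and slim: "energy_tendsto c s g"
    using energy_closureD[OF gF[unfolded Fin_eq]] by blast
  define \<phi> where "\<phi> n = finite_rep (s n)" for n
  have fin: "finite {y. \<phi> n y \<noteq> 0}" and s\<phi>: "class_of (\<phi> n) = s n" for n
    unfolding \<phi>_def using finitely_supportedE[OF infinite_vertices s] by auto
  have sH: "s n \<in> energy_space c" for n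
    unfolding s\<phi>[symmetric] by (rule finite_support_energy_space[OF fin])
  \<comment> \<open>With this choice of constant the finitely supported representatives converge in
    value to \<open>D\<close>, not merely in increments.\<close>
  have pw: "(\<lambda>n. \<phi> n y) \<longlonglongrightarrow> D y" for y
  proof -
    have "energy c (monopole_v c a y) (s n) = \<phi> n y" for n
    proof -
      have "energy c (monopole_v c a y) (s n) = increment (s n) a y + energy c w\<^sub>a (s n)"
        unfolding monopole_v_def by (simp add: energy_add_left dipole_energy_space w\<^sub>a sH energy_dipole)
      then show ?thesis
        unfolding s\<phi>[symmetric] energy_monopole_finite_support[OF w\<^sub>a(1) fin] increment_class_of by simp
    qed
    then show ?thesis
      using energy_tendsto_energy_right[OF sH g monopole_v_in(2) slim, of y] by (simp only: D_def)
  qed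
  have "class_of D = 0"
  proof (rule no_eigenfunction_in_Fin[OF _ e _ fin _ pw])
    show "class_of D \<in> energy_space c" by (simp only: gD g)
    show "energy_tendsto c (\<lambda>n. class_of (\<phi> n)) (class_of D)" by (simp only: gD s\<phi> slim)
    show "laplacian c (class_of D) y = - ?e * D y" for y
    proof -
      \<comment> \<open>Orthogonality at \<open>monopole_v c a y\<close>, whose Laplacian is exactly
        \<open>dirac y\<close>; no constant remains.\<close>
      have "?e * D y + laplacian c g y = 0"
        using split[OF monopole_v_in(1), of y]
        unfolding laplacian_monopole_v energy_dirac[OF g] D_def .
      then show ?thesis unfolding gD by (simp add: add_eq_0_iff)
    qed
  qed
  then show ?thesis by (simp only: gD)
qed

text \<open>The range of the shifted operator is dense by \<open>shifted_range_dense\<close>;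
  coercivity makes preimages of a sequence converging to \<open>g\<close> Cauchy, and their limit
  lies in the domain of the closure.\<close>

lemma resolvent_exists:
  assumes e: "0 < e" and g: "g \<in> energy_space c"
  shows "\<exists>f. (f, g - scale_potential (complex_of_real e) f) \<in> lap_closure c a"
proof -
  let ?e = "complex_of_real e"
  define A where "A u = scale_potential ?e u + class_of (laplacian c u)" for u
  note dom = lap_domain_subspace[of a, unfolded potential.subspace_def]
  have A_H: "A u \<in> energy_space c" if "u \<in> lap_domain c a" for u
    unfolding A_def using that
    by (intro energy_space_add energy_space_scale lap_domain_energy_space class_laplacian_energy_space)
  have A_add: "A (u + v) = A u + A v" if "u \<in> lap_domain c a" "v \<in> lap_domain c a" for u v
    unfolding A_def class_laplacian_add[OF that] potential.scale_right_distrib by simp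
  have A_scale: "A (scale_potential k u) = scale_potential k (A u)" if "u \<in> lap_domain c a" for u k
    unfolding A_def class_laplacian_scale[OF that] potential.scale_right_distrib
    by (simp add: mult.commute)
  have A_diff: "A (u - v) = A u - A v" if "u \<in> lap_domain c a" "v \<in> lap_domain c a" for u v
    unfolding A_def class_laplacian_diff[OF that] potential.scale_right_diff_distrib by simp
  let ?R = "A ` lap_domain c a"
  have RH: "?R \<subseteq> energy_space c" using A_H by blast
  have R: "potential.subspace ?R"
    unfolding potential.subspace_def
  proof (intro conjI ballI allI)
    have "A (scale_potential 0 0) = scale_potential 0 (A 0)" by (rule A_scale) (use dom in blast)
    then have "A 0 = 0" by simp
    then show "0 \<in> ?R" using dom by (metis image_eqI)
    fix p assume "p \<in> ?R"
    then obtain u where u: "u \<in> lap_domain c a" "p = A u" by blast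
    show "scale_potential k p \<in> ?R" for k
      unfolding u(2) A_scale[OF u(1), symmetric] by (rule imageI) (use dom u in blast)
    fix q assume "q \<in> ?R"
    then obtain v where v: "v \<in> lap_domain c a" "q = A v" by blast
    show "p + q \<in> ?R"
      unfolding u(2) v(2) A_add[OF u(1) v(1), symmetric] by (rule imageI) (use dom u v in blast)
  qed
  obtain p where p: "p \<in> energy_closure c ?R" and orth: "\<And>h. h \<in> ?R \<Longrightarrow> energy c (g - p) h = 0"
    using orthogonal_projection[OF RH R g] by blast
  have pH: "p \<in> energy_space c" using p energy_closure_subset by blast
  have "g - p = 0"
  proof (rule shifted_range_dense[OF e energy_space_diff[OF g pH]])
    fix u assume "u \<in> lap_domain c a"
    then have "energy c (g - p) (A u) = 0" by (intro orth imageI)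
    then show "energy c (scale_potential ?e u + class_of (laplacian c u)) (g - p) = 0"
      unfolding A_def by (rule energy_eq_0_commute)
  qed
  then have "g \<in> energy_closure c ?R" using p by simp
  then obtain r where r: "\<And>n. r n \<in> ?R" and rlim: "energy_tendsto c r g"
    using energy_closureD by blast
  have "\<forall>n. \<exists>u. u \<in> lap_domain c a \<and> r n = A u" using r by blast
  then obtain s where s: "\<And>n. s n \<in> lap_domain c a" and rs: "\<And>n. r n = A (s n)" by metis
  have sH: "s n \<in> energy_space c" for n by (rule lap_domain_energy_space[OF s])
  have rH: "r n \<in> energy_space c" for n unfolding rs by (rule A_H[OF s])
  have coer: "e * energy_norm c (s m - s n) \<le> energy_norm c (r m - r n)" for m n
    using lap_domain_coercive[OF potential.subspace_diff[OF lap_domain_subspace s s] e, of m n]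
    unfolding rs A_diff[OF s s, symmetric] by (simp only: A_def)
  have "\<exists>N. \<forall>m\<ge>N. \<forall>n\<ge>N. energy_norm c (s m - s n) < d" if d: "0 < d" for d
  proof -
    have "0 < e * d" using e d by simp
    from energy_tendsto_Cauchy[OF rH g rlim this]
    obtain N where N: "\<forall>m\<ge>N. \<forall>n\<ge>N. energy_norm c (r m - r n) < e * d" by blast
    have "energy_norm c (s m - s n) < d" if "m \<ge> N" "n \<ge> N" for m n
    proof -
      have "e * energy_norm c (s m - s n) < e * d" using coer[of m n] N that by fastforce
      then show ?thesis using e by simp
    qed
    then show ?thesis by blast
  qed
  then obtain f where f: "f \<in> energy_space c" and slim: "energy_tendsto c s f"
    using energy_space_complete[of s, OF sH] by blast
  have lap: "class_of (laplacian c (s n)) = r n - scale_potential ?e (s n)" for n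
    by (simp add: rs A_def)
  have "energy_tendsto c (\<lambda>n. class_of (laplacian c (s n))) (g - scale_potential ?e f)"
    unfolding lap
    by (intro energy_tendsto_diff energy_tendsto_scale energy_space_scale rH g rlim sH f slim)
  moreover have "(s n, class_of (laplacian c (s n))) \<in> lap_graph c a" for n
    using s[of n] unfolding lap_graph_def by blast
  ultimately have "\<exists>s t. (\<forall>n. (s n, t n) \<in> lap_graph c a) \<and>
      energy_tendsto c s f \<and> energy_tendsto c t (g - scale_potential ?e f)"
    using slim by - (rule exI[of _ s], rule exI[of _ "\<lambda>n. class_of (laplacian c (s n))"], simp)
  then have "(f, g - scale_potential ?e f) \<in> lap_closure c a"
    unfolding lap_closure_def graph_closure_def
    using f energy_space_diff[OF g energy_space_scale[OF f]] by simp
  then show ?thesis by blast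
qed

text \<open>Each Dirac mass is the Laplacian of a \<open>monopole_v\<close>, and the image is a
  subspace. Its closure is therefore all of Fin.\<close>

lemma finitely_supported_laplacian:
  assumes "h \<in> finitely_supported"
  shows "\<exists>z\<in>lap_domain c a. class_of (laplacian c z) = h"
proof -
  let ?R = "(\<lambda>u. class_of (laplacian c u)) ` lap_domain c a"
  note dom = lap_domain_subspace[of a, unfolded potential.subspace_def]
  have "potential.subspace ?R"
    unfolding potential.subspace_def
  proof (intro conjI ballI allI)
    have "class_of (laplacian c (scale_potential 0 0)) = scale_potential 0 (class_of (laplacian c 0))"
      by (rule class_laplacian_scale) (use dom in blast)
    then have "class_of (laplacian c 0) = 0" by simp
    then show "0 \<in> ?R" using dom by (metis image_eqI)
    fix p assume "p \<in> ?R"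
    then obtain u where u: "u \<in> lap_domain c a" "p = class_of (laplacian c u)" by blast
    show "scale_potential k p \<in> ?R" for k
      unfolding u(2) class_laplacian_scale[OF u(1), symmetric] by (rule imageI) (use dom u in blast)
    fix q assume "q \<in> ?R"
    then obtain v where v: "v \<in> lap_domain c a" "q = class_of (laplacian c v)" by blast
    show "p + q \<in> ?R"
      unfolding u(2) v(2) class_laplacian_add[OF u(1) v(1), symmetric] by (rule imageI) (use dom u v in blast)
  qed
  moreover have "range (\<lambda>y. class_of (dirac y)) \<subseteq> ?R"
  proof (rule image_subsetI)
    fix y
    have "class_of (laplacian c (monopole_v c a y)) \<in> ?R" by (rule imageI) (rule monopole_v_in)
    then show "class_of (dirac y) \<in> ?R" by (simp only: laplacian_monopole_v)
  qed
  ultimately have "potential.span (range (\<lambda>y. class_of (dirac y))) \<subseteq> ?R"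
    by (intro potential.span_minimal)
  then have "h \<in> ?R" unfolding span_dirac using assms by (rule subsetD)
  then show ?thesis by blast
qed

text \<open>With \<open>w = w\<^sub>x\<^sup>f\<close>, \<open>\<Delta>w = \<delta>\<^sub>x\<close> and \<open>z\<close> in the domain, comparing the resolvent equation with
  the one for \<open>w - \<epsilon>z\<close> gives \<open>\<parallel>w - f\<parallel> \<le> \<parallel>w - \<Delta>z\<parallel> + 2\<epsilon>\<parallel>z\<parallel>\<close>, and \<open>w \<in> Fin\<close> is a limit
  of elements \<open>\<Delta>z\<close>.\<close>

lemma resolvent_error:
  assumes f: "(f, class_of (dirac x) - scale_potential (complex_of_real e) f) \<in> lap_closure c a"
    and e: "0 < e" and z: "z \<in> lap_domain c a"
  shows "energy_norm c (f - monopole_f c a x)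
    \<le> energy_norm c (monopole_f c a x - class_of (laplacian c z)) + 2 * e * energy_norm c z"
proof -
  let ?e = "complex_of_real e" and ?w = "monopole_f c a x" and ?Az = "class_of (laplacian c z)"
  \<comment> \<open>An approximate solution: its residual is \<open>e\<close> times
    \<open>?w - e z - ?Az\<close>, and this \<open>e\<close> cancels the one in the coercive
    bound.\<close>
  let ?u = "?w - scale_potential ?e z"
  have fH: "f \<in> energy_space c" by (rule lap_closure_laplacian(1)[OF f])
  have zH: "z \<in> energy_space c" by (rule lap_domain_energy_space[OF z])
  have wH: "?w \<in> energy_space c" by (rule lap_domain_energy_space[OF monopole_f_in(1)])
  have AH: "?Az \<in> energy_space c" by (rule class_laplacian_energy_space[OF z])
  have ez: "scale_potential ?e z \<in> lap_domain c a"
    using lap_domain_subspace[of a] z unfolding potential.subspace_def by blast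
  have u: "?u \<in> lap_domain c a"
    by (rule potential.subspace_diff[OF lap_domain_subspace monopole_f_in(1) ez])
  have "class_of (laplacian c ?u) = class_of (dirac x) - scale_potential ?e ?Az"
    unfolding class_laplacian_diff[OF monopole_f_in(1) ez] class_laplacian_scale[OF z] laplacian_monopole_f ..
  then have "scale_potential ?e (?u - f) + (class_of (laplacian c ?u) - (class_of (dirac x) - scale_potential ?e f))
      = scale_potential ?e (?w - scale_potential ?e z - ?Az)"
    by (simp only: potential.scale_right_diff_distrib) (simp add: algebra_simps)
  with lap_closure_coercive[OF f u e]
  have "e * energy_norm c (?u - f) \<le> e * energy_norm c (?w - scale_potential ?e z - ?Az)"
    using e by (simp only: energy_norm_scale norm_of_real abs_of_pos)
  then have 1: "energy_norm c (?u - f) \<le> energy_norm c (?w - scale_potential ?e z - ?Az)"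
    using e by simp
  have ezH: "scale_potential ?e z \<in> energy_space c" by (rule energy_space_scale[OF zH])
  have ezN: "energy_norm c (scale_potential ?e z) = e * energy_norm c z"
    using e by (simp add: energy_norm_scale)
  have "?w - scale_potential ?e z - ?Az = (?w - ?Az) + scale_potential (- ?e) z" by simp
  note eq = this
  have 2: "energy_norm c (?w - scale_potential ?e z - ?Az) \<le> energy_norm c (?w - ?Az) + e * energy_norm c z"
    unfolding eq
    using energy_norm_triangle[OF energy_space_diff[OF wH AH] energy_space_scale[OF zH, of "- ?e"]] e
      energy_norm_scale[of "- ?e" z] by (simp del: potential.scale_minus_left)
  \<comment> \<open>Returning from \<open>?u\<close> to \<open>?w\<close> costs the second
    \<open>e * energy_norm c z\<close>.\<close>
  have "?w - f = (?u - f) + scale_potential ?e z" by simp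
  then have 3: "energy_norm c (?w - f) \<le> energy_norm c (?u - f) + e * energy_norm c z"
    using energy_norm_triangle[OF energy_space_diff[OF energy_space_diff[OF wH ezH] fH] ezH] ezN by simp
  show ?thesis using 1 2 3 energy_norm_minus[of f ?w] by simp
qed

text \<open>The order of choices matters: \<open>z\<close> is fixed from the approximation of the
  limit in Fin before \<open>\<epsilon> k\<close> is made small against the norm of
  \<open>z\<close>.\<close>

lemma resolvent_tendsto:
  assumes f: "\<And>k. (f k, class_of (dirac x) - scale_potential (complex_of_real (\<epsilon> k)) (f k)) \<in> lap_closure c a"
    and pos: "\<And>k. 0 < \<epsilon> k" and eps: "\<epsilon> \<longlonglongrightarrow> 0"
  shows "energy_tendsto c f (monopole_f c a x)"
  unfolding energy_tendsto_def
proof (rule LIMSEQ_I)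
  let ?w = "monopole_f c a x"
  fix r :: real assume r: "0 < r"
  obtain h where h: "\<And>n. h n \<in> finitely_supported" and hlim: "energy_tendsto c h ?w"
    using energy_closureD[OF monopole_f_in(2)[unfolded Fin_eq]] by blast
  have "\<forall>\<^sub>F n in sequentially. energy_norm c (h n - ?w) < r / 2"
    by (rule order_tendstoD(2)[OF hlim[unfolded energy_tendsto_def]]) (use r in simp)
  then obtain n where n: "energy_norm c (h n - ?w) < r / 2"
    using eventually_happens'[OF sequentially_bot] by blast
  obtain z where z: "z \<in> lap_domain c a" "class_of (laplacian c z) = h n"
    using finitely_supported_laplacian[OF h] by blast
  have "(\<lambda>k. 2 * \<epsilon> k * energy_norm c z) \<longlonglongrightarrow> 2 * 0 * energy_norm c z"
    by (intro tendsto_intros eps)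
  then have "\<forall>\<^sub>F k in sequentially. 2 * \<epsilon> k * energy_norm c z < r / 2"
    using r by (intro order_tendstoD(2)) auto
  then obtain N where N: "\<And>k. k \<ge> N \<Longrightarrow> 2 * \<epsilon> k * energy_norm c z < r / 2"
    unfolding eventually_sequentially by blast
  have "norm (energy_norm c (f k - ?w) - 0) < r" if "k \<ge> N" for k
    using resolvent_error[OF f pos z(1), of k] N[OF that] n energy_norm_minus[of "h n" ?w]
      energy_norm_nonneg[of "f k - ?w"] by (simp add: z(2))
  then show "\<exists>N. \<forall>k\<ge>N. norm (energy_norm c (f k - ?w) - 0) < r" by blast
qed

end

lemma transient_resolvent:
  assumes "transient c"
  shows "\<exists>(\<epsilon> :: nat \<Rightarrow> real) f. (\<forall>k. 0 < \<epsilon> k) \<and> \<epsilon> \<longlonglongrightarrow> 0 \<and>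
      (\<forall>k. (class_of (dirac x), f k) \<in> (shift_operator (\<epsilon> k) (lap_closure c a))\<inverse>) \<and>
      weak_star_convergent c f"
proof -
  obtain w where w: "monopole c a w" using transient_monopole[OF assms] by blast
  define \<epsilon> where "\<epsilon> k = inverse (real (Suc k))" for k
  have pos: "0 < \<epsilon> k" for k by (simp add: \<epsilon>_def)
  have eps: "\<epsilon> \<longlonglongrightarrow> 0" unfolding \<epsilon>_def by (rule LIMSEQ_inverse_real_of_nat)
  have "\<forall>k. \<exists>f. (f, class_of (dirac x) - scale_potential (complex_of_real (\<epsilon> k)) f) \<in> lap_closure c a"
    using resolvent_exists[OF w pos dirac_energy_space] by blast
  then obtain f where f: "\<And>k. (f k, class_of (dirac x) - scale_potential (complex_of_real (\<epsilon> k)) (f k)) \<in> lap_closure c a"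
    by metis
  have fH: "f k \<in> energy_space c" for k by (rule lap_closure_laplacian(1)[OF f])
  have wH: "monopole_f c a x \<in> energy_space c"
    by (rule lap_domain_energy_space[OF monopole_f_in(1)[OF w]])
  have lim: "energy_tendsto c f (monopole_f c a x)" by (rule resolvent_tendsto[OF w f pos eps])
  have "weak_star_convergent c f"
    unfolding weak_star_convergent_def
    using energy_tendsto_energy_left[OF fH wH _ lim] wH by blast
  moreover have "(class_of (dirac x), f k) \<in> (shift_operator (\<epsilon> k) (lap_closure c a))\<inverse>" for k
    unfolding shift_operator_def converse_iff mem_Collect_eq
    by (rule exI[of _ "f k"], rule exI, rule conjI[OF _ f]) simp
  ultimately show ?thesis using pos eps by blast
qed

end

theorem theorem4p7:
  fixes c :: "'v \<Rightarrow> 'v \<Rightarrow> real" and a x :: 'v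
  assumes "resistance_network c"
    and "infinite (UNIV :: 'v set)"
  shows "transient c \<longleftrightarrow>
    (\<exists>(\<epsilon> :: nat \<Rightarrow> real) (f :: nat \<Rightarrow> 'v potential).
      (\<forall>k. 0 < \<epsilon> k) \<and> \<epsilon> \<longlonglongrightarrow> 0 \<and>
      (\<forall>k. (class_of (dirac x), f k) \<in> (shift_operator (\<epsilon> k) (lap_closure c a))\<inverse>) \<and>
      weak_star_convergent c f)"
proof -
  interpret infinite_network c
    using assms by (simp add: infinite_network_def infinite_network_axioms_def)
  show ?thesis
  proof
    assume "transient c"
    then show "\<exists>(\<epsilon> :: nat \<Rightarrow> real) (f :: nat \<Rightarrow> 'v potential).
        (\<forall>k. 0 < \<epsilon> k) \<and> \<epsilon> \<longlonglongrightarrow> 0 \<and>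
        (\<forall>k. (class_of (dirac x), f k) \<in> (shift_operator (\<epsilon> k) (lap_closure c a))\<inverse>) \<and>
        weak_star_convergent c f"
      by (rule transient_resolvent)
  next
    assume "\<exists>(\<epsilon> :: nat \<Rightarrow> real) (f :: nat \<Rightarrow> 'v potential).
        (\<forall>k. 0 < \<epsilon> k) \<and> \<epsilon> \<longlonglongrightarrow> 0 \<and>
        (\<forall>k. (class_of (dirac x), f k) \<in> (shift_operator (\<epsilon> k) (lap_closure c a))\<inverse>) \<and>
        weak_star_convergent c f"
    then obtain \<epsilon> f where "\<epsilon> \<longlonglongrightarrow> (0 :: real)"
        "\<And>k. (class_of (dirac x), f k) \<in> (shift_operator (\<epsilon> k) (lap_closure c a))\<inverse>"
        "weak_star_convergent c f"
      by blast
    then obtain u K where "u \<in> energy_space c" "\<And>y. laplacian c u y = dirac x y + K"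
      using weak_limit_laplacian by blast
    then show "transient c" by (rule transient_if_dirac_plus_constant)
  qed
qed

end
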